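(* Consider the advanced model together with $\mathbf{RandEdge}$ queries, with $n$ known to the algorithm, and let $\varepsilon\in(0,1)$. (a) There is a randomized algorithm that outputs a $(1+\varepsilon)$-approximation to $d$ using $\widetilde{O}\left(\varepsilon^{-2}\min\left(d, \sqrt[4]{n/d}\right)\right)$ queries. In particular, it outputs a $(1+\varepsilon)$-approximation to $d$ using $\widetilde{O}\left(\varepsilon^{-2}n^{1/5}\right)$ queries. (b) Any algorithm in this setting that outputs a constant factor approximation to $d$ requires $\Omega(n^{1/5})$ queries. This holds even when $\mathbf{Additive}$ is replaced by the stronger full neighborhood access ($\mathbf{FullNbrHood}$) oracle.
   Context: $G=(V,E)$ is an unknown simple undirected graph with $n=|V|$ vertices and $m=|E|$ edges, no isolated vertices, and average degree $d=2m/n$. Access to $G$ is only through oracles: - $\mathbf{RandVert}()$ returns a uniformly random vertex. - $\mathbf{RandNbr}(x)$ returns a uniformly random neighbor of $x$. - $\mathbf{Degree}(x)$ returns $\deg(x)$. - $\mathbf{Additive}(S)$, for $S\subseteq V$, returns the number of edges with both endpoints in $S$ and costs $|S|$. - $\mathbf{RandEdge}()$ returns a uniformly random edge. - $\mathbf{FullNbrHood}(x)$ returns the full adjacency list of $x$. All queries other than $\mathbf{Additive}$ cost $1$, and the query complexity is the total cost. The advanced model gives $\mathbf{RandVert}$, $\mathbf{RandNbr}$, $\mathbf{Degree}$ and $\mathbf{Additive}$. A $(1+\varepsilon)$-approximation to $d$ is a value in $[(1-\varepsilon)d,(1+\varepsilon)d]$. A constant factor approximation is a value in $[d/c,cd]$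 for a constant $c$. Randomized guarantees hold with probability at least $0.99$. $\widetilde{O}$ hides factors polylogarithmic in $n$. *)

theory Defs
  imports "HOL-Probability.Probability"
begin

text \<open>
  Vertices are labelled by arbitrary natural numbers. The algorithm is told only the number of
  vertices, not the vertex set \<open>V\<close>; an edge is the set of its two endpoints.
\<close>

definition simple_graph :: "nat set \<Rightarrow> nat set set \<Rightarrow> bool" where
  "simple_graph V E \<longleftrightarrow> finite V \<and> V \<noteq> {} \<and> (\<forall>e\<in>E. e \<subseteq> V \<and> card e = 2)"

definition nbrs :: "nat set set \<Rightarrow> nat \<Rightarrow> nat set" where
  "nbrs E x = {y. {x, y} \<in> E}"

definition deg :: "nat set set \<Rightarrow> nat \<Rightarrow> nat" where
  "deg E x = card (nbrs E x)"

definition no_isolated :: "nat set \<Rightarrow> nat set set \<Rightarrow> bool" where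
  "no_isolated V E \<longleftrightarrow> (\<forall>x\<in>V. nbrs E x \<noteq> {})"

definition graph_on :: "nat \<Rightarrow> nat set \<Rightarrow> nat set set \<Rightarrow> bool" where
  "graph_on n V E \<longleftrightarrow> simple_graph V E \<and> no_isolated V E \<and> card V = n"

definition avg_degree :: "nat set \<Rightarrow> nat set set \<Rightarrow> real" where
  "avg_degree V E = 2 * real (card E) / real (card V)"


datatype query =
    RandVert
  | RandNbr nat
  | Degree nat
  | Additive "nat set"
  | RandEdge
  | FullNbrHood nat

datatype answer = Vertex nat | Number nat | Edge "nat set" | Nbrs "nat set"

primrec query_cost :: "query \<Rightarrow> nat" where
  "query_cost RandVert = 1"
| "query_cost (RandNbr x) = 1"
| "query_cost (Degree x) = 1"
| "query_cost (Additive S) = card S"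
| "query_cost RandEdge = 1"
| "query_cost (FullNbrHood x) = 1"

primrec query_args :: "query \<Rightarrow> nat set" where
  "query_args RandVert = {}"
| "query_args (RandNbr x) = {x}"
| "query_args (Degree x) = {x}"
| "query_args (Additive S) = S"
| "query_args RandEdge = {}"
| "query_args (FullNbrHood x) = {x}"

text \<open>
  The answers to queries whose arguments lie in \<open>V\<close>. Other queries are never answered,
  see \<open>run\<close>; in particular \<open>Additive\<close> is only answered on finite sets, so its cost
  \<open>card S\<close> is the true size. An adjacency list is given as a set, its order carrying no
  information.
\<close>

primrec respond :: "nat set \<Rightarrow> nat set set \<Rightarrow> query \<Rightarrow> answer pmf" where
  "respond V E RandVert = map_pmf Vertex (pmf_of_set V)"
| "respond V E (RandNbr x) = map_pmf Vertex (pmf_of_set (nbrs E x))"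
| "respond V E (Degree x) = return_pmf (Number (deg E x))"
| "respond V E (Additive S) = return_pmf (Number (card {e \<in> E. e \<subseteq> S}))"
| "respond V E RandEdge = map_pmf Edge (pmf_of_set E)"
| "respond V E (FullNbrHood x) = return_pmf (Nbrs (nbrs E x))"

definition advanced_queries :: "query set" where
  "advanced_queries = {RandVert} \<union> range RandNbr \<union> range Degree \<union> range Additive"

definition advanced_edge_queries :: "query set" where
  "advanced_edge_queries = insert RandEdge advanced_queries"

definition full_nbrhood_edge_queries :: "query set" where
  "full_nbrhood_edge_queries =
     (advanced_edge_queries - range Additive) \<union> range FullNbrHood"


text \<open>
  A randomized adaptive query algorithm is a decision tree: it outputs a number, branches on
  private randomness (at no cost), or asks a query and continues according to the answer.
  Every branch is finite, but depth need not be bounded and branching may be infinite. Halting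
  on every branch is no restriction for the success criterion \<open>succeeds\<close> below, which
  only counts runs that stay within a given query budget.
\<close>

datatype algorithm =
    Output real
  | Coin "nat pmf" "nat \<Rightarrow> algorithm"
  | Query query "answer \<Rightarrow> algorithm"

primrec only_queries :: "query set \<Rightarrow> algorithm \<Rightarrow> bool" where
  "only_queries Q (Output r) \<longleftrightarrow> True"
| "only_queries Q (Coin p k) \<longleftrightarrow> (\<forall>i. only_queries Q (k i))"
| "only_queries Q (Query q k) \<longleftrightarrow> q \<in> Q \<and> (\<forall>a. only_queries Q (k a))"

text \<open>
  The joint distribution of the output and the total query cost. Oracles accept only vertices
  of the graph: asking about anything else aborts the run without output (\<open>None\<close>).
\<close>

primrec run :: "nat set \<Rightarrow> nat set set \<Rightarrow> algorithm \<Rightarrow> (real option \<times> nat) pmf" where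
  "run V E (Output r) = return_pmf (Some r, 0)"
| "run V E (Coin p k) = bind_pmf p (\<lambda>i. run V E (k i))"
| "run V E (Query q k) =
     (if query_args q \<subseteq> V
      then bind_pmf (respond V E q)
             (\<lambda>a. map_pmf (\<lambda>(r, c). (r, query_cost q + c)) (run V E (k a)))
      else return_pmf (None, 0))"

text \<open>
  With probability at least 0.99 the algorithm both outputs a value in \<open>I\<close> and spends at most
  \<open>b\<close> on queries.
\<close>

definition succeeds ::
    "nat set \<Rightarrow> nat set set \<Rightarrow> algorithm \<Rightarrow> real set \<Rightarrow> real \<Rightarrow> bool" where
  "succeeds V E A I b \<longleftrightarrow>
     measure_pmf.prob (run V E A) {(r, c). (\<exists>y\<in>I. r = Some y) \<and> real c \<le> b} \<ge> 99 / 100"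

definition eps_approx :: "real \<Rightarrow> real \<Rightarrow> real set" where
  "eps_approx \<epsilon> d = {(1 - \<epsilon>) * d .. (1 + \<epsilon>) * d}"

definition factor_approx :: "real \<Rightarrow> real \<Rightarrow> real set" where
  "factor_approx c d = {d / c .. c * d}"

end

theory Submission
  imports Defs
begin

text \<open>
  A random endpoint \<open>v\<close> of a random edge is a vertex drawn with probability proportional to its degree,
  so \<open>1 / deg v\<close> has mean \<open>1 / d\<close> and relative variance at most \<open>d\<close>. To beat this for large \<open>d\<close>, fix a
  threshold \<open>\<theta>\<close> near the first quartile of the degree of \<open>v\<close>. Degrees truncated at \<open>\<theta>\<close> have relative
  variance about \<open>\<theta> / d\<close> at a uniform vertex. On the other hand, at least half of the edges join
  vertices above \<open>\<theta> / 2\<close>; for \<open>s\<close> pairs of independent samples \<open>x\<close>, \<open>y\<close> the number of adjacent pairs,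
  weighted by about \<open>1 / (deg x deg y)\<close>, estimates the reciprocal of the number of edges as soon as
  \<open>s\<^sup>2 \<theta>\<^sup>2\<close> exceeds a multiple of \<open>n d\<close>. One of the two succeeds for \<open>s\<close> of order \<open>(n / d) powr (1 / 4)\<close>.
  Additive queries evaluate the weighted count exactly: write the weights in binary and polarise. Since
  \<open>d\<close> and \<open>\<theta>\<close> are unknown, all scales are tried in increasing order of \<open>s\<close>, and an estimate is accepted
  only if the empirical means are so large that they are reliable.

  For the lower bound with \<open>t\<close> about \<open>n powr (1 / 5)\<close>, hide \<open>t\<^sup>2\<close> or \<open>K t\<^sup>2\<close> disjoint cliques of size \<open>2 t\<^sup>2\<close>
  among the vertices, the rest being sparse. Random vertices are almost always sparse, random edges lie
  almost always in a clique, and \<open>o(t)\<close> random edges rarely hit the same clique twice, so the two cases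
  look alike until about \<open>t\<close> queries have been made, whatever structure of the seen cliques is revealed.
\<close>

subsection \<open>Averages over random extensions\<close>

text \<open>Every trial produces a pair (X, Y) in which the mean of X is exactly d times the mean of
  Y, for every threshold and despite all rounding of weights. A badly chosen threshold therefore
  cannot bias the quotient, it can only make it noisy, and the search over scales has to detect
  nothing but noise. The fourth root arises as follows: if degrees truncated at \<theta> are too
  noisy for s samples, then \<theta> exceeds d s / 4, and the requirement that s^2 \<theta>^2 be of
  order n d turns into s^4 of order n / d. The bounds d and (n / d)^(1/4) meet at d = n^(1/5). For
  the lower bound the obstacle is that an algorithm may name arbitrary labels and may inspect all of
  a clique once it has seen it. Hence the cliques come from a pool so large that guessing is
  hopeless, and no edge leaves a clique, so what has been seen does not distinguish the sets that
  may still be hidden. A filler star makes up the difference in vertex count between the two cases,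
  and both are compared with one idealised process that does not know how many cliques there
  are.\<close>

lemma prob_bind_pmf:
  "measure_pmf.prob (bind_pmf p f) S = measure_pmf.expectation p (\<lambda>x. measure_pmf.prob (f x) S)"
proof -
  have "ennreal (measure_pmf.prob (bind_pmf p f) S) = emeasure (bind_pmf p f) S"
    by (simp add: measure_pmf.emeasure_eq_measure)
  also have "\<dots> = (\<integral>\<^sup>+x. ennreal (measure_pmf.prob (f x) S) \<partial>p)"
    by (simp add: measure_pmf.emeasure_eq_measure[symmetric])
  also have "\<dots> = ennreal (measure_pmf.expectation p (\<lambda>x. measure_pmf.prob (f x) S))"
    by (intro nn_integral_eq_integral measure_pmf.integrable_const_bound[where B = 1]) auto
  finally show ?thesis
    by (simp add: integral_nonneg)
qed

lemma integrable_prob [simp]: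
  "integrable (measure_pmf p) (\<lambda>x. measure_pmf.prob (f x) S)"
  by (rule measure_pmf.integrable_const_bound[where B = 1]) auto

text \<open>A plain quotient instead of an expectation: it is 0 on empty and infinite sets, so
  monotonicity and swapping need no side conditions.\<close>

definition avg :: "'a set \<Rightarrow> ('a \<Rightarrow> real) \<Rightarrow> real" where
  "avg S f = (\<Sum>x\<in>S. f x) / real (card S)"

lemma expectation_pmf_of_set:
  assumes "finite S" "S \<noteq> {}"
  shows "measure_pmf.expectation (pmf_of_set S) f = avg S f"
  using assms by (simp add: avg_def integral_pmf_of_set)

lemma avg_mono: "(\<And>x. x \<in> S \<Longrightarrow> f x \<le> g x) \<Longrightarrow> avg S f \<le> avg S g"
  by (simp add: avg_def divide_right_mono sum_mono)

lemma avg_cong: "(\<And>x. x \<in> S \<Longrightarrow> f x = g x) \<Longrightarrow> avg S f = avg S g"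
  by (simp add: avg_def)

lemma avg_add: "avg S (\<lambda>x. f x + g x) = avg S f + avg S g"
  by (simp add: avg_def sum.distrib add_divide_distrib)

lemma avg_const: "finite S \<Longrightarrow> S \<noteq> {} \<Longrightarrow> avg S (\<lambda>_. c) = c"
  by (simp add: avg_def)

lemma avg_nonneg: "(\<And>x. x \<in> S \<Longrightarrow> 0 \<le> f x) \<Longrightarrow> 0 \<le> avg S f"
  by (simp add: avg_def sum_nonneg)

lemma avg_swap: "avg S (\<lambda>x. avg T (f x)) = avg T (\<lambda>y. avg S (\<lambda>x. f x y))"
  unfolding avg_def by (simp add: sum_divide_distrib[symmetric] sum.swap[of _ S T] mult.commute)

lemma avg_expectation_swap:
  assumes "\<And>x y. \<bar>f x y\<bar> \<le> 1"
  shows "avg S (\<lambda>x. measure_pmf.expectation p (f x))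
       = measure_pmf.expectation p (\<lambda>y. avg S (\<lambda>x. f x y))"
proof -
  have "integrable (measure_pmf p) (f x)" for x
    by (rule measure_pmf.integrable_const_bound[where B = 1]) (use assms in auto)
  then show ?thesis unfolding avg_def by simp
qed

text \<open>Dividing the sum over \<open>T\<close> by \<open>card T\<close> instead of the larger
  \<open>card S\<close> only increases it, and the rest of \<open>S\<close> contributes at most its
  relative size. This is the price of pretending that a uniform sample fell into
  \<open>T\<close>.\<close>

lemma avg_indicator_bound:
  fixes f :: "'a \<Rightarrow> real"
  assumes S: "finite S" "S \<noteq> {}" and T: "T \<subseteq> S" "T \<noteq> {}"
    and f: "\<And>x. x \<in> S \<Longrightarrow> 0 \<le> f x \<and> f x \<le> 1"
  shows "avg S f \<le> avg T f + real (card (S - T)) / real (card S)"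
proof -
  have "finite T" using S T finite_subset by blast
  have "sum f S = sum f T + sum f (S - T)"
    using S T by (metis add.commute sum.subset_diff)
  also have "sum f (S - T) \<le> real (card (S - T))"
    using sum_bounded_above[of "S - T" f 1] f by auto
  finally have "avg S f \<le> (sum f T + real (card (S - T))) / real (card S)"
    unfolding avg_def by (intro divide_right_mono) auto
  also have "\<dots> = sum f T / real (card S) + real (card (S - T)) / real (card S)"
    by (simp add: add_divide_distrib)
  also have "sum f T / real (card S) \<le> sum f T / real (card T)"
    using S T f \<open>finite T\<close> by (intro divide_left_mono) (auto intro!: sum_nonneg card_mono simp: card_gt_0_iff)
  finally show ?thesis by (simp add: avg_def)
qed

text \<open>The hidden block sets that remain possible once the blocks in \<open>R\<close> are
  revealed; uniform choice among them is the conditional law of the hidden set.\<close>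

definition extensions :: "nat \<Rightarrow> nat \<Rightarrow> nat set \<Rightarrow> nat set set" where
  "extensions M N R = {C. R \<subseteq> C \<and> C \<subseteq> {..<M} \<and> card C = N}"

lemma finite_extensions [simp]: "finite (extensions M N R)"
  by (rule finite_subset[of _ "Pow {..<M}"]) (auto simp: extensions_def)

lemma finite_memb_extensions: "C \<in> extensions M N R \<Longrightarrow> finite C"
  by (auto simp: extensions_def intro: finite_subset)

lemma card_extensions:
  assumes "R \<subseteq> {..<M}" "card R \<le> N"
  shows "card (extensions M N R) = (M - card R) choose (N - card R)"
proof -
  have fin: "finite R" using assms finite_subset by blast
  have "bij_betw (\<lambda>C. C - R) (extensions M N R) {D. D \<subseteq> {..<M} - R \<and> card D = N - card R}"
  proof (rule bij_betw_byWitness[where f' = "\<lambda>D. D \<union> R"])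
    show "(\<lambda>D. D \<union> R) ` {D. D \<subseteq> {..<M} - R \<and> card D = N - card R} \<subseteq> extensions M N R"
    proof clarify
      fix D assume D: "D \<subseteq> {..<M} - R" "card D = N - card R"
      then have "finite D" using finite_subset by blast
      then have "card (D \<union> R) = card D + card R" using D fin by (intro card_Un_disjoint) auto
      then show "D \<union> R \<in> extensions M N R" using D assms by (auto simp: extensions_def)
    qed
  qed (use fin in \<open>auto simp: extensions_def card_Diff_subset\<close>)
  then have "card (extensions M N R) = card {D. D \<subseteq> {..<M} - R \<and> card D = N - card R}"
    by (rule bij_betw_same_card)
  also have "\<dots> = card ({..<M} - R) choose (N - card R)"
    by (rule n_subsets) simp
  also have "card ({..<M} - R) = M - card R"
    using assms fin by (simp add: card_Diff_subset)
  finally show ?thesis .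
qed

text \<open>The ratio of the two counts is the conditional probability that an unrevealed block is
  hidden. It is the same for every \<open>B\<close>, which is what makes a freshly revealed block
  uniform.\<close>

lemma card_extensions_insert:
  assumes "R \<subseteq> {..<M}" "card R < N" "N \<le> M" "B < M" "B \<notin> R"
  shows "(M - card R) * card (extensions M N (insert B R)) = (N - card R) * card (extensions M N R)"
proof -
  have fin: "finite R" using assms finite_subset by blast
  have "card (extensions M N (insert B R)) = (M - card R - 1) choose (N - card R - 1)"
    using card_extensions[of "insert B R" M N] assms fin by simp
  moreover have "card (extensions M N R) = (M - card R) choose (N - card R)"
    using card_extensions[of R M N] assms by simp
  ultimately show ?thesis using times_binomial_minus1_eq[of "N - card R" "M - card R"] assms by simp
qed

lemma extensions_nonempty:
  assumes "R \<subseteq> {..<M}" "card R \<le> N" "N \<le> M"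
  shows "extensions M N R \<noteq> {}"
proof -
  have "card (extensions M N R) > 0" using assms by (simp add: card_extensions)
  then show ?thesis by force
qed

text \<open>Deferred decisions: the hidden set may be drawn after the block that is revealed from it.\<close>

lemma avg_extensions_swap:
  assumes R: "R \<subseteq> {..<M}" "card R < N" "N \<le> M"
  shows "avg (extensions M N R) (\<lambda>C. avg (C - R) (\<lambda>B. f C B))
       = avg ({..<M} - R) (\<lambda>B. avg (extensions M N (insert B R)) (\<lambda>C. f C B))"
proof -
  have finR: "finite R" using R finite_subset by blast
  define a where "a = card (extensions M N R)"
  have a0: "a > 0" using extensions_nonempty[of R M N] R by (simp add: a_def card_gt_0_iff)
  have cC: "card (C - R) = N - card R" if "C \<in> extensions M N R" for C
    using that finR by (auto simp: extensions_def card_Diff_subset)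
  have "(\<Sum>C\<in>extensions M N R. \<Sum>B\<in>C - R. f C B)
      = (\<Sum>(C,B)\<in>Sigma (extensions M N R) (\<lambda>C. C - R). f C B)"
    by (rule sum.Sigma) (auto dest: finite_memb_extensions)
  \<comment> \<open>Pairs of a hidden set and one of its unrevealed blocks, now grouped by the
    block.\<close>
  also have "\<dots> = (\<Sum>(B,C)\<in>Sigma ({..<M} - R) (\<lambda>B. extensions M N (insert B R)). f C B)"
    by (rule sum.reindex_bij_witness[of _ prod.swap prod.swap]) (auto simp: extensions_def)
  also have "\<dots> = (\<Sum>B\<in>{..<M} - R. \<Sum>C\<in>extensions M N (insert B R). f C B)"
    by (rule sum.Sigma[symmetric]) auto
  finally have eq: "(\<Sum>C\<in>extensions M N R. \<Sum>B\<in>C - R. f C B)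
      = (\<Sum>B\<in>{..<M} - R. \<Sum>C\<in>extensions M N (insert B R). f C B)" .
  have cM: "card ({..<M} - R) = M - card R" using R finR by (simp add: card_Diff_subset)
  have ins: "real (card (extensions M N (insert B R))) = real (N - card R) * real a / real (M - card R)"
    if "B \<in> {..<M} - R" for B
  proof -
    have "real (M - card R) * real (card (extensions M N (insert B R))) = real (N - card R) * real a"
      using card_extensions_insert[of R M N B] that R unfolding a_def
      by (metis DiffD1 DiffD2 lessThan_iff of_nat_mult)
    then show ?thesis using R by (simp add: field_simps)
  qed
  have "avg (extensions M N R) (\<lambda>C. avg (C - R) (\<lambda>B. f C B))
     = (\<Sum>C\<in>extensions M N R. (\<Sum>B\<in>C - R. f C B) / real (N - card R)) / real a"
    unfolding avg_def a_def using cC by (simp cong: sum.cong)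
  also have "\<dots> = (\<Sum>C\<in>extensions M N R. \<Sum>B\<in>C - R. f C B) / (real (N - card R) * real a)"
    by (simp add: sum_divide_distrib[symmetric])
  also have "\<dots> = (\<Sum>B\<in>{..<M} - R. \<Sum>C\<in>extensions M N (insert B R). f C B) / (real (N - card R) * real a)"
    by (simp add: eq)
  also have "\<dots> = (\<Sum>B\<in>{..<M} - R. (\<Sum>C\<in>extensions M N (insert B R). f C B)
        / (real (N - card R) * real a / real (M - card R))) / real (M - card R)"
  proof -
    have "x / y = x / (y / z) / z" if "z \<noteq> 0" for x y z :: real
      using that by simp
    from this[of "real (M - card R)"] show ?thesis
      unfolding sum_divide_distrib[symmetric] using R by simp
  qed
  also have "\<dots> = avg ({..<M} - R) (\<lambda>B. avg (extensions M N (insert B R)) (\<lambda>C. f C B))"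
    unfolding avg_def cM
    by (intro arg_cong[where f = "\<lambda>x. x / real (M - card R)"] sum.cong refl) (simp only: ins)
  finally show ?thesis .
qed

text \<open>The conditional probability \<open>(N - card R) / (M - card R)\<close> is at most
  \<open>N / M\<close> because \<open>N \<le> M\<close>: knowing some hidden blocks does not help to
  guess another one.\<close>

lemma avg_extensions_mem:
  assumes "R \<subseteq> {..<M}" "card R < N" "N \<le> M" "B \<notin> R" "B < M"
  shows "avg (extensions M N R) (\<lambda>C. of_bool (B \<in> C)) \<le> real N / real M"
proof -
  let ?a = "card (extensions M N R)"
  have a0: "?a > 0" using extensions_nonempty[of R M N] assms by (simp add: card_gt_0_iff)
  have "(\<Sum>C\<in>extensions M N R. of_bool (B \<in> C)) = real (card {C \<in> extensions M N R. B \<in> C})"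
    by (simp add: sum.If_cases Int_def of_bool_def)
  also have "{C \<in> extensions M N R. B \<in> C} = extensions M N (insert B R)"
    by (auto simp: extensions_def)
  also have "real (card (extensions M N (insert B R))) = real (N - card R) * real ?a / real (M - card R)"
  proof -
    have "real (M - card R) * real (card (extensions M N (insert B R))) = real (N - card R) * real ?a"
      using card_extensions_insert[of R M N B] assms by (metis of_nat_mult)
    then show ?thesis using assms by (simp add: field_simps)
  qed
  finally have "avg (extensions M N R) (\<lambda>C. of_bool (B \<in> C)) = real (N - card R) / real (M - card R)"
    using a0 by (auto simp add: avg_def)
  also have "\<dots> \<le> real N / real M"
  proof -
    have "(real N - real (card R)) * real M \<le> real N * (real M - real (card R))"
      using mult_right_mono[of "real N" "real M" "real (card R)"] assms by (simp add: algebra_simps)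
    then show ?thesis using assms by (simp add: of_nat_diff divide_simps)
  qed
  finally show ?thesis .
qed

subsection \<open>Algorithms against hidden blocks\<close>

text \<open>A natural-number budget, so that the cost of a query can be subtracted when recursing
  into the decision tree.\<close>

definition success :: "real set \<Rightarrow> nat \<Rightarrow> (real option \<times> nat) set" where
  "success I b = {(r, c). (\<exists>y\<in>I. r = Some y) \<and> c \<le> b}"

lemma prob_add_cost:
  "measure_pmf.prob (map_pmf (\<lambda>(r, c). (r, k + c)) D) (success I b) =
     (if k \<le> b then measure_pmf.prob D (success I (b - k)) else 0)"
proof -
  have "(\<lambda>(r, c). (r, k + c)) -` success I b = (if k \<le> b then success I (b - k) else {})"
    by (auto simp: success_def)
  then show ?thesis by simp
qed

lemma prob_Suc_cost:
  "measure_pmf.prob (map_pmf (\<lambda>(r, c). (r, Suc c)) D) (success I b) =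
     (if 1 \<le> b then measure_pmf.prob D (success I (b - 1)) else 0)"
  using prob_add_cost[of 1 D I b] by (simp del: measure_map_pmf)

definition hit :: "nat set \<Rightarrow> nat set set \<Rightarrow> algorithm \<Rightarrow> real set \<Rightarrow> nat \<Rightarrow> real" where
  "hit V E A I b = measure_pmf.prob (run V E A) (success I b)"

lemma hit_bounds: "0 \<le> hit V E A I b" "hit V E A I b \<le> 1" "\<bar>hit V E A I b\<bar> \<le> 1"
  by (simp_all add: hit_def)

lemma hit_Query:
  "hit V E (Query q k) I b = (if query_args q \<subseteq> V \<and> query_cost q \<le> b
     then measure_pmf.expectation (respond V E q) (\<lambda>a. hit V E (k a) I (b - query_cost q)) else 0)"
  by (auto simp: hit_def prob_bind_pmf prob_add_cost simp del: measure_map_pmf) (simp_all add: success_def)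

text \<open>The empty vertex set is allowed here, unlike in \<open>graph_on\<close>: the filler is
  empty in one of the two worlds, and a world is assembled by taking unions.\<close>

definition component :: "nat set \<Rightarrow> nat set set \<Rightarrow> bool" where
  "component V E \<longleftrightarrow> finite V \<and> (\<forall>e\<in>E. e \<subseteq> V \<and> card e = 2) \<and> no_isolated V E"

lemma finite_component: "component V E \<Longrightarrow> finite E"
  by (rule finite_subset[of _ "Pow V"]) (auto simp: component_def)

lemma nbrs_Un: "nbrs (E \<union> F) x = nbrs E x \<union> nbrs F x"
  by (auto simp: nbrs_def)

lemma component_Un: "component V E \<Longrightarrow> component W F \<Longrightarrow> component (V \<union> W) (E \<union> F)"
  unfolding component_def no_isolated_def nbrs_Un by blast

lemma component_UN:
  assumes "finite I" "\<And>i. i \<in> I \<Longrightarrow> component (V i) (E i)"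
  shows "component (\<Union>i\<in>I. V i) (\<Union>i\<in>I. E i)"
  using assms
proof (induction I rule: finite_induct)
  case empty
  then show ?case by (simp add: component_def no_isolated_def)
next
  case (insert i I)
  then show ?case using component_Un[of "V i" "E i" "\<Union>i\<in>I. V i" "\<Union>i\<in>I. E i"] by simp
qed

text \<open>The process that the hidden worlds are compared with: it knows the vertices \<open>VP\<close> and the blocks
  in \<open>R\<close>, random vertices come from \<open>VP\<close>, and a random edge reveals a fresh block.\<close>

primrec ideal_run :: "nat set \<Rightarrow> nat set set \<Rightarrow> (nat \<Rightarrow> nat set) \<Rightarrow> (nat \<Rightarrow> nat set set) \<Rightarrow> nat \<Rightarrow>
    algorithm \<Rightarrow> nat set \<Rightarrow> (real option \<times> nat) pmf" where
  "ideal_run VP EP VB EB M (Output r) = (\<lambda>R. return_pmf (Some r, 0))"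
| "ideal_run VP EP VB EB M (Coin p k) = (\<lambda>R. bind_pmf p (\<lambda>i. ideal_run VP EP VB EB M (k i) R))"
| "ideal_run VP EP VB EB M (Query q k) = (\<lambda>R.
     if q = RandEdge then
       bind_pmf (pmf_of_set ({..<M} - R)) (\<lambda>B. bind_pmf (pmf_of_set (EB B))
         (\<lambda>e. map_pmf (\<lambda>(r, c). (r, 1 + c)) (ideal_run VP EP VB EB M (k (Edge e)) (insert B R))))
     else if query_args q \<subseteq> VP \<union> (\<Union>B\<in>R. VB B) then
       bind_pmf (respond VP (EP \<union> (\<Union>B\<in>R. EB B)) q)
         (\<lambda>a. map_pmf (\<lambda>(r, c). (r, query_cost q + c)) (ideal_run VP EP VB EB M (k a) R))
     else return_pmf (None, 0))"

text \<open>A world consists of the public part \<open>VP\<close>, of \<open>N\<close> blocks out of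
  a pool of \<open>M\<close>, and of one filler out of \<open>M\<close> copies. The filler pads the
  number of vertices, so that worlds with different \<open>N\<close> can have the same size; its
  copy is drawn at random so that its labels cannot be guessed either.\<close>

locale hidden_blocks =
  fixes VP :: "nat set" and EP :: "nat set set"
    and VB :: "nat \<Rightarrow> nat set" and EB :: "nat \<Rightarrow> nat set set"
    and VF :: "nat \<Rightarrow> nat set" and EF :: "nat \<Rightarrow> nat set set"
    and M N \<theta> g h l :: nat
  assumes NM: "0 < N" "N \<le> M"
    and comp: "component VP EP" "VP \<noteq> {}" "\<And>B. component (VB B) (EB B)" "\<And>f. component (VF f) (EF f)"
    and cards: "\<And>B. card (VB B) = \<theta>" "\<And>B. card (EB B) = g" "0 < g"
      "\<And>f. card (VF f) = h" "\<And>f. card (EF f) = l"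
    and disj: "\<And>B. VP \<inter> VB B = {}" "\<And>f. VP \<inter> VF f = {}" "\<And>B f. VB B \<inter> VF f = {}"
      "\<And>B B'. B \<noteq> B' \<Longrightarrow> VB B \<inter> VB B' = {}" "\<And>f f'. f \<noteq> f' \<Longrightarrow> VF f \<inter> VF f' = {}"
begin

definition gV :: "nat set \<Rightarrow> nat \<Rightarrow> nat set" where "gV C f = VP \<union> (\<Union>B\<in>C. VB B) \<union> VF f"
definition gE :: "nat set \<Rightarrow> nat \<Rightarrow> nat set set" where "gE C f = EP \<union> (\<Union>B\<in>C. EB B) \<union> EF f"

lemma fin: "finite VP" "finite (VB B)" "finite (VF f)" "finite EP" "finite (EB B)" "finite (EF f)"
  using finite_component[OF comp(1)] finite_component[OF comp(3)] finite_component[OF comp(4)]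
    comp(1,3,4)[unfolded component_def] by simp_all

lemma edge_sub: "e \<in> EP \<Longrightarrow> e \<subseteq> VP" "e \<in> EB B \<Longrightarrow> e \<subseteq> VB B" "e \<in> EF f \<Longrightarrow> e \<subseteq> VF f"
  and edge_ne: "e \<in> EP \<Longrightarrow> e \<noteq> {}" "e \<in> EB B \<Longrightarrow> e \<noteq> {}" "e \<in> EF f \<Longrightarrow> e \<noteq> {}"
  using comp by (fastforce simp: component_def)+

lemma disjE: "EP \<inter> EB B = {}" "EP \<inter> EF f = {}" "EB B \<inter> EF f = {}" "B \<noteq> B' \<Longrightarrow> EB B \<inter> EB B' = {}"
proof -
  show "EP \<inter> EB B = {}" using edge_sub(1,2) edge_ne(1) disj(1) by fastforce
  show "EP \<inter> EF f = {}" using edge_sub(1,3) edge_ne(1) disj(2) by fastforce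
  show "EB B \<inter> EF f = {}" using edge_sub(2,3) edge_ne(2) disj(3) by fastforce
  show "EB B \<inter> EB B' = {}" if "B \<noteq> B'" using edge_sub(2) edge_ne(2) disj(4)[OF that] by fastforce
qed

lemma component_g: "finite C \<Longrightarrow> component (gV C f) (gE C f)"
  unfolding gV_def gE_def by (intro component_Un component_UN comp)

lemma card_gV: "finite C \<Longrightarrow> card (gV C f) = card VP + card C * \<theta> + h"
proof -
  assume C: "finite C"
  have "card (\<Union>B\<in>C. VB B) = card C * \<theta>"
    using C fin disj(4) by (subst card_UN_disjoint) (auto simp: cards)
  moreover have "card (VP \<union> (\<Union>B\<in>C. VB B)) = card VP + card (\<Union>B\<in>C. VB B)"
    using C fin disj(1) by (intro card_Un_disjoint) (auto simp: disjoint_iff)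
  moreover have "card (gV C f) = card (VP \<union> (\<Union>B\<in>C. VB B)) + card (VF f)"
    unfolding gV_def using C fin disj(2,3) by (intro card_Un_disjoint) (auto simp: disjoint_iff)
  ultimately show ?thesis by (simp add: cards)
qed

lemma card_UN_EB: "finite C \<Longrightarrow> card (\<Union>B\<in>C. EB B) = card C * g"
  using fin disjE(4) by (subst card_UN_disjoint) (auto simp: cards)

lemma card_gE: "finite C \<Longrightarrow> card (gE C f) = card EP + card C * g + l"
proof -
  assume C: "finite C"
  have "card (EP \<union> (\<Union>B\<in>C. EB B)) = card EP + card (\<Union>B\<in>C. EB B)"
    using C fin disjE(1) by (intro card_Un_disjoint) (auto simp: disjoint_iff)
  moreover have "card (gE C f) = card (EP \<union> (\<Union>B\<in>C. EB B)) + card (EF f)"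
    unfolding gE_def using C fin disjE(2,3) by (intro card_Un_disjoint) (auto simp: disjoint_iff)
  ultimately show ?thesis by (simp add: cards card_UN_EB C)
qed

lemma finite_gE: "finite C \<Longrightarrow> finite (gE C f)"
  using component_g finite_component by blast

lemma graph_on_g: "finite C \<Longrightarrow> graph_on (card VP + card C * \<theta> + h) (gV C f) (gE C f)"
  using component_g[of C f] card_gV[of C f] comp(2)
  by (auto simp: graph_on_def simple_graph_def component_def gV_def)

abbreviation "known R \<equiv> VP \<union> (\<Union>B\<in>R. VB B)"
abbreviation "knownE R \<equiv> EP \<union> (\<Union>B\<in>R. EB B)"

lemma gE_split:
  assumes "R \<subseteq> C"
  obtains F where "gE C f = knownE R \<union> F" "\<And>e. e \<in> F \<Longrightarrow> e \<inter> known R = {} \<and> e \<noteq> {}"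
proof
  show "gE C f = knownE R \<union> ((\<Union>B\<in>C - R. EB B) \<union> EF f)" using assms by (auto simp: gE_def)
next
  fix e assume "e \<in> (\<Union>B\<in>C - R. EB B) \<union> EF f"
  then consider B where "B \<in> C - R" "e \<in> EB B" | "e \<in> EF f" by auto
  then show "e \<inter> known R = {} \<and> e \<noteq> {}"
  proof cases
    case 1
    have "VB B \<inter> VB B' = {}" if "B' \<in> R" for B' using 1 that by (intro disj(4)) auto
    then show ?thesis using edge_sub(2)[OF 1(2)] edge_ne(2)[OF 1(2)] disj(1)[of B] by blast
  next
    case 2
    then show ?thesis using edge_sub(3)[OF 2] edge_ne(3)[OF 2] disj(2)[of f] disj(3) by fast
  qed
qed

text \<open>No edge joins a revealed vertex to an unrevealed one, so every local oracle sees only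
  the public part and the revealed blocks. Since whole blocks are revealed at once, this covers
  \<open>FullNbrHood\<close> and \<open>Additive\<close> alike.\<close>

lemma respond_known:
  assumes "R \<subseteq> C" "query_args q \<subseteq> known R" "q \<noteq> RandVert" "q \<noteq> RandEdge"
  shows "respond (gV C f) (gE C f) q = respond VP (knownE R) q"
proof -
  obtain F where F: "gE C f = knownE R \<union> F" "\<And>e. e \<in> F \<Longrightarrow> e \<inter> known R = {} \<and> e \<noteq> {}"
    using gE_split[OF assms(1)] by metis
  have 1: "nbrs (gE C f) x = nbrs (knownE R) x" if "x \<in> known R" for x
  proof -
    have "{x, y} \<notin> F" for y using F(2)[of "{x,y}"] that by auto
    then show ?thesis unfolding F(1) by (simp add: nbrs_def)
  qed
  have 2: "{e \<in> gE C f. e \<subseteq> S} = {e \<in> knownE R. e \<subseteq> S}" if "S \<subseteq> known R" for S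
  proof -
    have "\<not> e \<subseteq> S" if "e \<in> F" for e
    proof
      assume "e \<subseteq> S"
      then have "e \<subseteq> known R" using \<open>S \<subseteq> known R\<close> by (rule order_trans)
      then have "e \<inter> known R = e" by (rule Int_absorb2)
      then show False using F(2)[OF that] by simp
    qed
    then show ?thesis by (auto simp only: F(1))
  qed
  show ?thesis
  proof (cases q)
    case (Additive S)
    then have "S \<subseteq> known R" using assms(2) by simp
    from 2[OF this] show ?thesis by (simp add: Additive)
  qed (use assms in \<open>simp_all add: 1 deg_def\<close>)
qed

text \<open>All blocks have \<open>g\<close> edges, so a uniform edge is a uniform block followed by
  a uniform edge in it.\<close>

lemma avg_UN_EB:
  assumes "finite C" "C \<noteq> {}"
  shows "avg (\<Union>B\<in>C. EB B) v = avg C (\<lambda>B. avg (EB B) v)"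
proof -
  have "sum v (\<Union>B\<in>C. EB B) = (\<Sum>B\<in>C. sum v (EB B))"
    using assms fin disjE(4) by (intro sum.UNION_disjoint) auto
  then show ?thesis unfolding avg_def card_UN_EB[OF assms(1)] cards
    by (simp add: sum_divide_distrib[symmetric] mult.commute)
qed

text \<open>A label outside the known part lies in at most one block or one filler copy. The former
  is present with probability at most \<open>N / M\<close>, the latter with probability at most
  \<open>1 / M\<close>.\<close>

lemma avg_unknown_vertex:
  assumes "R \<subseteq> {..<M}" "card R < N" "x \<notin> known R"
  shows "avg (extensions M N R) (\<lambda>C. avg {..<M} (\<lambda>f. of_bool (x \<in> gV C f))) \<le> real N / real M"
proof -
  have ne: "extensions M N R \<noteq> {}" using assms NM by (intro extensions_nonempty) auto
  have M0: "{..<M} \<noteq> {}" using NM by (auto simp: lessThan_empty_iff)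
  consider B where "x \<in> VB B" | i where "x \<in> VF i" | "\<forall>B. x \<notin> VB B" "\<forall>i. x \<notin> VF i" by blast
  then show ?thesis
  proof cases
    case 1
    then have BR: "B \<notin> R" using assms by auto
    have "x \<notin> VP" "x \<notin> VF f" "x \<in> VB B' \<longleftrightarrow> B' = B" for f B'
      using 1 disj(1)[of B] disj(3)[of B f] disj(4)[of B' B] by blast+
    then have "x \<in> gV C f \<longleftrightarrow> B \<in> C" for C f by (simp add: gV_def)
    then have "avg (extensions M N R) (\<lambda>C. avg {..<M} (\<lambda>f. of_bool (x \<in> gV C f)))
        = avg (extensions M N R) (\<lambda>C. of_bool (B \<in> C))"
      using M0 by (simp add: avg_const)
    also have "\<dots> \<le> real N / real M"
    proof (cases "B < M")
      case True
      then show ?thesis using assms BR NM by (intro avg_extensions_mem) auto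
    next
      case False
      then have "avg (extensions M N R) (\<lambda>C. of_bool (B \<in> C)) = 0"
        by (auto simp: avg_def extensions_def intro!: sum.neutral)
      then show ?thesis by simp
    qed
    finally show ?thesis .
  next
    case 2
    have "x \<notin> VP" "x \<notin> VB B" "x \<in> VF f \<longleftrightarrow> f = i" for f B
      using 2 disj(2)[of i] disj(3)[of B i] disj(5)[of f i] by blast+
    then have "x \<in> gV C f \<longleftrightarrow> f = i" for C f by (simp add: gV_def)
    then have "avg (extensions M N R) (\<lambda>C. avg {..<M} (\<lambda>f. of_bool (x \<in> gV C f)))
       = avg {..<M} (\<lambda>f. of_bool (f = i))"
      using ne by (simp add: avg_const)
    also have "\<dots> \<le> 1 / real M"
      by (simp add: avg_def of_bool_def divide_right_mono)
    also have "\<dots> \<le> real N / real M" using NM by (intro divide_right_mono) auto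
    finally show ?thesis .
  next
    case 3
    then have "x \<notin> gV C f" for C f using assms(3) unfolding gV_def by auto
    then show ?thesis using ne M0 by (simp add: avg_const)
  qed
qed

text \<open>The average over all worlds that are consistent with the revealed blocks
  \<open>R\<close>.\<close>

definition wavg :: "nat set \<Rightarrow> (nat set \<Rightarrow> nat \<Rightarrow> real) \<Rightarrow> real" where
  "wavg R v = avg (extensions M N R) (\<lambda>C. avg {..<M} (v C))"

abbreviation "ideal_hit A R I b \<equiv> measure_pmf.prob (ideal_run VP EP VB EB M A R) (success I b)"

text \<open>One bound \<open>\<kappa>\<close> for the three ways in which a query can leave the
  idealised process: a guessed label exists, \<open>RandVert\<close> leaves the public part, or
  \<open>RandEdge\<close> misses the fresh blocks. The number \<open>q0\<close> limits how many
  blocks can have been revealed.\<close>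

context
  fixes \<kappa> :: real and q0 :: nat
  assumes q0: "q0 \<le> N"
    and \<kappa>: "real N / real M \<le> \<kappa>"
      "real (N * \<theta> + h) / real (card VP + N * \<theta> + h) \<le> \<kappa>"
      "real (card EP + l + q0 * g) / real (card EP + N * g + l) \<le> \<kappa>"
begin

lemma \<kappa>_nonneg: "0 \<le> \<kappa>" using \<kappa>(1) by (rule order_trans[rotated]) simp

lemma wavg_mono:
  "(\<And>C f. C \<in> extensions M N R \<Longrightarrow> u C f \<le> v C f) \<Longrightarrow> wavg R u \<le> wavg R v"
  unfolding wavg_def by (intro avg_mono)

lemma wavg_const: "R \<subseteq> {..<M} \<Longrightarrow> card R \<le> N \<Longrightarrow> wavg R (\<lambda>_ _. c) = c"
  unfolding wavg_def using NM extensions_nonempty[of R M N]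
  by (simp add: avg_const lessThan_empty_iff)

lemma wavg_add: "wavg R (\<lambda>C f. u C f + v C f) = wavg R u + wavg R v"
  unfolding wavg_def by (simp add: avg_add)

lemma wavg_avg: "wavg R (\<lambda>C f. avg S (\<lambda>x. v C f x)) = avg S (\<lambda>x. wavg R (\<lambda>C f. v C f x))"
proof -
  have "avg {..<M} (\<lambda>f. avg S (v C f)) = avg S (\<lambda>x. avg {..<M} (\<lambda>f. v C f x))" for C
    by (rule avg_swap)
  then show ?thesis unfolding wavg_def using avg_swap[of "extensions M N R" S] by (simp only:)
qed

lemma wavg_expectation:
  assumes "\<And>C f x. \<bar>v C f x\<bar> \<le> 1"
  shows "wavg R (\<lambda>C f. measure_pmf.expectation p (v C f))
       = measure_pmf.expectation p (\<lambda>x. wavg R (\<lambda>C f. v C f x))"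
proof -
  have "\<bar>avg {..<M} (\<lambda>f. v C f x)\<bar> \<le> 1" for C x
  proof -
    have "\<bar>\<Sum>f<M. v C f x\<bar> \<le> (\<Sum>f<M. 1)" using assms by (intro order.trans[OF sum_abs] sum_mono) auto
    then show ?thesis using NM by (simp add: avg_def)
  qed
  then have "avg (extensions M N R) (\<lambda>C. measure_pmf.expectation p (\<lambda>x. avg {..<M} (\<lambda>f. v C f x)))
     = measure_pmf.expectation p (\<lambda>x. avg (extensions M N R) (\<lambda>C. avg {..<M} (\<lambda>f. v C f x)))"
    by (rule avg_expectation_swap)
  moreover have "avg {..<M} (\<lambda>f. measure_pmf.expectation p (v C f))
     = measure_pmf.expectation p (\<lambda>x. avg {..<M} (\<lambda>f. v C f x))" for C
    by (rule avg_expectation_swap[OF assms])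
  ultimately show ?thesis unfolding wavg_def by (simp only:)
qed

lemma hit_RandVert:
  assumes "C \<in> extensions M N R" "1 \<le> b"
  shows "hit (gV C f) (gE C f) (Query RandVert k) I b
       \<le> avg VP (\<lambda>x. hit (gV C f) (gE C f) (k (Vertex x)) I (b - 1)) + \<kappa>"
proof -
  have C: "finite C" "card C = N" using assms finite_memb_extensions[OF assms(1)] by (auto simp: extensions_def)
  have V: "finite (gV C f)" "gV C f \<noteq> {}" using component_g[OF C(1)] comp(2) by (auto simp: component_def gV_def)
  have eq: "hit (gV C f) (gE C f) (Query RandVert k) I b
      = avg (gV C f) (\<lambda>x. hit (gV C f) (gE C f) (k (Vertex x)) I (b - 1))"
    using V assms(2) by (simp add: hit_Query expectation_pmf_of_set)
  have c1: "card (gV C f - VP) = N * \<theta> + h"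
    using card_gV[OF C(1), of f] C fin by (subst card_Diff_subset) (auto simp: gV_def)
  have c2: "card (gV C f) = card VP + N * \<theta> + h" using card_gV[OF C(1)] C by simp
  have "avg (gV C f) (\<lambda>x. hit (gV C f) (gE C f) (k (Vertex x)) I (b - 1))
      \<le> avg VP (\<lambda>x. hit (gV C f) (gE C f) (k (Vertex x)) I (b - 1))
      + real (card (gV C f - VP)) / real (card (gV C f))"
    using V comp(2) by (intro avg_indicator_bound) (auto simp: gV_def hit_bounds)
  also have "real (card (gV C f - VP)) / real (card (gV C f)) \<le> \<kappa>"
    using \<kappa>(2) by (simp only: c1 c2)
  finally show ?thesis by (simp only: eq)
qed

text \<open>The invariant \<open>card R + b \<le> q0\<close> bounds the number of revealed blocks,
  hence the edges that do not lead to a fresh block: the public ones, those of the filler, and at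
  most \<open>q0 * g\<close> in revealed blocks.\<close>

lemma hit_RandEdge:
  assumes "C \<in> extensions M N R" "1 \<le> b" "card R + b \<le> q0"
  shows "hit (gV C f) (gE C f) (Query RandEdge k) I b
       \<le> avg (C - R) (\<lambda>B. avg (EB B) (\<lambda>e. hit (gV C f) (gE C f) (k (Edge e)) I (b - 1))) + \<kappa>"
proof -
  have C: "finite C" "card C = N" "R \<subseteq> C"
    using finite_memb_extensions[OF assms(1)] assms(1) by (simp_all add: extensions_def)
  have R: "finite R" using C finite_subset by blast
  have cCR: "card (C - R) = N - card R" using C R by (simp add: card_Diff_subset)
  let ?T = "\<Union>B\<in>C - R. EB B"
  have "card (C - R) > 0" using cCR assms(2,3) q0 by simp
  then have CR: "C - R \<noteq> {}" "finite (C - R)" using C(1) by force+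
  have "card ?T > 0" using cards(3) by (simp add: card_UN_EB[OF CR(2)] \<open>card (C - R) > 0\<close>)
  then have T: "?T \<noteq> {}" by force
  have TE: "?T \<subseteq> gE C f" by (auto simp: gE_def)
  have V: "finite (gE C f)" "gE C f \<noteq> {}" using finite_gE[OF C(1)] T TE by auto
  have eq: "hit (gV C f) (gE C f) (Query RandEdge k) I b
      = avg (gE C f) (\<lambda>e. hit (gV C f) (gE C f) (k (Edge e)) I (b - 1))"
    using V assms(2) by (simp add: hit_Query expectation_pmf_of_set)
  have c1: "card (gE C f - ?T) = card EP + l + card R * g"
  proof -
    have "card (gE C f - ?T) = card (gE C f) - (N - card R) * g"
      using card_Diff_subset[OF finite_subset[OF TE V(1)] TE] card_UN_EB[OF CR(2)] cCR by simp
    moreover have "card R \<le> N" using assms q0 by simp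
    ultimately show ?thesis using card_gE[OF C(1), of f] C by (simp add: diff_mult_distrib)
  qed
  have c2: "card (gE C f) = card EP + N * g + l" using card_gE[OF C(1)] C by simp
  have T_avg: "avg ?T (\<lambda>e. hit (gV C f) (gE C f) (k (Edge e)) I (b - 1))
     = avg (C - R) (\<lambda>B. avg (EB B) (\<lambda>e. hit (gV C f) (gE C f) (k (Edge e)) I (b - 1)))"
    using CR by (intro avg_UN_EB) auto
  have "avg (gE C f) (\<lambda>e. hit (gV C f) (gE C f) (k (Edge e)) I (b - 1))
      \<le> avg ?T (\<lambda>e. hit (gV C f) (gE C f) (k (Edge e)) I (b - 1))
      + real (card (gE C f - ?T)) / real (card (gE C f))"
    by (rule avg_indicator_bound[OF V TE T]) (simp add: hit_bounds)
  also have "real (card (gE C f - ?T)) / real (card (gE C f))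
     \<le> real (card EP + l + q0 * g) / real (card EP + N * g + l)"
    unfolding c1 c2 using assms by (intro divide_right_mono) (auto intro!: mult_right_mono)
  also have "\<dots> \<le> \<kappa>" by (rule \<kappa>(3))
  finally show ?thesis by (simp only: eq T_avg)
qed

lemma integrable_wavg_hit:
  assumes "R \<subseteq> {..<M}" "card R \<le> N"
  shows "integrable (measure_pmf p) (\<lambda>a. wavg R (\<lambda>C f. hit (gV C f) (gE C f) (A a) I b))"
proof (rule measure_pmf.integrable_const_bound[where B = 1], rule AE_I2)
  fix a
  have "wavg R (\<lambda>C f. hit (gV C f) (gE C f) (A a) I b) \<le> wavg R (\<lambda>_ _. 1)"
    by (intro wavg_mono hit_bounds)
  moreover have "wavg R (\<lambda>C f. hit (gV C f) (gE C f) (A a) I b) \<ge> wavg R (\<lambda>_ _. 0)"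
    by (intro wavg_mono hit_bounds)
  ultimately show "norm (wavg R (\<lambda>C f. hit (gV C f) (gE C f) (A a) I b)) \<le> 1"
    using assms by (simp add: wavg_const)
qed simp

lemma EB_ne: "EB B \<noteq> {}"
  using cards(2)[of B] cards(3) by auto

text \<open>Induction over the decision tree with the revealed blocks and the remaining budget
  generalised. A random edge moves at most one block into \<open>R\<close> and consumes one unit of
  budget, which preserves the invariant; every step that loses \<open>\<kappa>\<close> also costs at
  least 1, which gives the total \<open>b * \<kappa>\<close>.\<close>

lemma wavg_hit_le_ideal:
  "R \<subseteq> {..<M} \<Longrightarrow> card R + b \<le> q0 \<Longrightarrow>
    wavg R (\<lambda>C f. hit (gV C f) (gE C f) A I b) \<le> ideal_hit A R I b + real b * \<kappa>"
proof (induction A arbitrary: R b)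
  case (Output r)
  then show ?case using q0 \<kappa>_nonneg by (simp add: hit_def wavg_const)
next
  case (Coin p k)
  have "wavg R (\<lambda>C f. hit (gV C f) (gE C f) (Coin p k) I b)
      = measure_pmf.expectation p (\<lambda>i. wavg R (\<lambda>C f. hit (gV C f) (gE C f) (k i) I b))"
    using hit_bounds(3) by (simp add: hit_def prob_bind_pmf wavg_expectation)
  also have "\<dots> \<le> measure_pmf.expectation p (\<lambda>i. ideal_hit (k i) R I b + real b * \<kappa>)"
  proof (rule integral_mono)
    show "integrable p (\<lambda>i. wavg R (\<lambda>C f. hit (gV C f) (gE C f) (k i) I b))"
      by (rule integrable_wavg_hit) (use Coin.prems q0 in auto)
    show "integrable p (\<lambda>i. ideal_hit (k i) R I b + real b * \<kappa>)"
      by simp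
  qed (use Coin in auto)
  also have "\<dots> = ideal_hit (Coin p k) R I b + real b * \<kappa>"
    by (simp add: prob_bind_pmf)
  finally show ?case .
next
  case (Query q k)
  note IH = Query.IH[OF rangeI]
  consider "\<not> query_cost q \<le> b" | "query_cost q \<le> b" "q = RandVert" | "query_cost q \<le> b" "q = RandEdge"
    | "query_cost q \<le> b" "q \<noteq> RandVert" "q \<noteq> RandEdge" "query_args q \<subseteq> known R"
    | x where "query_cost q \<le> b" "x \<in> query_args q" "x \<notin> known R" by blast
  then show ?case
  proof cases
    case 1
    then have "wavg R (\<lambda>C f. hit (gV C f) (gE C f) (Query q k) I b) = wavg R (\<lambda>_ _. 0)"
      by (simp add: hit_Query)
    then show ?thesis using Query.prems q0 \<kappa>_nonneg by (simp add: wavg_const)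
  next
    case 2
    then have b1: "1 \<le> b" by simp
    have "wavg R (\<lambda>C f. hit (gV C f) (gE C f) (Query q k) I b)
       \<le> wavg R (\<lambda>C f. avg VP (\<lambda>x. hit (gV C f) (gE C f) (k (Vertex x)) I (b - 1)) + \<kappa>)"
      unfolding 2 by (intro wavg_mono hit_RandVert) (use b1 in auto)
    also have "\<dots> = avg VP (\<lambda>x. wavg R (\<lambda>C f. hit (gV C f) (gE C f) (k (Vertex x)) I (b - 1))) + \<kappa>"
      using Query.prems q0 by (simp add: wavg_add wavg_const wavg_avg)
    also have "\<dots> \<le> avg VP (\<lambda>x. ideal_hit (k (Vertex x)) R I (b - 1) + real (b - 1) * \<kappa>) + \<kappa>"
      by (intro add_right_mono avg_mono IH) (use Query.prems in auto)
    also have "\<dots> = avg VP (\<lambda>x. ideal_hit (k (Vertex x)) R I (b - 1)) + real b * \<kappa>"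
      unfolding avg_add avg_const[OF fin(1) comp(2)] using b1 by (simp add: algebra_simps of_nat_diff)
    also have "avg VP (\<lambda>x. ideal_hit (k (Vertex x)) R I (b - 1)) = ideal_hit (Query q k) R I b"
      using 2 b1 fin comp(2)
      by (simp add: prob_bind_pmf prob_Suc_cost expectation_pmf_of_set del: measure_map_pmf)
    finally show ?thesis .
  next
    case 3
    then have b1: "1 \<le> b" by simp
    have R: "finite R" "card R < N" using Query.prems b1 q0 finite_subset by auto
    have MR: "finite ({..<M} - R)" "{..<M} - R \<noteq> {}"
      using R Query.prems NM by (auto dest!: card_mono[rotated])
    let ?h = "\<lambda>C f e. hit (gV C f) (gE C f) (k (Edge e)) I (b - 1)"
    have "wavg R (\<lambda>C f. hit (gV C f) (gE C f) (Query q k) I b)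
       \<le> wavg R (\<lambda>C f. avg (C - R) (\<lambda>B. avg (EB B) (\<lambda>e. ?h C f e)) + \<kappa>)"
      unfolding 3 by (intro wavg_mono hit_RandEdge) (use b1 Query.prems in auto)
    also have "\<dots> = wavg R (\<lambda>C f. avg (C - R) (\<lambda>B. avg (EB B) (\<lambda>e. ?h C f e))) + \<kappa>"
      using Query.prems q0 by (simp add: wavg_add wavg_const)
    also have "wavg R (\<lambda>C f. avg (C - R) (\<lambda>B. avg (EB B) (\<lambda>e. ?h C f e)))
       = avg (extensions M N R) (\<lambda>C. avg (C - R) (\<lambda>B. avg (EB B) (\<lambda>e. avg {..<M} (\<lambda>f. ?h C f e))))"
    proof -
      have "avg {..<M} (\<lambda>f. avg (C - R) (\<lambda>B. avg (EB B) (?h C f)))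
        = avg (C - R) (\<lambda>B. avg {..<M} (\<lambda>f. avg (EB B) (?h C f)))" for C
        by (rule avg_swap)
      moreover have "avg {..<M} (\<lambda>f. avg (EB B) (?h C f))
        = avg (EB B) (\<lambda>e. avg {..<M} (\<lambda>f. ?h C f e))" for C B
        by (rule avg_swap)
      ultimately show ?thesis unfolding wavg_def by (simp only:)
    qed
    \<comment> \<open>Draw the revealed block before the hidden set. Afterwards the hidden set is
      uniform among the extensions of \<open>insert B R\<close>, which is the average that the
      induction hypothesis speaks about.\<close>
    also have "\<dots> = avg ({..<M} - R) (\<lambda>B. avg (extensions M N (insert B R))
         (\<lambda>C. avg (EB B) (\<lambda>e. avg {..<M} (\<lambda>f. ?h C f e))))"
      using Query.prems R NM by (intro avg_extensions_swap) auto
    also have "\<dots> = avg ({..<M} - R) (\<lambda>B. avg (EB B) (\<lambda>e. wavg (insert B R) (\<lambda>C f. ?h C f e)))"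
    proof -
      have "avg (extensions M N (insert B R)) (\<lambda>C. avg (EB B) (\<lambda>e. avg {..<M} (\<lambda>f. ?h C f e)))
        = avg (EB B) (\<lambda>e. wavg (insert B R) (\<lambda>C f. ?h C f e))" for B
        unfolding wavg_def by (rule avg_swap)
      then show ?thesis by (simp only:)
    qed
    also have "\<dots> \<le> avg ({..<M} - R) (\<lambda>B. avg (EB B) (\<lambda>e.
        ideal_hit (k (Edge e)) (insert B R) I (b - 1) + real (b - 1) * \<kappa>))"
      by (intro avg_mono IH) (use Query.prems b1 R in auto)
    also have "\<dots> = avg ({..<M} - R) (\<lambda>B. avg (EB B) (\<lambda>e.
        ideal_hit (k (Edge e)) (insert B R) I (b - 1))) + real (b - 1) * \<kappa>"
      using MR fin EB_ne by (simp add: avg_add avg_const)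
    also have "avg ({..<M} - R) (\<lambda>B. avg (EB B) (\<lambda>e. ideal_hit (k (Edge e)) (insert B R) I (b - 1)))
        = ideal_hit (Query q k) R I b"
      using 3 b1 MR fin EB_ne
      by (simp add: prob_bind_pmf prob_Suc_cost expectation_pmf_of_set del: measure_map_pmf)
    finally show ?thesis using b1 by (simp add: algebra_simps of_nat_diff)
  next
    \<comment> \<open>The law of the answer is the same in all remaining worlds, so nothing is lost.
      This includes the free query \<open>Additive {}\<close>, which could not pay for a
      loss.\<close>
    case 4
    let ?b = "b - query_cost q"
    let ?p = "respond VP (knownE R) q"
    have "wavg R (\<lambda>C f. hit (gV C f) (gE C f) (Query q k) I b)
       \<le> wavg R (\<lambda>C f. measure_pmf.expectation ?p (\<lambda>a. hit (gV C f) (gE C f) (k a) I ?b))"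
    proof (rule wavg_mono)
      fix C f assume C: "C \<in> extensions M N R"
      then have RC: "R \<subseteq> C" by (auto simp: extensions_def)
      then have "query_args q \<subseteq> gV C f" using 4 unfolding gV_def by blast
      then show "hit (gV C f) (gE C f) (Query q k) I b
         \<le> measure_pmf.expectation ?p (\<lambda>a. hit (gV C f) (gE C f) (k a) I ?b)"
        using 4 respond_known[OF RC 4(4,2,3)] by (simp add: hit_Query)
    qed
    also have "\<dots> = measure_pmf.expectation ?p (\<lambda>a. wavg R (\<lambda>C f. hit (gV C f) (gE C f) (k a) I ?b))"
      by (rule wavg_expectation) (rule hit_bounds)
    also have "\<dots> \<le> measure_pmf.expectation ?p (\<lambda>a. ideal_hit (k a) R I ?b + real ?b * \<kappa>)"
    proof (rule integral_mono)
      show "integrable ?p (\<lambda>a. wavg R (\<lambda>C f. hit (gV C f) (gE C f) (k a) I ?b))"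
        by (rule integrable_wavg_hit) (use Query.prems q0 in auto)
      show "integrable ?p (\<lambda>a. ideal_hit (k a) R I ?b + real ?b * \<kappa>)"
        by simp
    qed (use IH Query.prems in auto)
    also have "\<dots> = measure_pmf.expectation ?p (\<lambda>a. ideal_hit (k a) R I ?b) + real ?b * \<kappa>"
      by simp
    also have "measure_pmf.expectation ?p (\<lambda>a. ideal_hit (k a) R I ?b) = ideal_hit (Query q k) R I b"
      using 4 by (simp add: prob_bind_pmf prob_add_cost del: measure_map_pmf)
    also have "real ?b * \<kappa> \<le> real b * \<kappa>" using \<kappa>_nonneg by (intro mult_right_mono) auto
    finally show ?thesis by simp
  next
    case 5
    show ?thesis
    proof (cases "finite (query_args q)")
      \<comment> \<open>An infinite \<open>Additive\<close> set has \<open>card\<close> 0 and would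
        be free, but it is never contained in the finite vertex set.\<close>
      case False
      have "hit (gV C f) (gE C f) (Query q k) I b \<le> 0" if "C \<in> extensions M N R" for C f
      proof -
        have "finite (gV C f)" using component_g finite_memb_extensions[OF that] by (simp add: component_def)
        then show ?thesis using False finite_subset by (auto simp: hit_Query)
      qed
      then have "wavg R (\<lambda>C f. hit (gV C f) (gE C f) (Query q k) I b) \<le> wavg R (\<lambda>_ _. 0)"
        by (intro wavg_mono) auto
      then show ?thesis using Query.prems q0 \<kappa>_nonneg
        by (auto simp: wavg_const intro: order.trans)
    next
      case True
      \<comment> \<open>A query that names an unknown label has a nonempty argument, so it costs at
        least 1 and pays for its \<open>\<kappa>\<close>.\<close>
      then have "0 < query_cost q" using 5 by (cases q) (auto simp: card_gt_0_iff)
      then have b1: "1 \<le> b" using 5 by simp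
      have "wavg R (\<lambda>C f. hit (gV C f) (gE C f) (Query q k) I b)
         \<le> wavg R (\<lambda>C f. of_bool (x \<in> gV C f))"
      proof (rule wavg_mono)
        fix C f
        show "hit (gV C f) (gE C f) (Query q k) I b \<le> of_bool (x \<in> gV C f)"
        proof (cases "x \<in> gV C f")
          case False
          then have "\<not> query_args q \<subseteq> gV C f" using 5 by blast
          then show ?thesis by (simp add: hit_Query)
        qed (simp add: hit_bounds)
      qed
      also have "\<dots> \<le> real N / real M"
        unfolding wavg_def using 5 Query.prems b1 q0 by (intro avg_unknown_vertex) auto
      also have "\<dots> \<le> \<kappa>" by (rule \<kappa>)
      also have "\<kappa> \<le> real b * \<kappa>" using b1 \<kappa>_nonneg by (simp add: mult_le_cancel_right1)
      finally show ?thesis by (simp add: add_increasing)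
    qed
  qed
qed

end

end

subsection \<open>The lower bound\<close>

context hidden_blocks
begin

text \<open>Success on every graph implies success on average over the worlds, and all worlds share
  their vertex and edge counts, hence a single target interval. The process on the right does not
  involve \<open>N\<close> or the filler, so instances with different \<open>N\<close> can be played
  against each other.\<close>

lemma succeeds_le_ideal_hit:
  assumes q0: "q0 \<le> N" "b \<le> q0"
    and \<kappa>: "real N / real M \<le> \<kappa>"
      "real (N * \<theta> + h) / real (card VP + N * \<theta> + h) \<le> \<kappa>"
      "real (card EP + l + q0 * g) / real (card EP + N * g + l) \<le> \<kappa>"
    and A: "\<And>V E. graph_on (card VP + N * \<theta> + h) V E \<Longrightarrow>
      succeeds V E A (factor_approx c (avg_degree V E)) q"
    and q: "q < real b + 1"
  shows "99 / 100 \<le> ideal_hit A {}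
    (factor_approx c (2 * real (card EP + N * g + l) / real (card VP + N * \<theta> + h))) b + real b * \<kappa>"
proof -
  let ?I = "factor_approx c (2 * real (card EP + N * g + l) / real (card VP + N * \<theta> + h))"
  have "99 / 100 = wavg {} (\<lambda>_ _. 99 / 100)"
    by (subst wavg_const[OF q0(1) \<kappa>]) auto
  also have "\<dots> \<le> wavg {} (\<lambda>C f. hit (gV C f) (gE C f) A ?I b)"
  proof (rule wavg_mono[OF q0(1) \<kappa>])
    fix C f assume C: "C \<in> extensions M N {}"
    then have fC: "finite C" "card C = N"
      using finite_memb_extensions[OF C] by (simp_all add: extensions_def)
    have I: "factor_approx c (avg_degree (gV C f) (gE C f)) = ?I"
      by (simp add: avg_degree_def card_gV[OF fC(1)] card_gE[OF fC(1)] fC(2))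
    have "succeeds (gV C f) (gE C f) A ?I q"
      using A[of "gV C f" "gE C f"] graph_on_g[OF fC(1), of f] I fC(2) by simp
    then have "99 / 100 \<le> measure_pmf.prob (run (gV C f) (gE C f) A)
        {(r, c). (\<exists>y\<in>?I. r = Some y) \<and> real c \<le> q}"
      by (simp add: succeeds_def)
    also have "\<dots> \<le> hit (gV C f) (gE C f) A ?I b"
      unfolding hit_def using q by (intro measure_pmf.finite_measure_mono) (auto simp: success_def)
    finally show "99 / 100 \<le> hit (gV C f) (gE C f) A ?I b" .
  qed
  also have "\<dots> \<le> ideal_hit A {} ?I b + real b * \<kappa>"
    by (rule wavg_hit_le_ideal[OF q0(1) \<kappa>]) (use q0 in auto)
  finally show ?thesis .
qed

end

section \<open>Concrete worlds: stars and cliques on disjoint label sets\<close>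

definition cell :: "nat \<Rightarrow> nat \<Rightarrow> nat set" where
  "cell a k = (\<lambda>i. prod_encode (a, i)) ` {..<k}"

definition star :: "nat \<Rightarrow> nat \<Rightarrow> nat set set" where
  "star a k = (\<lambda>x. {prod_encode (a, 0), x}) ` (cell a k - {prod_encode (a, 0)})"

definition clique :: "nat \<Rightarrow> nat \<Rightarrow> nat set set" where
  "clique a k = {e. e \<subseteq> cell a k \<and> card e = 2}"

lemma finite_cell [simp]: "finite (cell a k)"
  by (simp add: cell_def)

lemma card_cell [simp]: "card (cell a k) = k"
  unfolding cell_def by (subst card_image) (auto simp: inj_on_def)

lemma cell_disjoint: "a \<noteq> b \<Longrightarrow> cell a k \<inter> cell b l = {}"
  by (auto simp: cell_def)

lemma card_star [simp]: "card (star a k) = k - 1"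
proof -
  have "inj_on (\<lambda>x. {prod_encode (a, 0), x}) (cell a k - {prod_encode (a, 0)})"
    by (auto simp: inj_on_def doubleton_eq_iff)
  moreover have "prod_encode (a, 0) \<in> cell a k" if "k \<noteq> 0"
    using that by (auto simp: cell_def)
  ultimately show ?thesis
    by (cases "k = 0") (simp_all add: star_def card_image, simp add: cell_def)
qed

lemma card_clique [simp]: "card (clique a k) = k choose 2"
  by (simp add: clique_def n_subsets)

text \<open>Only a single vertex would be isolated; the empty star is needed as the empty
  filler.\<close>

lemma component_star:
  assumes "k \<noteq> 1"
  shows "component (cell a k) (star a k)"
proof (cases "k = 0")
  case True
  then show ?thesis by (simp add: component_def star_def cell_def no_isolated_def)
next
  case False
  let ?c = "prod_encode (a, 0)"
  have c: "?c \<in> cell a k" "prod_encode (a, 1) \<in> cell a k" using assms False by (auto simp: cell_def)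
  have "nbrs (star a k) x \<noteq> {}" if "x \<in> cell a k" for x
  proof (cases "x = ?c")
    case True
    have "{?c, prod_encode (a, 1)} \<in> star a k" using c by (auto simp: star_def)
    then show ?thesis using True by (auto simp: nbrs_def)
  next
    case False
    then have "{x, ?c} \<in> star a k" using that by (auto simp: star_def)
    then show ?thesis by (auto simp: nbrs_def)
  qed
  then show ?thesis using c by (auto simp: component_def star_def no_isolated_def card_insert_if)
qed

lemma component_clique:
  assumes "2 \<le> k"
  shows "component (cell a k) (clique a k)"
proof -
  have "nbrs (clique a k) x \<noteq> {}" if "x \<in> cell a k" for x
  proof -
    have "\<not> cell a k \<subseteq> {x}" using card_mono[of "{x}" "cell a k"] assms by auto
    then obtain y where "y \<in> cell a k" "y \<noteq> x" by auto
    then have "{x, y} \<in> clique a k" using that by (auto simp: clique_def)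
    then show ?thesis by (auto simp: nbrs_def)
  qed
  then show ?thesis by (auto simp: component_def clique_def no_isolated_def)
qed

text \<open>Row 0 carries the public star, the odd rows the cliques and the positive even rows the
  fillers, so disjointness is a matter of parity.\<close>

lemma hidden_blocks_cells:
  assumes "2 \<le> p" "2 \<le> \<theta>" "h \<noteq> 1" "0 < N" "N \<le> M"
  shows "hidden_blocks (cell 0 p) (star 0 p) (\<lambda>B. cell (2 * B + 1) \<theta>) (\<lambda>B. clique (2 * B + 1) \<theta>)
    (\<lambda>f. cell (2 * f + 2) h) (\<lambda>f. star (2 * f + 2) h) M N \<theta> (\<theta> choose 2) h (h - 1)"
proof
  show "cell 0 p \<noteq> {}" using assms card_cell[of 0 p] by (metis card.empty not_numeral_le_zero)
  show "cell (2 * B + 1) \<theta> \<inter> cell (2 * f + 2) h = {}" for B f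
    by (rule cell_disjoint) presburger
  show "0 < \<theta> choose 2" using assms by simp
qed (use assms in \<open>auto intro!: component_star component_clique cell_disjoint\<close>)

text \<open>Two families of worlds, with \<open>t\<^sup>2\<close> and with
  \<open>K * t\<^sup>2\<close> cliques, are both close to the same idealised process. Their target
  intervals are disjoint, yet that process would have to hit each of them with probability above one
  half.\<close>

lemma lower_bound:
  fixes c :: real
  assumes c: "c \<ge> 1"
  shows "\<exists>\<delta> :: real. \<delta> > 0 \<and> (\<forall>\<^sub>F n :: nat in sequentially. \<forall>(A :: algorithm) (q :: real).
    (\<forall>V E. graph_on n V E \<longrightarrow> succeeds V E A (factor_approx c (avg_degree V E)) q)
     \<longrightarrow> q \<ge> \<delta> * real n powr (1 / 5))"
proof -
  \<comment> \<open>The edge counts of the two worlds turn out to differ by a factor of at least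
    \<open>K / 2\<close>, which must exceed \<open>c\<^sup>2\<close> for the factor \<open>c\<close>
    intervals to be disjoint.\<close>
  define K :: nat where "K = nat \<lceil>2 * c\<^sup>2\<rceil> + 1"
  have cc: "c\<^sup>2 \<ge> 1" using c by simp
  have K: "real K > 2 * c\<^sup>2" unfolding K_def by linarith
  have K3: "K \<ge> 3" using K cc by linarith
  \<comment> \<open>Chosen so that \<open>2 * \<delta> * t\<close> queries, each with error
    \<open>(33 + 2 * K) / t\<close>, have total error 2/5.\<close>
  define \<delta> :: real where "\<delta> = 1 / (5 * (33 + 2 * real K))"
  have \<delta>0: "\<delta> > 0" by (simp add: \<delta>_def add_pos_nonneg)
  have "eventually (\<lambda>n::nat. real n powr (1 / 5) \<ge> real T) sequentially" for T :: nat
    using eventually_ge_at_top[of "T ^ 5"]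
  proof eventually_elim
    case (elim n)
    have "(real T ^ 5) powr (1 / 5) \<le> real n powr (1 / 5)"
      using elim by (intro powr_mono2) (simp_all flip: of_nat_power)
    moreover have "(real T ^ 5) powr (1 / 5) = real T"
    proof (cases "T = 0")
      case False
      then have "real T ^ 5 = real T powr 5" by simp
      then show ?thesis by (simp only: powr_powr) simp
    qed simp
    ultimately show ?case by simp
  qed
  from this[of "33 + 2 * K"]
  have "\<forall>\<^sub>F n :: nat in sequentially. \<forall>(A :: algorithm) (q :: real).
    (\<forall>V E. graph_on n V E \<longrightarrow> succeeds V E A (factor_approx c (avg_degree V E)) q)
     \<longrightarrow> q \<ge> \<delta> * real n powr (1 / 5)"
  proof (rule eventually_mono, intro allI impI, goal_cases)
    case (1 n A q)
    note big = 1(1) and A = 1(3)[rule_format]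
    define t where "t = nat \<lfloor>real n powr (1 / 5)\<rfloor>"
    have t: "real t \<le> real n powr (1 / 5)" "real n powr (1 / 5) < real t + 1" "t \<ge> 33 + 2 * K"
      unfolding t_def using big by linarith+
    have n0: "n > 0" using big by (cases "n = 0") auto
    have pow: "(real n powr (1 / 5)) ^ 5 = real n"
      using n0 by (simp add: powr_power)
    have "real t ^ 5 \<le> (real n powr (1 / 5)) ^ 5" using t by (intro power_mono) auto
    then have nt: "t ^ 5 \<le> n" unfolding pow by (metis of_nat_le_iff of_nat_power)
    have "(real n powr (1 / 5)) ^ 5 \<le> (2 * real t) ^ 5" using t by (intro power_mono) auto
    then have "real n \<le> real (32 * t ^ 5)" unfolding pow by (simp add: power_mult_distrib)
    then have nt': "n \<le> 32 * t ^ 5" by (simp only: of_nat_le_iff)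
    \<comment> \<open>Cliques of \<open>2 * t\<^sup>2\<close> vertices have at least
      \<open>t ^ 4\<close> edges. In both worlds cliques and filler together take
      \<open>2 * K * t ^ 4\<close> vertices, and the public star gets the other
      \<open>p\<close>.\<close>
    define \<theta> g p where "\<theta> = 2 * t\<^sup>2" and "g = \<theta> choose 2" and "p = n - 2 * K * t ^ 4"
    have t1: "t \<ge> 1" using t by simp
    have "t ^ 4 * (2 * K + 2) \<le> t ^ 4 * t" using t by (intro mult_left_mono) auto
    also have "\<dots> \<le> n" using nt by (simp add: power_numeral_reduce mult_ac)
    finally have "2 * K * t ^ 4 + 2 * t ^ 4 \<le> n" by (simp add: algebra_simps)
    moreover have "t ^ 4 \<ge> 1" using t1 by simp
    ultimately have p: "p \<ge> 2" "p + 2 * K * t ^ 4 = n" unfolding p_def by linarith+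
    have "g = \<theta> * (\<theta> - 1) div 2" by (simp add: g_def choose_two)
    also have "\<dots> = t\<^sup>2 * (2 * t\<^sup>2 - 1)" by (simp add: \<theta>_def)
    finally have "g = t\<^sup>2 * (2 * t\<^sup>2 - 1)" .
    moreover have "2 * t\<^sup>2 - 1 \<ge> t\<^sup>2" using t1 by simp
    ultimately have g: "g \<ge> t ^ 4" by (simp add: power_numeral_reduce mult_ac power2_eq_square)
    have \<theta>2: "\<theta> \<ge> 2" using t1 by (simp add: \<theta>_def)
    \<comment> \<open>Both values of \<open>N\<close> are at most \<open>K * t\<^sup>2\<close>, so a
      guessed label exists with probability at most \<open>1 / n\<close>.\<close>
    define M where "M = K * t\<^sup>2 * n"
    \<comment> \<open>A random vertex is not public with probability at most
      \<open>2 * K / t\<close>. A random edge is sparse with probability at most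
      \<open>32 / t\<close>, because \<open>n \<le> 32 * t ^ 5\<close> while the cliques have at
      least \<open>t ^ 6\<close> edges, and it lies in one of at most \<open>t\<close> revealed
      cliques with probability at most \<open>1 / t\<close>.\<close>
    define \<kappa> where "\<kappa> = (33 + 2 * real K) / real t"
    define N where "N i = (if i = 0 then t\<^sup>2 else K * t\<^sup>2)" for i :: nat
    \<comment> \<open>The world with few cliques is padded by \<open>2 * (K - 1) * t ^ 4\<close>
      vertices. Both values are even, so the filler is never a single vertex.\<close>
    define h where "h i = (if i = 0 then 2 * (K - 1) * t ^ 4 else 0)" for i :: nat
    have Nh: "N i * \<theta> + h i = 2 * K * t ^ 4" for i
      using K3 by (cases K) (simp_all add: N_def h_def \<theta>_def power_numeral_reduce algebra_simps)
    have N: "0 < N i" "N i \<le> M" "N i \<ge> t\<^sup>2" "N i \<le> K * t\<^sup>2" for i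
      using K3 t1 n0 by (auto simp: N_def M_def)
    have h1: "h i \<noteq> 1" for i unfolding h_def by (metis dvd_triv_left even_mult_iff odd_one zero_neq_one)
    have hb: "hidden_blocks (cell 0 p) (star 0 p) (\<lambda>B. cell (2 * B + 1) \<theta>) (\<lambda>B. clique (2 * B + 1) \<theta>)
      (\<lambda>f. cell (2 * f + 2) (h i)) (\<lambda>f. star (2 * f + 2) (h i)) M (N i) \<theta> g (h i) (h i - 1)" for i
      unfolding g_def by (intro hidden_blocks_cells p \<theta>2 h1 N)
    have tt: "t \<le> N i" for i using N(3)[of i] t1 by (meson le_trans self_le_power zero_less_numeral)
    have tpos: "real t > 0" using t1 by simp
    have \<kappa>1: "real (N i) / real M \<le> \<kappa>" for i
    proof -
      have "real (N i) / real M \<le> real (K * t\<^sup>2) / real (K * t\<^sup>2 * n)"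
        unfolding M_def using N(4)[of i] by (intro divide_right_mono) (simp_all only: of_nat_le_iff of_nat_0_le_iff)
      also have "\<dots> = 1 / real n" using K3 t1 by simp
      also have "\<dots> \<le> 1 / real t"
        using nt t1 self_le_power[of t 5] by (intro divide_left_mono) auto
      also have "\<dots> \<le> \<kappa>" unfolding \<kappa>_def by (intro divide_right_mono) auto
      finally show ?thesis .
    qed
    have \<kappa>2: "real (N i * \<theta> + h i) / real (card (cell 0 p) + N i * \<theta> + h i) \<le> \<kappa>" for i
    proof -
      have "real (N i * \<theta> + h i) / real (card (cell 0 p) + N i * \<theta> + h i) = real (2 * K * t ^ 4) / real n"
        using Nh[of i] p(2) by (simp add: add.assoc)
      also have "\<dots> \<le> real (2 * K * t ^ 4) / real (t ^ 5)"
        using nt t1 n0 by (intro divide_left_mono) (simp_all only: of_nat_le_iff of_nat_0_le_iff, simp)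
      also have "\<dots> = 2 * real K / real t" using t1 by (simp add: power_numeral_reduce)
      also have "\<dots> \<le> \<kappa>" unfolding \<kappa>_def by (intro divide_right_mono) auto
      finally show ?thesis .
    qed
    have gpos: "real g > 0" using g t1 by (metis less_le_trans of_nat_0_less_iff zero_less_power less_le_trans zero_less_one)
    have \<kappa>3: "real (card (star 0 p) + (h i - 1) + t * g) / real (card (star 0 p) + N i * g + (h i - 1)) \<le> \<kappa>" for i
    proof -
      have "card (star 0 p) + (h i - 1) \<le> n" using Nh[of i] p by simp
      then have "real (card (star 0 p) + (h i - 1) + t * g) / real (card (star 0 p) + N i * g + (h i - 1))
         \<le> real (n + t * g) / real (N i * g)"
        using N(1)[of i] gpos by (intro frac_le) (simp_all only: of_nat_le_iff of_nat_0_le_iff of_nat_0_less_iff, auto)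
      also have "\<dots> \<le> real (n + t * g) / real (t\<^sup>2 * g)"
        using N(1,3)[of i] gpos t1 by (intro divide_left_mono) (simp_all only: of_nat_le_iff of_nat_0_le_iff of_nat_0_less_iff, auto)
      also have "\<dots> = real n / (real t ^ 2 * real g) + 1 / real t"
        using gpos tpos by (simp add: add_divide_distrib power2_eq_square)
      also have "real n / (real t ^ 2 * real g) \<le> real (32 * t ^ 5) / (real t ^ 2 * real (t ^ 4))"
        using g nt' gpos tpos by (intro frac_le mult_left_mono) (simp_all only: of_nat_le_iff of_nat_0_le_iff, auto)
      also have "\<dots> = 32 / real t" using tpos by (simp add: power_numeral_reduce)
      also have "32 / real t + 1 / real t \<le> \<kappa>"
        unfolding \<kappa>_def add_divide_distrib[symmetric] by (intro divide_right_mono) auto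
      finally show ?thesis by simp
    qed
    show ?case
    proof (rule ccontr)
      assume "\<not> \<delta> * real n powr (1 / 5) \<le> q"
      then have q: "q < \<delta> * real n powr (1 / 5)" by simp
      define b where "b = nat \<lfloor>q\<rfloor>"
      have qb: "q < real b + 1" unfolding b_def by linarith
      have "real b \<le> \<delta> * real n powr (1 / 5)"
      proof (cases "q \<ge> 0")
        case True
        then have "real b \<le> q" unfolding b_def by linarith
        then show ?thesis using q by linarith
      next
        case False
        then have "b = 0" unfolding b_def by linarith
        then show ?thesis using \<delta>0 by simp
      qed
      also have "\<dots> \<le> \<delta> * (2 * real t)" using t t1 \<delta>0 by (intro mult_left_mono) auto
      finally have b\<delta>: "real b \<le> \<delta> * (2 * real t)" .
      have "\<delta> * 2 \<le> 1" by (simp add: \<delta>_def divide_simps)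
      then have "\<delta> * (2 * real t) \<le> real t" using tpos by (simp add: mult.assoc[symmetric] mult_le_cancel_right1)
      then have bt: "b \<le> t" using b\<delta> by linarith
      have "real b * \<kappa> \<le> \<delta> * (2 * real t) * \<kappa>"
        using b\<delta> \<kappa>1[of 0] by (intro mult_right_mono) (auto intro: order_trans[rotated])
      also have "\<dots> = 2 / 5"
      proof -
        have "1 / (5 * s) * (2 * x) * (s / x) = 2 / 5" if "s > 0" "x > 0" for s x :: real
          using that by (simp add: field_simps)
        from this[of "33 + 2 * real K" "real t"] show ?thesis
          using tpos by (simp add: \<delta>_def \<kappa>_def add_pos_nonneg)
      qed
      finally have b\<kappa>: "real b * \<kappa> \<le> 2 / 5" .
      define d where "d i = 2 * real (card (star 0 p) + N i * g + (h i - 1))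
         / real (card (cell 0 p) + N i * \<theta> + h i)" for i
      let ?D = "ideal_run (cell 0 p) (star 0 p) (\<lambda>B. cell (2 * B + 1) \<theta>) (\<lambda>B. clique (2 * B + 1) \<theta>) M A {}"
      have n_eq: "card (cell 0 p) + N i * \<theta> + h i = n" for i using Nh[of i] p by (simp add: add.assoc)
      have P: "99 / 100 \<le> measure_pmf.prob ?D (success (factor_approx c (d i)) b) + real b * \<kappa>" for i
        unfolding d_def
        by (rule hidden_blocks.succeeds_le_ideal_hit[OF hb tt bt \<kappa>1 \<kappa>2 \<kappa>3 _ qb])
           (use A n_eq in auto)
      \<comment> \<open>In the smaller world the sparse edges number at most
        \<open>n \<le> 32 * t ^ 5 \<le> t ^ 6\<close>, which is at most the number of clique edges;
        this is where \<open>t \<ge> 32\<close> is used.\<close>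
      have m0: "real (card (star 0 p) + N 0 * g + (h 0 - 1)) \<le> 2 * (real t ^ 2 * real g)"
      proof -
        have "card (star 0 p) + (h 0 - 1) \<le> n" using Nh[of 0] p by simp
        also have "n \<le> 32 * t ^ 5" by (rule nt')
        also have "\<dots> \<le> t * t ^ 5" using t(3) by (intro mult_right_mono) auto
        also have "\<dots> = t\<^sup>2 * t ^ 4" by (simp add: power_numeral_reduce)
        also have "\<dots> \<le> t\<^sup>2 * g" using g by (intro mult_left_mono) auto
        finally have "card (star 0 p) + N 0 * g + (h 0 - 1) \<le> 2 * (t\<^sup>2 * g)"
          by (simp add: N_def mult.commute)
        then show ?thesis by (metis of_nat_le_iff of_nat_mult of_nat_numeral of_nat_power)
      qed
      have m1: "real K * (real t ^ 2 * real g) \<le> real (card (star 0 p) + N 1 * g + (h 1 - 1))"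
        by (simp add: N_def)
      have "c\<^sup>2 * d 0 < d 1"
      proof -
        have "c\<^sup>2 * real (card (star 0 p) + N 0 * g + (h 0 - 1)) \<le> c\<^sup>2 * (2 * (real t ^ 2 * real g))"
          by (intro mult_left_mono m0) auto
        also have "\<dots> < real K * (real t ^ 2 * real g)"
        proof -
          have "0 < real t ^ 2 * real g" using tpos gpos by simp
          from mult_strict_right_mono[OF K this] show ?thesis by (simp add: mult_ac)
        qed
        also note m1
        finally have L: "c\<^sup>2 * real (card (star 0 p) + N 0 * g + (h 0 - 1))
          < real (card (star 0 p) + N 1 * g + (h 1 - 1))" .
        have G: "c\<^sup>2 * (2 * x / y) < 2 * z / y" if "c\<^sup>2 * x < z" "y > 0" for x y z :: real
          using that by (simp add: divide_simps mult_ac)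
        show ?thesis unfolding d_def n_eq by (rule G[OF L]) (use n0 in simp)
      qed
      then have "c * d 0 < d 1 / c" using c by (simp add: field_simps power2_eq_square)
      then have "success (factor_approx c (d 0)) b \<inter> success (factor_approx c (d 1)) b = {}"
        by (auto simp: success_def factor_approx_def)
      \<comment> \<open>Each of the two disjoint events has probability at least 99/100 - 2/5, and
        these add up to more than 1.\<close>
      then have "measure_pmf.prob ?D (success (factor_approx c (d 0)) b)
          + measure_pmf.prob ?D (success (factor_approx c (d 1)) b)
          = measure_pmf.prob ?D (success (factor_approx c (d 0)) b \<union> success (factor_approx c (d 1)) b)"
        by (intro measure_pmf.finite_measure_Union[symmetric]) auto
      also have "\<dots> \<le> 1" by simp
      finally show False using P[of 0] P[of 1] b\<kappa> by linarith
    qed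
  qed
  then show ?thesis using \<delta>0 by blast
qed

subsection \<open>Subroutines\<close>

text \<open>Subroutines are written in continuation-passing style.\<close>

type_synonym 'a subroutine = "('a \<Rightarrow> algorithm) \<Rightarrow> algorithm"

text \<open>\<open>D\<close> is the joint law of result and cost. It is fixed before the
  continuation is, so the subroutine neither aborts nor depends on what follows; the bound
  \<open>C\<close> holds on every run of positive probability.\<close>

definition computes :: "nat set \<Rightarrow> nat set set \<Rightarrow> 'a subroutine \<Rightarrow> 'a pmf \<Rightarrow> nat \<Rightarrow> bool" where
  "computes V E P p C \<longleftrightarrow> (\<exists>D. (\<forall>\<kappa>. run V E (P \<kappa>) =
       bind_pmf D (\<lambda>(a, c). map_pmf (\<lambda>(r, c'). (r, c + c')) (run V E (\<kappa> a)))) \<and>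
     map_pmf fst D = p \<and> (\<forall>x\<in>set_pmf D. snd x \<le> C))"

definition only_asks :: "query set \<Rightarrow> 'a subroutine \<Rightarrow> bool" where
  "only_asks Q P \<longleftrightarrow> (\<forall>\<kappa>. (\<forall>a. only_queries Q (\<kappa> a)) \<longrightarrow> only_queries Q (P \<kappa>))"

lemma computes_mono:
  assumes "computes V E P p C" "C \<le> C'"
  shows "computes V E P p C'"
proof -
  obtain D where "\<forall>\<kappa>. run V E (P \<kappa>) =
       bind_pmf D (\<lambda>(a, c). map_pmf (\<lambda>(r, c'). (r, c + c')) (run V E (\<kappa> a)))"
     "map_pmf fst D = p" "\<forall>x\<in>set_pmf D. snd x \<le> C"
    using assms(1) unfolding computes_def by blast
  then show ?thesis unfolding computes_def using assms(2) by (intro exI[of _ D]) auto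
qed

lemma map_add_0 [simp]: "map_pmf (\<lambda>(r, c'). (r, 0 + c')) D = (D :: ('a \<times> nat) pmf)"
  by (simp add: case_prod_unfold pmf.map_ident)

lemma computes_return: "computes V E (\<lambda>\<kappa>. \<kappa> a) (return_pmf a) 0"
  unfolding computes_def
  by (rule exI[of _ "return_pmf (a, 0)"]) (simp add: bind_return_pmf del: add_0)

lemma computes_Coin: "computes V E (Coin p) p 0"
  unfolding computes_def
  by (rule exI[of _ "map_pmf (\<lambda>i. (i, 0)) p"])
     (auto simp: bind_map_pmf map_pmf_comp pmf.map_ident simp del: add_0)

lemma computes_Query:
  assumes "query_args q \<subseteq> V"
  shows "computes V E (\<lambda>\<kappa>. Query q (\<lambda>a. \<kappa> (f a))) (map_pmf f (respond V E q)) (query_cost q)"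
  unfolding computes_def
  by (rule exI[of _ "map_pmf (\<lambda>a. (f a, query_cost q)) (respond V E q)"])
     (use assms in \<open>auto simp: bind_map_pmf map_pmf_comp\<close>)

text \<open>The second part is only required to work on the support of \<open>p\<close>: later
  queries name sampled vertices, and only there are these known to lie in \<open>V\<close>.\<close>

lemma computes_bind:
  assumes P: "computes V E P p C" and Q: "\<And>a. a \<in> set_pmf p \<Longrightarrow> computes V E (P' a) (f a) C'"
  shows "computes V E (\<lambda>\<kappa>. P (\<lambda>a. P' a \<kappa>)) (bind_pmf p f) (C + C')"
proof -
  obtain D where D: "\<And>\<kappa>. run V E (P \<kappa>) =
       bind_pmf D (\<lambda>(a, c). map_pmf (\<lambda>(r, c'). (r, c + c')) (run V E (\<kappa> a)))"
     "map_pmf fst D = p" "\<And>x. x \<in> set_pmf D \<Longrightarrow> snd x \<le> C"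
    using P unfolding computes_def by auto
  obtain D' where D': "\<And>a \<kappa>. a \<in> set_pmf p \<Longrightarrow> run V E (P' a \<kappa>) =
       bind_pmf (D' a) (\<lambda>(b, c). map_pmf (\<lambda>(r, c'). (r, c + c')) (run V E (\<kappa> b)))"
     "\<And>a. a \<in> set_pmf p \<Longrightarrow> map_pmf fst (D' a) = f a"
     "\<And>a x. a \<in> set_pmf p \<Longrightarrow> x \<in> set_pmf (D' a) \<Longrightarrow> snd x \<le> C'"
    using Q unfolding computes_def by metis
  define H where "H = bind_pmf D (\<lambda>(a, c). map_pmf (\<lambda>(b, c'). (b, c + c')) (D' a))"
  have inp: "fst x \<in> set_pmf p" if "x \<in> set_pmf D" for x
    using that D(2) by auto
  have "run V E (P (\<lambda>a. P' a \<kappa>)) =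
      bind_pmf H (\<lambda>(a, c). map_pmf (\<lambda>(r, c'). (r, c + c')) (run V E (\<kappa> a)))" for \<kappa>
    unfolding D(1) H_def bind_assoc_pmf
    by (intro bind_pmf_cong refl)
       (auto simp: D'(1)[OF inp[of "(a, b)" for a b, simplified]] map_bind_pmf bind_map_pmf
         case_prod_unfold map_pmf_comp add.assoc intro!: bind_pmf_cong)
  moreover have "map_pmf fst H = bind_pmf p f"
    unfolding H_def D(2)[symmetric] bind_map_pmf map_bind_pmf
    by (intro bind_pmf_cong refl)
       (auto simp: map_pmf_comp case_prod_unfold D'(2)[OF inp] simp flip: D'(2)[OF inp])
  moreover have "snd x \<le> C + C'" if "x \<in> set_pmf H" for x
    using that D(3) D'(3)[OF inp] unfolding H_def by (fastforce simp: add_mono)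
  ultimately show ?thesis unfolding computes_def by blast
qed

lemma computes_map:
  assumes "computes V E P p C"
  shows "computes V E (\<lambda>\<kappa>. P (\<lambda>a. \<kappa> (f a))) (map_pmf f p) C"
  using computes_bind[OF assms computes_return, of f] by (simp add: map_pmf_def)

primrec repeat_sub :: "nat \<Rightarrow> 'a subroutine \<Rightarrow> 'a list subroutine" where
  "repeat_sub 0 P = (\<lambda>\<kappa>. \<kappa> [])"
| "repeat_sub (Suc n) P = (\<lambda>\<kappa>. P (\<lambda>x. repeat_sub n P (\<lambda>xs. \<kappa> (x # xs))))"

lemma computes_repeat:
  assumes "computes V E P p C"
  shows "computes V E (repeat_sub n P) (replicate_pmf n p) (n * C)"
proof (induction n)
  case 0
  then show ?case using computes_return[of V E "[]"] by simp
next
  case (Suc n)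
  have "computes V E (\<lambda>\<kappa>. P (\<lambda>x. repeat_sub n P (\<lambda>xs. \<kappa> (x # xs))))
     (bind_pmf p (\<lambda>x. map_pmf (Cons x) (replicate_pmf n p))) (C + n * C)"
    by (intro computes_bind computes_map Suc assms)
  then show ?case by (simp add: map_pmf_def)
qed

lemma only_asks_repeat: "only_asks Q P \<Longrightarrow> only_asks Q (repeat_sub n P)"
  by (induction n) (simp_all add: only_asks_def)

text \<open>The output 0 is a default for the event that every estimator rejects.\<close>

primrec first_accepted :: "real option subroutine list \<Rightarrow> algorithm" where
  "first_accepted [] = Output 0"
| "first_accepted (P # Ps) = P (\<lambda>r. case r of Some x \<Rightarrow> Output x | None \<Rightarrow> first_accepted Ps)"

lemma only_queries_first_accepted:
  "(\<And>P. P \<in> set Ps \<Longrightarrow> only_asks Q P) \<Longrightarrow> only_queries Q (first_accepted Ps)"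
  by (induction Ps) (auto simp: only_asks_def split: option.split)

text \<open>The worst-case cost \<open>C\<close> is charged in advance, so every good result leaves
  a budget of at least \<open>b - C\<close>; results outside \<open>G\<close> are counted as
  failures.\<close>

lemma hit_subroutine:
  assumes "computes V E P p C" "C \<le> b" "\<And>a. a \<in> G \<Longrightarrow> u \<le> hit V E (\<kappa> a) I (b - C)"
  shows "measure_pmf.prob p G * u \<le> hit V E (P \<kappa>) I b"
proof -
  obtain D where D: "\<And>\<kappa>. run V E (P \<kappa>) =
       bind_pmf D (\<lambda>(a, c). map_pmf (\<lambda>(r, c'). (r, c + c')) (run V E (\<kappa> a)))"
     "map_pmf fst D = p" "\<And>x. x \<in> set_pmf D \<Longrightarrow> snd x \<le> C"
    using assms(1) unfolding computes_def by auto
  have mono: "hit V E A I k \<le> hit V E A I k'" if "k \<le> k'" for A k k'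
    unfolding hit_def using that by (intro measure_pmf.finite_measure_mono) (auto simp: success_def)
  have "measure_pmf.prob p G * u = measure_pmf.expectation D (\<lambda>x. indicator (fst -` G) x * u)"
    by (simp add: D(2)[symmetric])
  also have "\<dots> \<le> measure_pmf.expectation D (\<lambda>x. hit V E (\<kappa> (fst x)) I (b - snd x))"
  proof (rule integral_mono_AE)
    show "integrable D (\<lambda>x. hit V E (\<kappa> (fst x)) I (b - snd x))"
      by (rule measure_pmf.integrable_const_bound[where B = 1]) (auto simp: hit_bounds)
    show "AE x in D. indicator (fst -` G) x * u \<le> hit V E (\<kappa> (fst x)) I (b - snd x)"
    proof (rule AE_pmfI)
      fix x assume "x \<in> set_pmf D"
      then have "b - C \<le> b - snd x" using D(3) by (simp add: diff_le_mono2)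
      then have "hit V E (\<kappa> (fst x)) I (b - C) \<le> hit V E (\<kappa> (fst x)) I (b - snd x)" by (rule mono)
      then show "indicator (fst -` G) x * u \<le> hit V E (\<kappa> (fst x)) I (b - snd x)"
        using assms(3)[of "fst x"] by (auto simp: indicator_def hit_bounds)
    qed
  qed (auto intro!: measure_pmf.integrable_const_bound[where B = 1])
  also have "\<dots> = hit V E (P \<kappa>) I b"
    unfolding hit_def D(1) prob_bind_pmf using D(3) assms(2)
    by (intro integral_cong_AE AE_pmfI)
       (auto simp: case_prod_unfold prob_add_cost[unfolded case_prod_unfold] intro: order_trans simp del: measure_map_pmf)
  finally show ?thesis .
qed

text \<open>A correct early acceptance is as good as reaching \<open>P\<close>, so the estimators
  before \<open>P\<close> may accept or reject as long as they do not accept a wrong value. Only the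
  attempts up to \<open>P\<close> contribute to error and cost, so larger scales listed after
  \<open>P\<close> do no harm.\<close>

lemma hit_first_accepted:
  fixes I :: "real set"
  assumes "\<And>P. P \<in> set Ps \<Longrightarrow> \<exists>p. computes V E P p C \<and> 1 - \<eta> \<le> measure_pmf.prob p {r. \<forall>x. r = Some x \<longrightarrow> x \<in> I}"
    and "\<exists>p. computes V E P p C \<and> 1 - \<eta> \<le> measure_pmf.prob p (Some ` I)"
    and "0 \<le> \<eta>" "real (Suc (length Ps)) * \<eta> \<le> 1"
  shows "1 - real (Suc (length Ps)) * \<eta> \<le> hit V E (first_accepted (Ps @ P # Ps')) I (Suc (length Ps) * C)"
  using assms(1,4)
proof (induction Ps)
  case Nil
  obtain p where p: "computes V E P p C" "1 - \<eta> \<le> measure_pmf.prob p (Some ` I)" using assms(2) by blast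
  have "measure_pmf.prob p (Some ` I) * 1 \<le> hit V E (first_accepted (P # Ps')) I C"
    unfolding first_accepted.simps
    by (rule hit_subroutine[OF p(1)]) (auto simp: hit_def success_def)
  then show ?case using p(2) by simp
next
  case (Cons R Ps)
  obtain p where p: "computes V E R p C"
      "1 - \<eta> \<le> measure_pmf.prob p {r. \<forall>x. r = Some x \<longrightarrow> x \<in> I}" using Cons.prems(1) by auto
  define u where "u = 1 - real (Suc (length Ps)) * \<eta>"
  have u: "u \<le> 1" "0 \<le> u" "0 \<le> 1 - \<eta>"
    using assms(3) Cons.prems(2) by (auto simp: u_def algebra_simps intro: order_trans[rotated])
  have IH: "u \<le> hit V E (first_accepted (Ps @ P # Ps')) I (Suc (length Ps) * C)"
    unfolding u_def using Cons.prems assms(3) by (intro Cons.IH) (auto simp: algebra_simps)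
  have "measure_pmf.prob p {r. \<forall>x. r = Some x \<longrightarrow> x \<in> I} * u
     \<le> hit V E (first_accepted ((R # Ps) @ P # Ps')) I (Suc (length (R # Ps)) * C)"
    unfolding append_Cons first_accepted.simps
  proof (rule hit_subroutine[OF p(1)], goal_cases)
    case (2 r)
    then show ?case using IH u(1)
      by (cases r) (auto simp: hit_def success_def)
  qed simp
  moreover have "(1 - \<eta>) * u \<le> measure_pmf.prob p {r. \<forall>x. r = Some x \<longrightarrow> x \<in> I} * u"
    using p(2) u by (intro mult_right_mono) auto
  moreover have "1 - real (Suc (length (R # Ps))) * \<eta> \<le> (1 - \<eta>) * u"
    using assms(3) by (simp add: u_def algebra_simps)
  ultimately show ?case by linarith
qed

subsection \<open>Moments and reliable means\<close>

abbreviation "expect p \<equiv> measure_pmf.expectation p"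

lemma expect_mono:
  assumes "finite (set_pmf p)" "\<And>x. x \<in> set_pmf p \<Longrightarrow> f x \<le> g x"
  shows "expect p f \<le> (expect p g :: real)"
  using assms by (intro integral_mono_AE integrable_measure_pmf_finite AE_pmfI) auto

lemma expect_bind:
  fixes g :: "'b \<Rightarrow> real"
  assumes "finite (set_pmf p)" "\<And>x. x \<in> set_pmf p \<Longrightarrow> finite (set_pmf (f x))"
  shows "expect (bind_pmf p f) g = expect p (\<lambda>x. expect (f x) g)"
proof -
  let ?A = "\<Union>x\<in>set_pmf p. set_pmf (f x)"
  have fin: "finite ?A" using assms by auto
  have "expect (bind_pmf p f) g = (\<Sum>y\<in>?A. g y * pmf (bind_pmf p f) y)"
    by (rule integral_measure_pmf_real[OF fin]) auto
  also have "\<dots> = (\<Sum>y\<in>?A. \<Sum>x\<in>set_pmf p. g y * (pmf (f x) y * pmf p x))"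
    unfolding pmf_bind by (subst integral_measure_pmf_real[OF assms(1)]) (auto simp: sum_distrib_left)
  also have "\<dots> = (\<Sum>x\<in>set_pmf p. (\<Sum>y\<in>?A. g y * pmf (f x) y) * pmf p x)"
    by (subst sum.swap) (simp add: sum_distrib_right mult.assoc)
  also have "\<dots> = (\<Sum>x\<in>set_pmf p. expect (f x) g * pmf p x)"
    by (intro sum.cong refl) (subst integral_measure_pmf_real[OF fin], auto)
  also have "\<dots> = expect p (\<lambda>x. expect (f x) g)"
    by (rule integral_measure_pmf_real[OF assms(1), symmetric]) auto
  finally show ?thesis .
qed

lemma expect_swap:
  fixes f :: "'a \<Rightarrow> 'b \<Rightarrow> real"
  assumes "finite (set_pmf p)" "finite (set_pmf q)"
  shows "expect p (\<lambda>x. expect q (f x)) = expect q (\<lambda>y. expect p (\<lambda>x. f x y))"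
proof -
  have "expect p (\<lambda>x. expect q (f x)) = (\<Sum>x\<in>set_pmf p. \<Sum>y\<in>set_pmf q. f x y * pmf q y * pmf p x)"
    by (simp add: integral_measure_pmf_real[OF assms(1)] integral_measure_pmf_real[OF assms(2)] sum_distrib_right)
  also have "\<dots> = (\<Sum>y\<in>set_pmf q. \<Sum>x\<in>set_pmf p. f x y * pmf p x * pmf q y)"
    by (subst sum.swap) (simp add: mult_ac)
  also have "\<dots> = expect q (\<lambda>y. expect p (\<lambda>x. f x y))"
    by (simp add: integral_measure_pmf_real[OF assms(1)] integral_measure_pmf_real[OF assms(2)] sum_distrib_right)
  finally show ?thesis .
qed

lemma finite_set_replicate_pmf: "finite (set_pmf p) \<Longrightarrow> finite (set_pmf (replicate_pmf n p))"
proof -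
  assume "finite (set_pmf p)"
  then have "finite {xs. set xs \<subseteq> set_pmf p \<and> length xs = n}" by (rule finite_lists_length_eq)
  moreover have "set_pmf (replicate_pmf n p) = {xs. set xs \<subseteq> set_pmf p \<and> length xs = n}"
    by (auto simp: set_replicate_pmf)
  ultimately show ?thesis by simp
qed

lemma expect_replicate_Suc:
  fixes g :: "'a list \<Rightarrow> real"
  assumes "finite (set_pmf p)"
  shows "expect (replicate_pmf (Suc n) p) g = expect p (\<lambda>x. expect (replicate_pmf n p) (\<lambda>xs. g (x # xs)))"
proof -
  have "replicate_pmf (Suc n) p = bind_pmf p (\<lambda>x. map_pmf (Cons x) (replicate_pmf n p))"
    by (simp add: map_pmf_def)
  then show ?thesis using assms finite_set_replicate_pmf[OF assms]
    by (subst (1) \<open>replicate_pmf (Suc n) p = _\<close>) (simp add: expect_bind)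
qed

lemma expect_replicate_sum:
  fixes f :: "'a \<Rightarrow> real"
  assumes fin: "finite (set_pmf p)"
  shows "expect (replicate_pmf n p) (\<lambda>xs. \<Sum>x\<leftarrow>xs. f x) = real n * expect p f"
proof (induction n)
  case (Suc n)
  note [simp] = integrable_measure_pmf_finite[OF fin]
    integrable_measure_pmf_finite[OF finite_set_replicate_pmf[OF fin]]
  show ?case unfolding expect_replicate_Suc[OF fin] using Suc by (simp add: algebra_simps)
qed simp

lemma expect_replicate_sum_sq:
  fixes f :: "'a \<Rightarrow> real"
  assumes fin: "finite (set_pmf p)"
  shows "expect (replicate_pmf n p) (\<lambda>xs. (\<Sum>x\<leftarrow>xs. f x)\<^sup>2)
    = real n * expect p (\<lambda>x. (f x)\<^sup>2) + real n * (real n - 1) * (expect p f)\<^sup>2"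
proof (induction n)
  case (Suc n)
  note [simp] = integrable_measure_pmf_finite[OF fin]
    integrable_measure_pmf_finite[OF finite_set_replicate_pmf[OF fin]]
  have "expect (replicate_pmf n p) (\<lambda>xs. (f x + (\<Sum>x\<leftarrow>xs. f x))\<^sup>2)
      = (f x)\<^sup>2 + 2 * f x * (real n * expect p f) + expect (replicate_pmf n p) (\<lambda>xs. (\<Sum>x\<leftarrow>xs. f x)\<^sup>2)" for x
  proof -
    have "expect (replicate_pmf n p) (\<lambda>xs. (f x + (\<Sum>x\<leftarrow>xs. f x))\<^sup>2)
       = expect (replicate_pmf n p) (\<lambda>xs. (f x)\<^sup>2 + 2 * f x * (\<Sum>x\<leftarrow>xs. f x) + (\<Sum>x\<leftarrow>xs. f x)\<^sup>2)"
      by (simp add: power2_sum algebra_simps)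
    then show ?thesis by (simp add: expect_replicate_sum[OF fin])
  qed
  then have "expect (replicate_pmf (Suc n) p) (\<lambda>xs. (\<Sum>x\<leftarrow>xs. f x)\<^sup>2)
    = expect p (\<lambda>x. (f x)\<^sup>2 + 2 * f x * (real n * expect p f) + expect (replicate_pmf n p) (\<lambda>xs. (\<Sum>x\<leftarrow>xs. f x)\<^sup>2))"
    unfolding expect_replicate_Suc[OF fin] by simp
  then show ?case unfolding Suc by (simp add: algebra_simps power2_eq_square)
qed simp

lemma expect_replicate_sum_sq_le:
  fixes f :: "'a \<Rightarrow> real"
  assumes fin: "finite (set_pmf p)"
  shows "expect (replicate_pmf n p) (\<lambda>xs. (\<Sum>x\<leftarrow>xs. f x)\<^sup>2)
    \<le> real n * expect p (\<lambda>x. (f x)\<^sup>2) + (real n)\<^sup>2 * (expect p f)\<^sup>2"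
proof -
  have "real n * (real n - 1) * (expect p f)\<^sup>2 \<le> (real n)\<^sup>2 * (expect p f)\<^sup>2"
    by (intro mult_right_mono) (auto simp: power2_eq_square algebra_simps)
  then show ?thesis unfolding expect_replicate_sum_sq[OF fin] by simp
qed

text \<open>Chebyshev's inequality, with the variance relaxed to the second moment.\<close>

lemma replicate_mean_deviation:
  fixes f :: "'a \<Rightarrow> real"
  assumes fin: "finite (set_pmf p)" and "0 < N" "0 < t"
  shows "measure_pmf.prob (replicate_pmf N p) {xs. \<bar>(\<Sum>x\<leftarrow>xs. f x) / real N - expect p f\<bar> \<ge> t}
     \<le> expect p (\<lambda>x. (f x)\<^sup>2) / (real N * t\<^sup>2)"
proof -
  let ?\<mu> = "expect p f" and ?R = "replicate_pmf N p"
  note [simp] = integrable_measure_pmf_finite[OF fin]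
  note finR = finite_set_replicate_pmf[OF fin, of N]
  have len: "length xs = N" if "xs \<in> set_pmf ?R" for xs using that by (simp add: set_replicate_pmf)
  have c: "(\<Sum>x\<leftarrow>xs. f x - ?\<mu>) = (\<Sum>x\<leftarrow>xs. f x) - real (length xs) * ?\<mu>" for xs
    by (induction xs) (auto simp: algebra_simps)
  have "measure_pmf.prob ?R {xs. \<bar>(\<Sum>x\<leftarrow>xs. f x) / real N - ?\<mu>\<bar> \<ge> t}
     = expect ?R (indicator {xs. \<bar>(\<Sum>x\<leftarrow>xs. f x) / real N - ?\<mu>\<bar> \<ge> t})"
    by simp
  also have "\<dots> \<le> expect ?R (\<lambda>xs. (\<Sum>x\<leftarrow>xs. f x - ?\<mu>)\<^sup>2 / (real N * t)\<^sup>2)"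
  proof (rule expect_mono[OF finR])
    fix xs assume "xs \<in> set_pmf ?R"
    then have eq: "(\<Sum>x\<leftarrow>xs. f x - ?\<mu>) = real N * ((\<Sum>x\<leftarrow>xs. f x) / real N - ?\<mu>)"
      using assms(2) by (simp add: c len algebra_simps)
    show "indicator {xs. \<bar>(\<Sum>x\<leftarrow>xs. f x) / real N - ?\<mu>\<bar> \<ge> t} xs \<le> (\<Sum>x\<leftarrow>xs. f x - ?\<mu>)\<^sup>2 / (real N * t)\<^sup>2"
    proof (cases "\<bar>(\<Sum>x\<leftarrow>xs. f x) / real N - ?\<mu>\<bar> \<ge> t")
      case True
      then have "t\<^sup>2 \<le> ((\<Sum>x\<leftarrow>xs. f x) / real N - ?\<mu>)\<^sup>2"
        using assms(3) by (metis abs_le_square_iff abs_of_pos)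
      then show ?thesis using True assms(2,3) unfolding eq power_mult_distrib by simp
    qed simp
  qed
  also have "\<dots> = (real N * expect p (\<lambda>x. (f x - ?\<mu>)\<^sup>2)) / (real N * t)\<^sup>2"
    using expect_replicate_sum_sq[OF fin, of N "\<lambda>x. f x - ?\<mu>"] by simp
  also have "expect p (\<lambda>x. (f x - ?\<mu>)\<^sup>2) = expect p (\<lambda>x. (f x)\<^sup>2) - ?\<mu>\<^sup>2"
  proof -
    have "expect p (\<lambda>x. (f x - ?\<mu>)\<^sup>2) = expect p (\<lambda>x. (f x)\<^sup>2 - 2 * ?\<mu> * f x + ?\<mu>\<^sup>2)"
      by (simp add: power2_diff algebra_simps)
    then show ?thesis by (simp add: power2_eq_square)
  qed
  also have "real N * (expect p (\<lambda>x. (f x)\<^sup>2) - ?\<mu>\<^sup>2) / (real N * t)\<^sup>2 \<le> real N * expect p (\<lambda>x. (f x)\<^sup>2) / (real N * t)\<^sup>2"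
    by (intro divide_right_mono mult_left_mono) auto
  also have "\<dots> = expect p (\<lambda>x. (f x)\<^sup>2) / (real N * t\<^sup>2)"
    using assms(2) by (simp add: power2_eq_square)
  finally show ?thesis .
qed

definition mean_of :: "('a \<Rightarrow> real) \<Rightarrow> 'a list \<Rightarrow> real" where
  "mean_of f xs = (\<Sum>x\<leftarrow>xs. f x) / real (length xs)"

text \<open>An empirical mean that is trusted only when it reaches \<open>\<tau> / 2\<close>: small true means are rejected,
  large ones accepted, and whatever is accepted is accurate.\<close>

definition reliable :: "real \<Rightarrow> real \<Rightarrow> real \<Rightarrow> real \<Rightarrow> bool" where
  "reliable \<delta> \<tau> \<mu> X \<longleftrightarrow> (X \<ge> \<tau> / 2 \<longrightarrow> \<bar>X - \<mu>\<bar> \<le> \<delta> * \<mu>) \<and> (\<mu> \<ge> \<tau> \<longrightarrow> X \<ge> \<tau> / 2)"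

text \<open>Chebyshev in two regimes. In both the deviation is compared with a mean of at least
  \<open>\<tau> / 4\<close>, so the part of the second moment that is linear in the mean costs
  \<open>4 * a / \<tau>\<close>, and the quadratic part costs only the constant
  \<open>b\<close>.\<close>

lemma mean_reliable:
  fixes f :: "'a \<Rightarrow> real"
  assumes fin: "finite (set_pmf p)" and pos: "0 < N" "0 < \<tau>" "0 < \<delta>" "\<delta> \<le> 1 / 2" "0 \<le> a" "0 \<le> b"
    and m: "0 \<le> expect p f" "expect p (\<lambda>x. (f x)\<^sup>2) \<le> a * expect p f + b * (expect p f)\<^sup>2"
  shows "measure_pmf.prob (replicate_pmf N p) {xs. \<not> reliable \<delta> \<tau> (expect p f) (mean_of f xs)}
     \<le> (4 * a / \<tau> + b) / (\<delta>\<^sup>2 * real N)"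
proof -
  let ?\<mu> = "expect p f" and ?R = "replicate_pmf N p"
  \<comment> \<open>A relative deviation where the mean is large. Below \<open>\<tau> / 4\<close> it
    is enough that the empirical mean stays under \<open>\<tau> / 2\<close>, which leaves room for a
    deviation of \<open>\<tau> / 4\<close>.\<close>
  define t where "t = (if ?\<mu> \<ge> \<tau> / 4 then \<delta> * ?\<mu> else \<tau> / 4)"
  have t0: "t > 0" using pos by (auto simp: t_def)
  have "measure_pmf.prob ?R {xs. \<not> reliable \<delta> \<tau> ?\<mu> (mean_of f xs)}
     = measure_pmf.prob ?R ({xs. \<not> reliable \<delta> \<tau> ?\<mu> (mean_of f xs)} \<inter> set_pmf ?R)"
    by (rule measure_Int_set_pmf[symmetric])
  also have "\<dots> \<le> measure_pmf.prob ?R {xs. \<bar>(\<Sum>x\<leftarrow>xs. f x) / real N - ?\<mu>\<bar> \<ge> t}"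
  proof (rule measure_pmf.finite_measure_mono; clarsimp)
    fix xs assume bad: "\<not> reliable \<delta> \<tau> ?\<mu> (mean_of f xs)" and "xs \<in> set_pmf ?R"
    then have X: "mean_of f xs = (\<Sum>x\<leftarrow>xs. f x) / real N"
      by (simp add: mean_of_def set_replicate_pmf)
    define X where "X = mean_of f xs"
    have "\<bar>X - ?\<mu>\<bar> \<ge> t"
    proof (cases "?\<mu> \<ge> \<tau> / 4")
      case True
      have "\<bar>X - ?\<mu>\<bar> > \<delta> * ?\<mu>"
      proof (rule ccontr)
        assume c: "\<not> \<bar>X - ?\<mu>\<bar> > \<delta> * ?\<mu>"
        have "\<delta> * ?\<mu> \<le> (1 / 2) * ?\<mu>" using pos m(1) by (intro mult_right_mono) auto
        then have "X \<ge> ?\<mu> / 2" using c by linarith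
        then show False using bad c by (auto simp: reliable_def X_def)
      qed
      then show ?thesis using True by (simp add: t_def)
    next
      case False
      then have "X \<ge> \<tau> / 2" using bad pos by (auto simp: reliable_def X_def)
      moreover have "t = \<tau> / 4" using False by (simp add: t_def)
      ultimately show ?thesis using False by linarith
    qed
    then show "t \<le> \<bar>(\<Sum>x\<leftarrow>xs. f x) / real N - ?\<mu>\<bar>" by (simp add: X X_def)
  qed
  also have "\<dots> \<le> expect p (\<lambda>x. (f x)\<^sup>2) / (real N * t\<^sup>2)"
    using replicate_mean_deviation[OF fin pos(1) t0] .
  also have "\<dots> \<le> (a * ?\<mu> + b * ?\<mu>\<^sup>2) / (real N * t\<^sup>2)"
    using m(2) by (intro divide_right_mono) auto
  also have "\<dots> = (a * ?\<mu> + b * ?\<mu>\<^sup>2) / t\<^sup>2 / real N" by simp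
  also have "\<dots> \<le> (4 * a / \<tau> + b) / \<delta>\<^sup>2 / real N"
  proof (intro divide_right_mono)
    show "(a * ?\<mu> + b * ?\<mu>\<^sup>2) / t\<^sup>2 \<le> (4 * a / \<tau> + b) / \<delta>\<^sup>2"
    proof (cases "?\<mu> \<ge> \<tau> / 4")
      case True
      then have \<mu>0: "?\<mu> > 0" using pos by linarith
      have "(a * ?\<mu> + b * ?\<mu>\<^sup>2) / t\<^sup>2 = (a / ?\<mu> + b) / \<delta>\<^sup>2"
        using True \<mu>0 pos by (simp add: t_def power2_eq_square field_simps)
      also have "a / ?\<mu> \<le> a / (\<tau> / 4)" using True pos \<mu>0 by (intro divide_left_mono) auto
      finally show ?thesis by (simp add: divide_right_mono mult.commute)
    next
      case False
      then have "a * ?\<mu> + b * ?\<mu>\<^sup>2 \<le> a * (\<tau> / 4) + b * (\<tau> / 4)\<^sup>2"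
        using m(1) pos by (intro add_mono mult_left_mono power_mono) auto
      then have "(a * ?\<mu> + b * ?\<mu>\<^sup>2) / t\<^sup>2 \<le> (a * (\<tau> / 4) + b * (\<tau> / 4)\<^sup>2) / (\<tau> / 4)\<^sup>2"
        using False by (simp add: t_def divide_right_mono)
      also have "\<dots> = 4 * a / \<tau> + b" using pos by (simp add: power2_eq_square field_simps)
      also have "\<dots> \<le> (4 * a / \<tau> + b) / \<delta>\<^sup>2"
      proof -
        have "\<delta>\<^sup>2 \<le> 1" using pos by (simp add: power_le_one)
        then show ?thesis using pos by (simp add: le_divide_eq mult_left_le)
      qed
      finally show ?thesis .
    qed
  qed auto
  also have "\<dots> = (4 * a / \<tau> + b) / (\<delta>\<^sup>2 * real N)" by simp
  finally show ?thesis .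
qed

text \<open>Meant for pairs whose two means have ratio \<open>d\<close>; \<open>None\<close> says
  that the samples are too thin to be trusted.\<close>

definition ratio_estimate :: "real \<Rightarrow> real \<Rightarrow> (real \<times> real) list \<Rightarrow> real option" where
  "ratio_estimate \<tau> \<tau>' xys = (let X = mean_of fst xys; Y = mean_of snd xys in
     if X \<ge> \<tau> / 2 \<and> Y \<ge> \<tau>' / 2 then Some (X / Y) else None)"

text \<open>For c = \<epsilon> / 4 the extreme quotients (1 + c) / (1 - c) and (1 - c) / (1 + c) lie
  within 1 + 4 c and 1 - 4 c.\<close>

lemma reliable_ratio:
  assumes "reliable (\<epsilon> / 4) \<tau> \<mu> X" "reliable (\<epsilon> / 4) \<tau>' \<nu> Y" "X \<ge> \<tau> / 2" "Y \<ge> \<tau>' / 2"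
    and "0 < \<tau>" "0 < \<tau>'" "0 < \<epsilon>" "\<epsilon> < 1" "\<mu> = d * \<nu>" "0 < d"
  shows "X / Y \<in> eps_approx \<epsilon> d"
proof -
  have XY: "\<bar>X - \<mu>\<bar> \<le> \<epsilon> / 4 * \<mu>" "\<bar>Y - \<nu>\<bar> \<le> \<epsilon> / 4 * \<nu>" "Y > 0" using assms by (auto simp: reliable_def)
  then have "\<epsilon> / 4 * \<nu> \<ge> 0" by linarith
  then have \<nu>0: "\<nu> \<ge> 0" using assms by (simp add: zero_le_mult_iff)
  define c where "c = \<epsilon> / 4"
  have c: "0 < c" "c < 1 / 4" using assms by (auto simp: c_def)
  have X: "(1 - c) * (d * \<nu>) \<le> X" "X \<le> (1 + c) * (d * \<nu>)" and Y: "(1 - c) * \<nu> \<le> Y" "Y \<le> (1 + c) * \<nu>"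
    using XY assms(9) unfolding c_def[symmetric] by (auto simp: abs_le_iff algebra_simps)
  have cc: "c * c \<le> c * 1" using c by (intro mult_left_mono) auto
  have "X \<le> (1 + 4 * c) * d * Y"
  proof -
    have "(1 + c) \<le> (1 + 4 * c) * (1 - c)" using c cc by (simp add: algebra_simps)
    then have "(1 + c) * (d * \<nu>) \<le> (1 + 4 * c) * (1 - c) * (d * \<nu>)"
      using \<nu>0 assms(10) by (intro mult_right_mono) auto
    also have "\<dots> = (1 + 4 * c) * d * ((1 - c) * \<nu>)" by simp
    also have "\<dots> \<le> (1 + 4 * c) * d * Y" using Y(1) c assms(10) by (intro mult_left_mono) auto
    finally show ?thesis using X(2) by linarith
  qed
  moreover have "(1 - 4 * c) * d * Y \<le> X"
  proof -
    have "(1 - 4 * c) * d * Y \<le> (1 - 4 * c) * d * ((1 + c) * \<nu>)"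
      using Y(2) c assms(10) by (intro mult_left_mono) auto
    also have "\<dots> = (1 - 4 * c) * (1 + c) * (d * \<nu>)" by simp
    also have "\<dots> \<le> (1 - c) * (d * \<nu>)"
      using \<nu>0 assms(10) c by (intro mult_right_mono) (auto simp: algebra_simps)
    finally show ?thesis using X(1) by linarith
  qed
  ultimately show ?thesis using XY(3) by (simp add: eps_approx_def c_def field_simps)
qed

text \<open>The second moment of the denominator is controlled only if the numerator has mean at
  least \<open>\<tau> / 4\<close>. Otherwise a reliable numerator alone already causes rejection.
  The heavy trial depends on this conditional form.\<close>

lemma ratio_estimate_correct:
  fixes p :: "(real \<times> real) pmf"
  assumes fin: "finite (set_pmf p)" and pos: "0 < \<tau>" "0 < \<tau>'" "0 < \<epsilon>" "\<epsilon> < 1" "0 < d" "0 < \<eta>"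
    and nonneg: "0 \<le> a" "0 \<le> b" "0 \<le> a'" "0 \<le> b'"
    and ratio: "expect p fst = d * expect p snd" "0 \<le> expect p snd"
    and m: "expect p (\<lambda>z. (fst z)\<^sup>2) \<le> a * expect p fst + b * (expect p fst)\<^sup>2"
    and m': "expect p fst \<ge> \<tau> / 4 \<Longrightarrow>
      expect p (\<lambda>z. (snd z)\<^sup>2) \<le> a' * expect p snd + b' * (expect p snd)\<^sup>2"
    and K: "4 * a / \<tau> + b \<le> K" "4 * a' / \<tau>' + b' \<le> K" "0 < K" and N: "real N \<ge> 32 * K / (\<eta> * \<epsilon>\<^sup>2)"
  shows "1 - \<eta> \<le> measure_pmf.prob (replicate_pmf N p)
      {xys. (\<forall>x. ratio_estimate \<tau> \<tau>' xys = Some x \<longrightarrow> x \<in> eps_approx \<epsilon> d) \<and>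
        (expect p fst \<ge> \<tau> \<and> expect p snd \<ge> \<tau>' \<longrightarrow> ratio_estimate \<tau> \<tau>' xys \<noteq> None)}"
    (is "_ \<le> measure_pmf.prob ?R ?G")
proof -
  let ?\<mu> = "expect p fst" and ?\<nu> = "expect p snd"
  have \<mu>0: "0 \<le> ?\<mu>" using ratio pos by simp
  have "32 * K / (\<eta> * \<epsilon>\<^sup>2) > 0" using pos K by simp
  then have N0: "0 < N" using N by (cases N) auto
  \<comment> \<open>The factor 32 is 16 from the accuracy \<open>\<epsilon> / 4\<close>, squared,
    times 2 from splitting \<open>\<eta>\<close> between the two means.\<close>
  have small: "k / ((\<epsilon> / 4)\<^sup>2 * real N) \<le> \<eta> / 2" if "k \<le> K" for k
  proof -
    have "32 * K \<le> real N * (\<eta> * \<epsilon>\<^sup>2)" using N pos by (simp add: divide_le_eq)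
    moreover have "k / ((\<epsilon> / 4)\<^sup>2 * real N) \<le> K / ((\<epsilon> / 4)\<^sup>2 * real N)" using that by (intro divide_right_mono) auto
    moreover have "K / ((\<epsilon> / 4)\<^sup>2 * real N) \<le> \<eta> / 2 \<longleftrightarrow> K \<le> \<eta> / 2 * ((\<epsilon> / 4)\<^sup>2 * real N)"
      using pos N0 by (intro divide_le_eq[THEN trans]) auto
    moreover have "32 * K \<le> real N * (\<eta> * \<epsilon>\<^sup>2) \<longleftrightarrow> K \<le> \<eta> / 2 * ((\<epsilon> / 4)\<^sup>2 * real N)"
      by (simp add: power2_eq_square field_simps)
    ultimately show ?thesis by (meson order_trans)
  qed
  let ?B = "{xys. \<not> reliable (\<epsilon> / 4) \<tau> ?\<mu> (mean_of fst xys)}"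
  let ?B' = "{xys. \<not> reliable (\<epsilon> / 4) \<tau>' ?\<nu> (mean_of snd xys)}"
  have B: "measure_pmf.prob ?R ?B \<le> \<eta> / 2"
    by (rule order_trans[OF mean_reliable[OF fin N0 pos(1) _ _ nonneg(1,2) \<mu>0 m] small[OF K(1)]])
       (use pos in auto)
  show ?thesis
  proof (cases "?\<mu> \<ge> \<tau> / 4")
    case True
    have B': "measure_pmf.prob ?R ?B' \<le> \<eta> / 2"
      by (rule order_trans[OF mean_reliable[OF fin N0 pos(2) _ _ nonneg(3,4) ratio(2) m'[OF True]] small[OF K(2)]])
         (use pos in auto)
    have "- ?G \<subseteq> ?B \<union> ?B'"
    proof (rule subsetI, rule ccontr)
      fix xys assume "xys \<in> - ?G" and "xys \<notin> ?B \<union> ?B'"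
      then have r: "reliable (\<epsilon> / 4) \<tau> ?\<mu> (mean_of fst xys)" "reliable (\<epsilon> / 4) \<tau>' ?\<nu> (mean_of snd xys)"
        by auto
      have "xys \<in> ?G"
        using reliable_ratio[OF r _ _ pos(1-4) ratio(1) pos(5)] r
        by (auto simp: ratio_estimate_def Let_def reliable_def split: if_splits)
      then show False using \<open>xys \<in> - ?G\<close> by blast
    qed
    then have "measure_pmf.prob ?R (- ?G) \<le> measure_pmf.prob ?R (?B \<union> ?B')"
      by (intro measure_pmf.finite_measure_mono) auto
    also have "\<dots> \<le> measure_pmf.prob ?R ?B + measure_pmf.prob ?R ?B'"
      by (intro measure_Un_le) auto
    finally have "measure_pmf.prob ?R (- ?G) \<le> \<eta>" using B B' by linarith
    then show ?thesis using measure_pmf.prob_compl[of ?G ?R] by (simp add: Compl_eq_Diff_UNIV)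
  next
    case False
    have "- ?G \<subseteq> ?B"
    proof (rule subsetI, rule ccontr)
      fix xys assume G: "xys \<in> - ?G" and "xys \<notin> ?B"
      then have r: "reliable (\<epsilon> / 4) \<tau> ?\<mu> (mean_of fst xys)" by auto
      have "mean_of fst xys < \<tau> / 2"
      proof (rule ccontr)
        assume "\<not> mean_of fst xys < \<tau> / 2"
        then have "\<bar>mean_of fst xys - ?\<mu>\<bar> \<le> \<epsilon> / 4 * ?\<mu>" "mean_of fst xys \<ge> \<tau> / 2"
          using r by (auto simp: reliable_def)
        moreover have "\<epsilon> / 4 * ?\<mu> \<le> 1 * ?\<mu>" using pos \<mu>0 by (intro mult_right_mono) auto
        ultimately show False using False by linarith
      qed
      then have "xys \<in> ?G" using False pos by (auto simp: ratio_estimate_def Let_def)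
      then show False using G by blast
    qed
    then have "measure_pmf.prob ?R (- ?G) \<le> measure_pmf.prob ?R ?B"
      by (intro measure_pmf.finite_measure_mono) auto
    then have "measure_pmf.prob ?R (- ?G) \<le> \<eta>" using B pos by linarith
    then show ?thesis using measure_pmf.prob_compl[of ?G ?R] by (simp add: Compl_eq_Diff_UNIV)
  qed
qed

subsection \<open>Edge counts as quadratic forms\<close>

text \<open>The two sets may overlap. The symmetric difference supplies the cross term between
  \<open>S - T\<close> and \<open>T - S\<close>, the counts for \<open>S\<close> and
  \<open>T\<close> supply those with the intersection, and the coefficients -2 cancel the squares of
  the two differences.\<close>

definition cross_terms :: "real \<Rightarrow> nat set \<Rightarrow> nat set \<Rightarrow> (real \<times> nat set) list" where
  "cross_terms c S T = [(c, (S - T) \<union> (T - S)), (- 2 * c, S - T), (- 2 * c, T - S), (c, S), (c, T)]"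

text \<open>\<open>Additive\<close> counts edges without weights. Writing the weights in binary
  reduces a weighted count to \<open>B * B\<close> unweighted ones, with only logarithmic
  overhead.\<close>

definition digit_terms :: "nat \<Rightarrow> nat set \<Rightarrow> nat set \<Rightarrow> (nat \<Rightarrow> nat) \<Rightarrow> (nat \<Rightarrow> nat) \<Rightarrow> (real \<times> nat set) list" where
  "digit_terms B X Y \<mu> \<nu> = concat (map (\<lambda>b. concat (map (\<lambda>b'.
     cross_terms (2 ^ b * 2 ^ b') {x \<in> X. bit (\<mu> x) b} {y \<in> Y. bit (\<nu> y) b'}) [0..<B])) [0..<B])"

lemma binary_digits:
  fixes k :: nat
  assumes "k < 2 ^ B"
  shows "real k = (\<Sum>b<B. 2 ^ b * of_bool (bit k b))"
proof -
  have "k = take_bit B k" using assms by (simp add: take_bit_nat_eq_self)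
  also have "\<dots> = (\<Sum>b = 0..<B. push_bit b (of_bool (bit k b)))" by (rule take_bit_sum)
  finally have "real k = real (\<Sum>b = 0..<B. push_bit b (of_bool (bit k b)))" by (rule arg_cong)
  then show ?thesis by (simp add: push_bit_eq_mult lessThan_atLeast0 mult.commute)
qed

lemma sum_list_concat_map:
  "(\<Sum>z\<leftarrow>concat (map f xs). g z) = (\<Sum>x\<leftarrow>xs. \<Sum>z\<leftarrow>f x. (g z :: real))"
  by (induction xs) auto

lemma length_digit_terms: "length (digit_terms B X Y \<mu> \<nu>) = 5 * B * B"
  by (simp add: digit_terms_def cross_terms_def length_concat comp_def sum_list_triv)

lemma digit_terms_sub: "(c, U) \<in> set (digit_terms B X Y \<mu> \<nu>) \<Longrightarrow> U \<subseteq> X \<union> Y"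
  by (auto simp: digit_terms_def cross_terms_def)

section \<open>Arcs, degrees and the adjacency form of a graph\<close>

locale graph =
  fixes n :: nat and V :: "nat set" and E :: "nat set set"
  assumes graph: "graph_on n V E"
begin

lemma finV: "finite V" and cardV: "card V = n" and V_ne: "V \<noteq> {}"
  and edge: "e \<in> E \<Longrightarrow> e \<subseteq> V" "e \<in> E \<Longrightarrow> card e = 2"
  and nbrs_ne: "x \<in> V \<Longrightarrow> nbrs E x \<noteq> {}"
  using graph by (auto simp: graph_on_def simple_graph_def no_isolated_def)

lemma finE: "finite E"
  using finV edge(1) by (intro finite_subset[of E "Pow V"]) auto

lemma nbrs_sub: "nbrs E x \<subseteq> V - {x}"
  using edge by (force simp: nbrs_def)

lemma fin_nbrs: "finite (nbrs E x)"
  using nbrs_sub finV by (meson finite_Diff finite_subset)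

lemma deg_pos: "x \<in> V \<Longrightarrow> 1 \<le> deg E x"
  unfolding deg_def using nbrs_ne fin_nbrs by (simp add: Suc_le_eq card_gt_0_iff)

lemma deg_less: "x \<in> V \<Longrightarrow> deg E x < n"
proof -
  assume x: "x \<in> V"
  have "deg E x \<le> card (V - {x})" unfolding deg_def using nbrs_sub finV by (intro card_mono) auto
  also have "\<dots> < n" using x finV cardV V_ne by (metis card_Diff1_less)
  finally show ?thesis .
qed

lemma n_ge_2: "2 \<le> n"
proof -
  obtain x where "x \<in> V" using V_ne by blast
  then show ?thesis using deg_pos[of x] deg_less[of x] by linarith
qed

definition arcs :: "(nat \<times> nat) set" where "arcs = {(x, y). {x, y} \<in> E}"

lemma arcs_Sigma: "arcs = Sigma V (nbrs E)"
  using edge by (fastforce simp: arcs_def nbrs_def)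

lemma arcs_ne: "(x, y) \<in> arcs \<Longrightarrow> x \<noteq> y"
  using nbrs_sub by (auto simp: arcs_Sigma)

lemma sum_arcs_edges: "(\<Sum>(x, y)\<in>arcs. h {x, y}) = 2 * (\<Sum>e\<in>E. h e :: real)"
proof -
  have fin: "finite arcs" unfolding arcs_Sigma using finV fin_nbrs by auto
  have "(\<Sum>(x, y)\<in>arcs. h {x, y}) = (\<Sum>e\<in>E. \<Sum>p\<in>{p \<in> arcs. (\<lambda>(x, y). {x, y}) p = e}. (\<lambda>(x, y). h {x, y}) p)"
    by (rule sum.group[symmetric]) (auto simp: fin finE, auto simp: arcs_def)
  also have "\<dots> = (\<Sum>e\<in>E. 2 * h e)"
  proof (rule sum.cong[OF refl])
    fix e assume e: "e \<in> E"
    then obtain a b where ab: "e = {a, b}" "a \<noteq> b" using edge(2) by (metis card_2_iff)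
    have "{p \<in> arcs. (\<lambda>(x, y). {x, y}) p = e} = {(a, b), (b, a)}"
      using e ab by (auto simp: arcs_def doubleton_eq_iff insert_commute)
    then show "(\<Sum>p\<in>{p \<in> arcs. (\<lambda>(x, y). {x, y}) p = e}. (\<lambda>(x, y). h {x, y}) p) = 2 * h e"
      using ab by (simp add: insert_commute)
  qed
  finally show ?thesis by (simp add: sum_distrib_left)
qed

lemma sum_arcs_swap: "(\<Sum>(x, y)\<in>arcs. f x y) = (\<Sum>(x, y)\<in>arcs. f y x)"
  by (rule sum.reindex_bij_witness[of _ prod.swap prod.swap]) (auto simp: arcs_def insert_commute)

lemma sum_arcs_fst: "(\<Sum>(x, y)\<in>arcs. f x) = (\<Sum>x\<in>V. real (deg E x) * f x)"
  unfolding arcs_Sigma using finV fin_nbrs by (subst sum.Sigma[symmetric]) (auto simp: deg_def)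

text \<open>Double counting of incidences; this identity is why a random endpoint of a random edge
  is distributed proportionally to the degree.\<close>

lemma sum_endpoints: "(\<Sum>e\<in>E. \<Sum>x\<in>e. f x) = (\<Sum>x\<in>V. real (deg E x) * f x)"
proof -
  have "2 * (\<Sum>e\<in>E. \<Sum>x\<in>e. f x) = (\<Sum>(x, y)\<in>arcs. \<Sum>z\<in>{x, y}. f z)"
    by (rule sum_arcs_edges[symmetric])
  also have "\<dots> = (\<Sum>(x, y)\<in>arcs. f x + f y)"
    using arcs_ne by (intro sum.cong refl) (auto split: prod.split)
  also have "\<dots> = (\<Sum>(x, y)\<in>arcs. f x) + (\<Sum>(x, y)\<in>arcs. f y)"
    by (simp add: case_prod_unfold sum.distrib)
  also have "(\<Sum>(x, y)\<in>arcs. f y) = (\<Sum>(x, y)\<in>arcs. f x)" by (rule sum_arcs_swap)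
  finally show ?thesis by (simp add: sum_arcs_fst)
qed

definition m :: real where "m = real (card E)"

lemma handshake: "(\<Sum>x\<in>V. real (deg E x)) = 2 * m"
proof -
  have "(\<Sum>e\<in>E. \<Sum>x\<in>e. (1 :: real)) = (\<Sum>e\<in>E. 2)" using edge(2) by (intro sum.cong) auto
  then show ?thesis using sum_endpoints[of "\<lambda>_. 1"] by (simp add: m_def)
qed

abbreviation "d \<equiv> avg_degree V E"

lemma d_eq: "d = 2 * m / real n"
  by (simp add: avg_degree_def m_def cardV)

lemma d_bounds: "1 \<le> d" "d \<le> real n"
proof -
  have "(\<Sum>x\<in>V. 1) \<le> (\<Sum>x\<in>V. real (deg E x))" using deg_pos by (intro sum_mono) force
  then show "1 \<le> d" using n_ge_2 by (simp add: handshake d_eq cardV divide_simps)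
  have "(\<Sum>x\<in>V. real (deg E x)) \<le> (\<Sum>x\<in>V. real n)" using deg_less by (intro sum_mono) force
  then show "d \<le> real n" using n_ge_2 by (simp add: handshake d_eq cardV divide_simps)
qed

lemma m_pos: "0 < m"
  using d_bounds(1) n_ge_2 by (simp add: d_eq divide_simps)

lemma E_ne: "E \<noteq> {}"
  using m_pos by (auto simp: m_def)

definition adj :: "nat \<Rightarrow> nat \<Rightarrow> real" where "adj x y = of_bool ({x, y} \<in> E)"

definition bil :: "(nat \<Rightarrow> real) \<Rightarrow> (nat \<Rightarrow> real) \<Rightarrow> real" where
  "bil \<phi> \<psi> = (\<Sum>x\<in>V. \<Sum>y\<in>V. \<phi> x * \<psi> y * adj x y)"

lemma adj_sym: "adj x y = adj y x"
  by (simp add: adj_def insert_commute)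

lemma bil_sym: "bil \<phi> \<psi> = bil \<psi> \<phi>"
  unfolding bil_def by (subst sum.swap) (simp add: adj_sym mult.commute)

lemma bil_add: "bil (\<lambda>x. \<phi> x + \<phi>' x) \<psi> = bil \<phi> \<psi> + bil \<phi>' \<psi>"
    "bil \<phi> (\<lambda>x. \<psi> x + \<psi>' x) = bil \<phi> \<psi> + bil \<phi> \<psi>'"
  unfolding bil_def by (simp_all add: algebra_simps sum.distrib)

lemma bil_sum:
  "bil (\<lambda>x. \<Sum>b\<in>I. c b * \<phi> b x) (\<lambda>x. \<Sum>b'\<in>J. c' b' * \<psi> b' x)
     = (\<Sum>b\<in>I. \<Sum>b'\<in>J. c b * c' b' * bil (\<phi> b) (\<psi> b'))"
proof -
  have "bil (\<lambda>x. \<Sum>b\<in>I. c b * \<phi> b x) (\<lambda>x. \<Sum>b'\<in>J. c' b' * \<psi> b' x)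
     = (\<Sum>x\<in>V. \<Sum>y\<in>V. \<Sum>b\<in>I. \<Sum>b'\<in>J. c b * c' b' * (\<phi> b x * \<psi> b' y * adj x y))"
    unfolding bil_def sum_product sum_distrib_right by (intro sum.cong refl) (simp add: sum_distrib_left mult_ac)
  also have "\<dots> = (\<Sum>x\<in>V. \<Sum>b\<in>I. \<Sum>y\<in>V. \<Sum>b'\<in>J. c b * c' b' * (\<phi> b x * \<psi> b' y * adj x y))"
    by (intro sum.cong refl sum.swap)
  also have "\<dots> = (\<Sum>b\<in>I. \<Sum>x\<in>V. \<Sum>y\<in>V. \<Sum>b'\<in>J. c b * c' b' * (\<phi> b x * \<psi> b' y * adj x y))"
    by (rule sum.swap)
  also have "\<dots> = (\<Sum>b\<in>I. \<Sum>x\<in>V. \<Sum>b'\<in>J. \<Sum>y\<in>V. c b * c' b' * (\<phi> b x * \<psi> b' y * adj x y))"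
    by (intro sum.cong refl sum.swap)
  also have "\<dots> = (\<Sum>b\<in>I. \<Sum>b'\<in>J. \<Sum>x\<in>V. \<Sum>y\<in>V. c b * c' b' * (\<phi> b x * \<psi> b' y * adj x y))"
    by (intro sum.cong refl sum.swap)
  finally show ?thesis unfolding bil_def by (simp add: sum_distrib_left)
qed

lemma bil_arcs: "bil \<phi> \<psi> = (\<Sum>(x, y)\<in>arcs. \<phi> x * \<psi> y)"
proof -
  have "bil \<phi> \<psi> = (\<Sum>x\<in>V. \<Sum>y\<in>nbrs E x. \<phi> x * \<psi> y)"
    unfolding bil_def
  proof (rule sum.cong[OF refl])
    fix x
    show "(\<Sum>y\<in>V. \<phi> x * \<psi> y * adj x y) = (\<Sum>y\<in>nbrs E x. \<phi> x * \<psi> y)"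
      using nbrs_sub[of x] finV by (intro sum.mono_neutral_cong_right) (auto simp: adj_def nbrs_def)
  qed
  also have "\<dots> = (\<Sum>(x, y)\<in>arcs. \<phi> x * \<psi> y)"
    unfolding arcs_Sigma using finV fin_nbrs by (intro sum.Sigma) auto
  finally show ?thesis .
qed

lemma bil_edges: "bil \<phi> \<phi> = 2 * (\<Sum>e\<in>E. \<Prod>x\<in>e. \<phi> x)"
proof -
  have "bil \<phi> \<phi> = (\<Sum>(x, y)\<in>arcs. \<Prod>z\<in>{x, y}. \<phi> z)"
    unfolding bil_arcs using arcs_ne by (intro sum.cong refl) (auto split: prod.split)
  then show ?thesis by (simp only: sum_arcs_edges)
qed

definition esub :: "nat set \<Rightarrow> real" where "esub S = real (card {e \<in> E. e \<subseteq> S})"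

abbreviation ind :: "nat set \<Rightarrow> nat \<Rightarrow> real" where "ind S \<equiv> (\<lambda>x. of_bool (x \<in> S))"

lemma esub_bil: "bil (ind S) (ind S) = 2 * esub S"
proof -
  have "(\<Prod>x\<in>e. ind S x) = of_bool (e \<subseteq> S)" if "e \<in> E" for e
  proof -
    have "finite e" using edge(1)[OF that] finV finite_subset by blast
    then show ?thesis by (induction e rule: finite_induct) auto
  qed
  then show ?thesis unfolding bil_edges esub_def
    by (simp add: finE sum.If_cases Int_def of_bool_def cong: sum.cong)
qed

text \<open>Counting edges between overlapping sets by polarisation of the quadratic form \<open>2 * esub\<close>.\<close>

lemma cross_terms: "(\<Sum>(c', U)\<leftarrow>cross_terms c S T. c' * esub U) = c * bil (ind S) (ind T)"
proof -
  define p r i where "p = ind (S - T)" and "r = ind (T - S)" and "i = ind (S \<inter> T)"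
  have 1: "ind S = (\<lambda>x. p x + i x)" "ind T = (\<lambda>x. r x + i x)"
      "ind ((S - T) \<union> (T - S)) = (\<lambda>x. p x + r x)" by (auto simp: p_def r_def i_def)
  have sq: "esub U = bil (ind U) (ind U) / 2" for U by (simp add: esub_bil)
  have PR: "esub (S - T) = bil p p / 2" "esub (T - S) = bil r r / 2"
    unfolding sq p_def r_def by (rule refl)+
  have a: "esub S = (bil p p + 2 * bil p i + bil i i) / 2"
    unfolding sq[of S] 1(1) bil_add by (simp add: bil_sym[of i p])
  have b: "esub T = (bil r r + 2 * bil r i + bil i i) / 2"
    unfolding sq[of T] 1(2) bil_add by (simp add: bil_sym[of i r])
  have c: "esub ((S - T) \<union> (T - S)) = (bil p p + 2 * bil p r + bil r r) / 2"
    unfolding sq[of "(S - T) \<union> (T - S)"] 1(3) bil_add by (simp add: bil_sym[of r p])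
  have d: "bil (ind S) (ind T) = bil p r + bil p i + bil r i + bil i i"
    unfolding 1(1,2) bil_add by (simp add: bil_sym[of i r])
  show ?thesis unfolding cross_terms_def d
    by (simp add: a b c PR algebra_simps add_divide_distrib)
qed

text \<open>Bilinearity applied to the binary expansions. The sets \<open>X\<close> and
  \<open>Y\<close> have to contain the supports because the digit sets are formed inside
  them.\<close>

lemma digit_terms:
  assumes "\<And>x. \<mu> x < 2 ^ B" "\<And>x. \<nu> x < 2 ^ B" "\<And>x. \<mu> x \<noteq> 0 \<Longrightarrow> x \<in> X" "\<And>x. \<nu> x \<noteq> 0 \<Longrightarrow> x \<in> Y"
  shows "(\<Sum>(c, U)\<leftarrow>digit_terms B X Y \<mu> \<nu>. c * esub U) = bil (\<lambda>x. real (\<mu> x)) (\<lambda>x. real (\<nu> x))"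
proof -
  have \<mu>: "(\<lambda>x. real (\<mu> x)) = (\<lambda>x. \<Sum>b<B. 2 ^ b * ind {x \<in> X. bit (\<mu> x) b} x)"
    using assms(3) by (intro ext, subst binary_digits[OF assms(1)]) (force intro!: sum.cong simp: of_bool_def)
  have \<nu>: "(\<lambda>x. real (\<nu> x)) = (\<lambda>x. \<Sum>b<B. 2 ^ b * ind {x \<in> Y. bit (\<nu> x) b} x)"
    using assms(4) by (intro ext, subst binary_digits[OF assms(2)]) (force intro!: sum.cong simp: of_bool_def)
  show ?thesis unfolding digit_terms_def sum_list_concat_map cross_terms
    unfolding \<mu> \<nu> bil_sum by (simp add: interv_sum_list_conv_sum_set_nat lessThan_atLeast0)
qed

definition prop_vertex :: "nat pmf" where
  "prop_vertex = bind_pmf (pmf_of_set E) pmf_of_set"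

lemma edge_fin_ne: "e \<in> E \<Longrightarrow> finite e \<and> e \<noteq> {}"
  using edge(2) by (metis card.empty card.infinite zero_neq_numeral)

lemma set_prop_vertex: "set_pmf prop_vertex \<subseteq> V"
proof
  fix x assume "x \<in> set_pmf prop_vertex"
  then obtain e where e: "e \<in> E" "x \<in> set_pmf (pmf_of_set e)"
    using set_pmf_of_set[OF E_ne finE] by (auto simp: prop_vertex_def)
  then have "x \<in> e" using edge_fin_ne[OF e(1)] by simp
  then show "x \<in> V" using edge(1)[OF e(1)] by blast
qed

lemma finite_prop_vertex: "finite (set_pmf prop_vertex)"
  using set_prop_vertex finV finite_subset by blast

end

subsection \<open>Sampling trials\<close>

lemma expect_two_samples:
  fixes h :: "'a \<Rightarrow> 'a \<Rightarrow> real"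
  assumes fin: "finite (set_pmf p)"
  shows "expect (replicate_pmf s p) (\<lambda>xs. expect (replicate_pmf s p) (\<lambda>ys. \<Sum>y\<leftarrow>ys. \<Sum>x\<leftarrow>xs. h x y))
    = (real s)\<^sup>2 * expect p (\<lambda>x. expect p (h x))"
proof -
  let ?R = "replicate_pmf s p"
  have "expect ?R (\<lambda>xs. expect ?R (\<lambda>ys. \<Sum>y\<leftarrow>ys. \<Sum>x\<leftarrow>xs. h x y))
    = real s * expect ?R (\<lambda>xs. expect p (\<lambda>y. \<Sum>x\<leftarrow>xs. h x y))"
    by (simp add: expect_replicate_sum[OF fin, of _ "\<lambda>y. \<Sum>x\<leftarrow>xs. h x y" for xs])
  also have "expect ?R (\<lambda>xs. expect p (\<lambda>y. \<Sum>x\<leftarrow>xs. h x y)) = expect p (\<lambda>y. expect ?R (\<lambda>xs. \<Sum>x\<leftarrow>xs. h x y))"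
    by (rule expect_swap[OF finite_set_replicate_pmf[OF fin] fin])
  also have "\<dots> = real s * expect p (\<lambda>y. expect p (\<lambda>x. h x y))"
    by (simp add: expect_replicate_sum[OF fin])
  also have "expect p (\<lambda>y. expect p (\<lambda>x. h x y)) = expect p (\<lambda>x. expect p (h x))"
    by (rule expect_swap[OF fin fin])
  finally show ?thesis by (simp add: power2_eq_square)
qed

text \<open>Expanding the square gives pairs of positions in an s by s grid. They share both
  indices, one of them, or none, in about s^2, s^3 (twice) and s^4 cases; the marginal expectations
  measure the correlation along a common row or column.\<close>

lemma expect_two_samples_sq_le:
  fixes h :: "'a \<Rightarrow> 'a \<Rightarrow> real"
  assumes fin: "finite (set_pmf p)"
  shows "expect (replicate_pmf s p) (\<lambda>xs. expect (replicate_pmf s p) (\<lambda>ys. (\<Sum>y\<leftarrow>ys. \<Sum>x\<leftarrow>xs. h x y)\<^sup>2))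
    \<le> (real s)\<^sup>2 * expect p (\<lambda>x. expect p (\<lambda>y. (h x y)\<^sup>2)) + real s ^ 3 * expect p (\<lambda>y. (expect p (\<lambda>x. h x y))\<^sup>2)
      + real s ^ 3 * expect p (\<lambda>x. (expect p (h x))\<^sup>2) + real s ^ 4 * (expect p (\<lambda>x. expect p (h x)))\<^sup>2"
proof -
  let ?R = "replicate_pmf s p"
  note finR = finite_set_replicate_pmf[OF fin, of s]
  note [simp] = integrable_measure_pmf_finite[OF fin] integrable_measure_pmf_finite[OF finR]
  let ?G = "\<lambda>xs y. \<Sum>x\<leftarrow>xs. h x y"
  have lin: "expect p (?G xs) = (\<Sum>x\<leftarrow>xs. expect p (h x))" for xs
    by (induction xs) simp_all
  let ?A = "expect p (\<lambda>x. expect p (\<lambda>y. (h x y)\<^sup>2))" and ?B = "expect p (\<lambda>y. (expect p (\<lambda>x. h x y))\<^sup>2)"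
  let ?C = "expect p (\<lambda>x. (expect p (h x))\<^sup>2)" and ?D = "(expect p (\<lambda>x. expect p (h x)))\<^sup>2"
  let ?X = "expect p (\<lambda>y. expect ?R (\<lambda>xs. (?G xs y)\<^sup>2))"
  let ?Y = "expect ?R (\<lambda>xs. (\<Sum>x\<leftarrow>xs. expect p (h x))\<^sup>2)"
  \<comment> \<open>The bound for one sample is used conditionally on \<open>xs\<close>, and then
    once more for each of the two resulting terms.\<close>
  have "expect ?R (\<lambda>xs. expect ?R (\<lambda>ys. (\<Sum>y\<leftarrow>ys. ?G xs y)\<^sup>2))
     \<le> expect ?R (\<lambda>xs. real s * expect p (\<lambda>y. (?G xs y)\<^sup>2) + (real s)\<^sup>2 * (\<Sum>x\<leftarrow>xs. expect p (h x))\<^sup>2)"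
    unfolding lin[symmetric] by (intro expect_mono finR expect_replicate_sum_sq_le fin)
  also have "\<dots> = real s * ?X + (real s)\<^sup>2 * ?Y"
    by (simp add: expect_swap[OF finR fin])
  also have "\<dots> \<le> real s * (real s * ?A + (real s)\<^sup>2 * ?B) + (real s)\<^sup>2 * (real s * ?C + (real s)\<^sup>2 * ?D)"
  proof (intro add_mono mult_left_mono)
    have "?X \<le> expect p (\<lambda>y. real s * expect p (\<lambda>x. (h x y)\<^sup>2) + (real s)\<^sup>2 * (expect p (\<lambda>x. h x y))\<^sup>2)"
      by (intro expect_mono fin expect_replicate_sum_sq_le)
    also have "\<dots> = real s * ?A + (real s)\<^sup>2 * ?B"
      by (simp add: expect_swap[OF fin fin, of "\<lambda>x y. (h x y)\<^sup>2"])
    finally show "?X \<le> real s * ?A + (real s)\<^sup>2 * ?B" .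
    show "?Y \<le> real s * ?C + (real s)\<^sup>2 * ?D" by (rule expect_replicate_sum_sq_le[OF fin])
  qed auto
  also have "\<dots> = (real s)\<^sup>2 * ?A + real s ^ 3 * ?B + real s ^ 3 * ?C + real s ^ 4 * ?D"
  proof -
    have "t * (t * a + t\<^sup>2 * b) + t\<^sup>2 * (t * c + t\<^sup>2 * u) = t\<^sup>2 * a + t ^ 3 * b + t ^ 3 * c + t ^ 4 * u"
      for t a b c u :: real
      by (simp add: algebra_simps power2_eq_square power3_eq_cube power4_eq_xxxx)
    then show ?thesis .
  qed
  finally show ?thesis .
qed

lemma computes_seq:
  "computes V E P (return_pmf a) C \<Longrightarrow> computes V E (P' a) q C' \<Longrightarrow>
    computes V E (\<lambda>\<kappa>. P (\<lambda>a. P' a \<kappa>)) q (C + C')"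
  using computes_bind[of V E P "return_pmf a" C P' "\<lambda>_. q" C'] by (simp add: bind_return_pmf)

text \<open>Here and below, the values for answers of the wrong shape are placeholders that make the
  continuation total.\<close>

definition ask_vertex :: "nat subroutine" where
  "ask_vertex = (\<lambda>\<kappa>. Query RandVert (\<lambda>a. \<kappa> (case a of Vertex v \<Rightarrow> v | _ \<Rightarrow> 0)))"

definition ask_edge :: "nat set subroutine" where
  "ask_edge = (\<lambda>\<kappa>. Query RandEdge (\<lambda>a. \<kappa> (case a of Edge e \<Rightarrow> e | _ \<Rightarrow> {})))"

definition ask_degree :: "nat \<Rightarrow> nat subroutine" where
  "ask_degree x = (\<lambda>\<kappa>. Query (Degree x) (\<lambda>a. \<kappa> (case a of Number k \<Rightarrow> k | _ \<Rightarrow> 0)))"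

definition ask_prop :: "(nat \<times> nat) subroutine" where
  "ask_prop = (\<lambda>\<kappa>. ask_edge (\<lambda>e. Coin (pmf_of_set e) (\<lambda>v. ask_degree v (\<lambda>k. \<kappa> (v, k)))))"

primrec ask_additive :: "(real \<times> nat set) list \<Rightarrow> real subroutine" where
  "ask_additive [] = (\<lambda>\<kappa>. \<kappa> 0)"
| "ask_additive (cU # cUs) = (\<lambda>\<kappa>. Query (Additive (snd cU)) (\<lambda>a. ask_additive cUs
     (\<lambda>r. \<kappa> (fst cU * (case a of Number k \<Rightarrow> real k | _ \<Rightarrow> 0) + r))))"

text \<open>A scaled reciprocal degree \<open>n / k\<close>, rounded to an integer so that it has
  binary digits. The cutoff at degree \<open>\<theta> / 2\<close> keeps it below
  \<open>2 * n / \<theta>\<close>.\<close>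

definition heavy_weight :: "nat \<Rightarrow> nat \<Rightarrow> nat \<Rightarrow> nat" where
  "heavy_weight n \<theta> k = (if \<theta> < 2 * k then n div k else 0)"

text \<open>Repeated samples of one vertex add up their weights, so the sum over all pairs of
  samples becomes a bilinear form in two weight functions.\<close>

definition weight_at :: "(nat \<Rightarrow> nat) \<Rightarrow> (nat \<times> nat) list \<Rightarrow> nat \<Rightarrow> nat" where
  "weight_at f zs x = (\<Sum>z\<leftarrow>zs. if fst z = x then f (snd z) else 0)"

definition inverse_degree_trial :: "(real \<times> real) subroutine" where
  "inverse_degree_trial = (\<lambda>\<kappa>. ask_prop (\<lambda>z. \<kappa> (1, 1 / real (snd z))))"

text \<open>Both means are the total degree of the vertices of degree at most
  \<open>\<theta>\<close>, divided by \<open>n\<close> and by \<open>2 * m\<close> respectively, so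
  their ratio is \<open>d\<close> for every \<open>\<theta>\<close>.\<close>

definition light_trial :: "nat \<Rightarrow> (real \<times> real) subroutine" where
  "light_trial \<theta> = (\<lambda>\<kappa>. ask_vertex (\<lambda>u. ask_degree u (\<lambda>k. ask_prop
     (\<lambda>z. \<kappa> (real k * of_bool (k \<le> \<theta>), of_bool (snd z \<le> \<theta>))))))"

text \<open>The first coordinate evaluates on a random edge the weights that the second uses for
  sampled pairs. Both contain the same rounded weights, so rounding cancels in the ratio of the
  means.\<close>

definition heavy_trial :: "nat \<Rightarrow> nat \<Rightarrow> nat \<Rightarrow> nat \<Rightarrow> (real \<times> real) subroutine" where
  "heavy_trial n B \<theta> s = (\<lambda>\<kappa>. ask_edge (\<lambda>e. ask_degree (Min e) (\<lambda>k. ask_degree (Max e) (\<lambda>l.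
     repeat_sub s ask_prop (\<lambda>xs. repeat_sub s ask_prop (\<lambda>ys.
       ask_additive (digit_terms B (fst ` set xs) (fst ` set ys)
           (weight_at (heavy_weight n \<theta>) xs) (weight_at (heavy_weight n \<theta>) ys))
         (\<lambda>r. \<kappa> (real (k * heavy_weight n \<theta> k) * real (l * heavy_weight n \<theta> l) / real n,
            r / (real s)\<^sup>2))))))))"

definition estimator :: "real \<Rightarrow> real \<Rightarrow> nat \<Rightarrow> (real \<times> real) subroutine \<Rightarrow> real option subroutine" where
  "estimator \<tau> \<tau>' N P = (\<lambda>\<kappa>. repeat_sub N P (\<lambda>xys. \<kappa> (ratio_estimate \<tau> \<tau>' xys)))"

abbreviation "uses_allowed \<equiv> only_asks advanced_edge_queries"

lemma uses_allowed_basic: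
  "uses_allowed ask_vertex" "uses_allowed ask_edge" "uses_allowed (ask_degree x)"
  "uses_allowed ask_prop" "uses_allowed (ask_additive cUs)"
proof -
  show 1: "uses_allowed ask_vertex" "uses_allowed ask_edge" "uses_allowed (ask_degree x)" for x
    by (auto simp: only_asks_def ask_vertex_def ask_edge_def ask_degree_def
        advanced_edge_queries_def advanced_queries_def)
  show "uses_allowed ask_prop"
    using 1(2,3) unfolding ask_prop_def by (auto simp: only_asks_def)
  show "uses_allowed (ask_additive cUs)"
    by (induction cUs) (auto simp: only_asks_def advanced_edge_queries_def advanced_queries_def)
qed

lemma uses_allowed_estimator:
  "uses_allowed (estimator \<tau> \<tau>' N inverse_degree_trial)"
  "uses_allowed (estimator \<tau> \<tau>' N (light_trial \<theta>))"
  "uses_allowed (estimator \<tau> \<tau>' N (heavy_trial n B \<theta> s))"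
proof -
  note b = uses_allowed_basic
  note r = only_asks_repeat[OF b(4)]
  have 1: "uses_allowed inverse_degree_trial"
    using b(4) by (auto simp: inverse_degree_trial_def only_asks_def)
  have 2: "uses_allowed (light_trial \<theta>)"
    using b(1,3,4) by (auto simp: light_trial_def only_asks_def)
  have 3: "uses_allowed (heavy_trial n B \<theta> s)"
    using b(2,3,5) r by (auto simp: heavy_trial_def only_asks_def)
  show "uses_allowed (estimator \<tau> \<tau>' N inverse_degree_trial)"
    "uses_allowed (estimator \<tau> \<tau>' N (light_trial \<theta>))"
    "uses_allowed (estimator \<tau> \<tau>' N (heavy_trial n B \<theta> s))"
    using only_asks_repeat[OF 1] only_asks_repeat[OF 2] only_asks_repeat[OF 3]
    by (auto simp: estimator_def only_asks_def)
qed

context graph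
begin

lemma computes_basic:
  "computes V E ask_vertex (pmf_of_set V) 1"
  "computes V E ask_edge (pmf_of_set E) 1"
  "x \<in> V \<Longrightarrow> computes V E (ask_degree x) (return_pmf (deg E x)) 1"
proof -
  show "computes V E ask_vertex (pmf_of_set V) 1"
    using computes_Query[of RandVert V E "\<lambda>a. case a of Vertex v \<Rightarrow> v | _ \<Rightarrow> 0"]
    by (simp add: ask_vertex_def map_pmf_comp pmf.map_ident)
  show "computes V E ask_edge (pmf_of_set E) 1"
    using computes_Query[of RandEdge V E "\<lambda>a. case a of Edge e \<Rightarrow> e | _ \<Rightarrow> {}"]
    by (simp add: ask_edge_def map_pmf_comp pmf.map_ident)
  show "x \<in> V \<Longrightarrow> computes V E (ask_degree x) (return_pmf (deg E x)) 1"
    using computes_Query[of "Degree x" V E "\<lambda>a. case a of Number k \<Rightarrow> k | _ \<Rightarrow> 0"]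
    by (simp add: ask_degree_def)
qed

definition prop_pair :: "(nat \<times> nat) pmf" where
  "prop_pair = map_pmf (\<lambda>v. (v, deg E v)) prop_vertex"

lemma finite_prop_pair: "finite (set_pmf prop_pair)"
  by (simp add: prop_pair_def finite_prop_vertex)

lemma computes_ask_prop: "computes V E ask_prop prop_pair 2"
proof -
  have "computes V E (\<lambda>\<kappa>. ask_edge (\<lambda>e. Coin (pmf_of_set e) (\<lambda>v. ask_degree v (\<lambda>k. \<kappa> (v, k)))))
     (bind_pmf (pmf_of_set E) (\<lambda>e. bind_pmf (pmf_of_set e) (\<lambda>v. return_pmf (v, deg E v)))) (1 + (0 + 1))"
  proof (rule computes_bind[OF computes_basic(2) computes_bind[OF computes_Coin]])
    fix e v assume "e \<in> set_pmf (pmf_of_set E)" "v \<in> set_pmf (pmf_of_set e)"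
    then have "v \<in> V" using set_prop_vertex by (auto simp: prop_vertex_def)
    then show "computes V E (\<lambda>\<kappa>. ask_degree v (\<lambda>k. \<kappa> (v, k))) (return_pmf (v, deg E v)) 1"
      using computes_map[OF computes_basic(3), of v "\<lambda>k. (v, k)"] by simp
  qed
  moreover have "bind_pmf (pmf_of_set E) (\<lambda>e. bind_pmf (pmf_of_set e) (\<lambda>v. return_pmf (v, deg E v))) = prop_pair"
    by (simp add: prop_pair_def prop_vertex_def map_pmf_def bind_assoc_pmf)
  ultimately show ?thesis by (simp add: ask_prop_def numeral_2_eq_2)
qed

lemma computes_ask_additive:
  "(\<And>c U. (c, U) \<in> set cUs \<Longrightarrow> U \<subseteq> V \<and> card U \<le> L) \<Longrightarrow>
    computes V E (ask_additive cUs) (return_pmf (\<Sum>(c, U)\<leftarrow>cUs. c * esub U)) (length cUs * L)"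
proof (induction cUs)
  case Nil
  then show ?case using computes_return[of V E "0 :: real"] by simp
next
  case (Cons cU cUs)
  obtain c U where cU: "cU = (c, U)" by (cases cU)
  have "computes V E (\<lambda>\<kappa>. Query (Additive U) (\<lambda>a. \<kappa> (case a of Number k \<Rightarrow> real k | _ \<Rightarrow> 0)))
     (return_pmf (esub U)) L"
    using computes_mono[OF computes_Query[of "Additive U" V E "\<lambda>a. case a of Number k \<Rightarrow> real k | _ \<Rightarrow> 0"], of L]
      Cons.prems[of c U] by (simp add: cU esub_def)
  then have "computes V E (\<lambda>\<kappa>. Query (Additive U) (\<lambda>a. ask_additive cUs
       (\<lambda>r. \<kappa> (c * (case a of Number k \<Rightarrow> real k | _ \<Rightarrow> 0) + r))))
     (return_pmf (c * esub U + (\<Sum>(c, U)\<leftarrow>cUs. c * esub U))) (L + length cUs * L)"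
  proof (rule computes_seq)
    have "computes V E (ask_additive cUs) (return_pmf (\<Sum>(c, U)\<leftarrow>cUs. c * esub U)) (length cUs * L)"
      by (rule Cons.IH) (use Cons.prems in auto)
    from computes_map[OF this, of "\<lambda>r. c * esub U + r"]
    show "computes V E (\<lambda>\<kappa>. ask_additive cUs (\<lambda>r. \<kappa> (c * esub U + r)))
     (return_pmf (c * esub U + (\<Sum>(c, U)\<leftarrow>cUs. c * esub U))) (length cUs * L)" by simp
  qed
  then show ?case by (simp add: cU)
qed

lemma expect_prop_vertex: "expect prop_vertex f = (\<Sum>x\<in>V. real (deg E x) * f x) / (2 * m)"
proof -
  have "expect prop_vertex f = expect (pmf_of_set E) (\<lambda>e. expect (pmf_of_set e) f)"
    unfolding prop_vertex_def
    by (rule expect_bind) (use finE E_ne edge_fin_ne in auto)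
  also have "\<dots> = avg E (\<lambda>e. (\<Sum>x\<in>e. f x) / 2)"
    unfolding expectation_pmf_of_set[OF finE E_ne]
    using edge_fin_ne edge(2) by (intro avg_cong) (simp add: expectation_pmf_of_set avg_def)
  also have "\<dots> = (\<Sum>x\<in>V. real (deg E x) * f x) / (2 * m)"
    by (simp add: avg_def m_def sum_divide_distrib[symmetric] sum_endpoints)
  finally show ?thesis .
qed

lemma expect_prop_pair:
  "expect prop_pair (\<lambda>z. f (fst z) (snd z)) = (\<Sum>x\<in>V. real (deg E x) * f x (deg E x)) / (2 * m)"
  by (simp add: prop_pair_def expect_prop_vertex)

text \<open>The flag \<open>acc\<close> is the condition under which acceptance is likely. Never
  accepting a wrong value is demanded in any case, so one notion serves both roles in
  \<open>hit_first_accepted\<close>.\<close>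

definition estimates :: "real option subroutine \<Rightarrow> nat \<Rightarrow> real \<Rightarrow> real \<Rightarrow> bool \<Rightarrow> bool" where
  "estimates P C \<eta> \<epsilon> acc \<longleftrightarrow> (\<exists>p. computes V E P p C \<and>
     1 - \<eta> \<le> measure_pmf.prob p {r. \<forall>x. r = Some x \<longrightarrow> x \<in> eps_approx \<epsilon> d} \<and>
     (acc \<longrightarrow> 1 - \<eta> \<le> measure_pmf.prob p (Some ` eps_approx \<epsilon> d)))"

lemma estimates_ratio:
  fixes p :: "(real \<times> real) pmf"
  assumes P: "computes V E P p C" and fin: "finite (set_pmf p)"
    and pos: "0 < \<tau>" "0 < \<tau>'" "0 < \<epsilon>" "\<epsilon> < 1" "0 < \<eta>"
    and nonneg: "0 \<le> a" "0 \<le> b" "0 \<le> a'" "0 \<le> b'"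
    and ratio: "expect p fst = d * expect p snd" "0 \<le> expect p snd"
    and m: "expect p (\<lambda>z. (fst z)\<^sup>2) \<le> a * expect p fst + b * (expect p fst)\<^sup>2"
    and m': "expect p fst \<ge> \<tau> / 4 \<Longrightarrow>
      expect p (\<lambda>z. (snd z)\<^sup>2) \<le> a' * expect p snd + b' * (expect p snd)\<^sup>2"
    and K: "4 * a / \<tau> + b \<le> K" "4 * a' / \<tau>' + b' \<le> K" "0 < K" and N: "real N \<ge> 32 * K / (\<eta> * \<epsilon>\<^sup>2)"
    and acc: "acc \<Longrightarrow> expect p fst \<ge> \<tau> \<and> expect p snd \<ge> \<tau>'"
  shows "estimates (estimator \<tau> \<tau>' N P) (N * C) \<eta> \<epsilon> acc"
proof -
  let ?R = "replicate_pmf N p"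
  have c: "computes V E (estimator \<tau> \<tau>' N P) (map_pmf (ratio_estimate \<tau> \<tau>') ?R) (N * C)"
    unfolding estimator_def by (intro computes_map computes_repeat P)
  have d0: "0 < d" using d_bounds by simp
  let ?G = "{xys. (\<forall>x. ratio_estimate \<tau> \<tau>' xys = Some x \<longrightarrow> x \<in> eps_approx \<epsilon> d) \<and>
        (expect p fst \<ge> \<tau> \<and> expect p snd \<ge> \<tau>' \<longrightarrow> ratio_estimate \<tau> \<tau>' xys \<noteq> None)}"
  have G: "1 - \<eta> \<le> measure_pmf.prob ?R ?G"
    by (rule ratio_estimate_correct[OF fin pos(1-4) d0 pos(5) nonneg ratio m m' K N])
  have "measure_pmf.prob ?R ?G \<le> measure_pmf.prob ?R
      (ratio_estimate \<tau> \<tau>' -` {r. \<forall>x. r = Some x \<longrightarrow> x \<in> eps_approx \<epsilon> d})"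
    by (intro measure_pmf.finite_measure_mono) auto
  moreover have "measure_pmf.prob ?R ?G \<le> measure_pmf.prob ?R
      (ratio_estimate \<tau> \<tau>' -` (Some ` eps_approx \<epsilon> d))" if acc
    using acc[OF that] by (intro measure_pmf.finite_measure_mono) (auto intro!: image_eqI)
  ultimately show ?thesis unfolding estimates_def using c G
    by (intro exI[of _ "map_pmf (ratio_estimate \<tau> \<tau>') ?R"]) auto
qed

text \<open>Degrees are at least 1, so the square of \<open>1 / deg\<close> is at most
  \<open>1 / deg\<close> itself. With threshold \<open>1 / s\<close> for the denominator this yields
  the constant \<open>4 * s\<close>.\<close>

lemma inverse_degree_estimates:
  assumes "0 < \<epsilon>" "\<epsilon> < 1" "0 < \<eta>" "1 \<le> s" "real N \<ge> 32 * (4 * s) / (\<eta> * \<epsilon>\<^sup>2)"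
  shows "estimates (estimator 1 (1 / s) N inverse_degree_trial) (N * 2) \<eta> \<epsilon> (d \<le> s)"
proof -
  let ?p = "map_pmf (\<lambda>z. (1, 1 / real (snd z))) prop_pair"
  have c: "computes V E inverse_degree_trial ?p 2"
    unfolding inverse_degree_trial_def by (intro computes_map computes_ask_prop)
  have "(\<Sum>x\<in>V. real (deg E x) * (1 / real (deg E x))) = (\<Sum>x\<in>V. 1)"
    using deg_pos by (intro sum.cong) force+
  then have snd: "expect ?p snd = 1 / d"
    using expect_prop_pair[of "\<lambda>_ k. 1 / real k"] m_pos n_ge_2 by (simp add: d_eq cardV)
  have "(\<Sum>x\<in>V. real (deg E x) * (1 / real (deg E x))\<^sup>2) \<le> (\<Sum>x\<in>V. real (deg E x) * (1 / real (deg E x)))"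
  proof (intro sum_mono mult_left_mono)
    fix x assume "x \<in> V"
    then have "1 / real (deg E x) \<le> 1" using deg_pos[of x] by simp
    then show "(1 / real (deg E x))\<^sup>2 \<le> 1 / real (deg E x)"
      using mult_left_mono[of "1 / real (deg E x)" 1 "1 / real (deg E x)"] by (simp add: power2_eq_square)
  qed auto
  then have sq: "expect ?p (\<lambda>z. (snd z)\<^sup>2) \<le> expect ?p snd"
    using expect_prop_pair[of "\<lambda>_ k. (1 / real k)\<^sup>2"] expect_prop_pair[of "\<lambda>_ k. 1 / real k"] m_pos
    by (simp add: divide_right_mono)
  have d1: "1 \<le> d" by (rule d_bounds)
  show ?thesis
    by (rule estimates_ratio[OF c, where a = 1 and b = 0 and a' = 1 and b' = 0 and K = "4 * s"])
       (use assms sq snd d1 in \<open>auto simp: finite_prop_pair frac_le\<close>)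
qed

end

lemma heavy_weight_le: "k * heavy_weight n \<theta> k \<le> n"
  by (simp add: heavy_weight_def)

text \<open>Rounding down loses at most half because the quotient is at least 1.\<close>

lemma heavy_weight_ge:
  assumes "\<theta> < 2 * k" "k \<le> n"
  shows "real n / 2 \<le> real (k * heavy_weight n \<theta> k)"
proof -
  have k0: "k > 0" using assms by simp
  have "n div k \<ge> 1" using assms k0 by (simp add: Suc_leI div_greater_zero_iff)
  then have 1: "k \<le> k * (n div k)" by simp
  have "n mod k < k" using k0 by simp
  moreover have "k * (n div k) + n mod k = n" by simp
  ultimately have "n \<le> 2 * (k * (n div k))" using 1 by linarith
  then have "real n \<le> 2 * real (k * (n div k))" by (metis of_nat_le_iff of_nat_mult of_nat_numeral)
  then show ?thesis using assms by (simp add: heavy_weight_def)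
qed

lemma heavy_weight_le_div:
  assumes "0 < \<theta>"
  shows "real (heavy_weight n \<theta> k) \<le> 2 * real n / real \<theta>"
proof (cases "\<theta> < 2 * k")
  case True
  have "real (n div k) \<le> real n / real k" by (rule of_nat_div_le_of_nat)
  also have "\<dots> \<le> real n / (real \<theta> / 2)" using True assms by (intro divide_left_mono) auto
  finally show ?thesis using True by (simp add: heavy_weight_def mult.commute)
qed (simp add: heavy_weight_def)

lemma weight_at_le: "(\<And>k. f k \<le> c) \<Longrightarrow> weight_at f zs x \<le> length zs * c"
proof (induction zs)
  case (Cons z zs)
  then have "f (snd z) \<le> c" "weight_at f zs x \<le> length zs * c" by auto
  then show ?case by (simp add: weight_at_def)
qed (simp add: weight_at_def)

lemma weight_at_support: "weight_at f zs x \<noteq> 0 \<Longrightarrow> x \<in> fst ` set zs"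
  by (induction zs) (auto simp: weight_at_def split: if_splits)

section \<open>The light trial: degrees truncated at a threshold\<close>

context graph
begin

definition low_mass :: "nat \<Rightarrow> real" where
  "low_mass \<theta> = (\<Sum>x\<in>V. real (deg E x) * of_bool (deg E x \<le> \<theta>))"

text \<open>Truncation bounds the second moment by \<open>\<theta>\<close> times the mean, which
  costs \<open>4 * s\<close> at threshold \<open>\<theta> / s\<close>; the indicator costs 16 at
  threshold 1/4. Both are covered by \<open>16 * s\<close>.\<close>

lemma light_estimates:
  assumes "0 < \<epsilon>" "\<epsilon> < 1" "0 < \<eta>" "1 \<le> s" "0 < \<theta>" "real N \<ge> 32 * (16 * s) / (\<eta> * \<epsilon>\<^sup>2)"
  shows "estimates (estimator (real \<theta> / s) (1 / 4) N (light_trial \<theta>)) (N * 4) \<eta> \<epsilon>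
    (real \<theta> / s \<le> low_mass \<theta> / real n \<and> 1 / 4 \<le> low_mass \<theta> / (2 * m))"
proof -
  let ?f = "\<lambda>u. real (deg E u) * of_bool (deg E u \<le> \<theta>)"
  let ?p = "bind_pmf (pmf_of_set V) (\<lambda>u. map_pmf (\<lambda>z. (?f u, of_bool (snd z \<le> \<theta>) :: real)) prop_pair)"
  have c: "computes V E (light_trial \<theta>) ?p 4"
  proof -
    have "computes V E (light_trial \<theta>) ?p (1 + (1 + 2))"
      unfolding light_trial_def
    proof (rule computes_bind[OF computes_basic(1)])
      fix u assume "u \<in> set_pmf (pmf_of_set V)"
      then have u: "u \<in> V" using finV V_ne by simp
      show "computes V E (\<lambda>\<kappa>. ask_degree u (\<lambda>k. ask_prop
          (\<lambda>z. \<kappa> (real k * of_bool (k \<le> \<theta>), of_bool (snd z \<le> \<theta>)))))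
        (map_pmf (\<lambda>z. (?f u, of_bool (snd z \<le> \<theta>))) prop_pair) (1 + 2)"
        by (rule computes_seq[OF computes_basic(3)[OF u]]) (rule computes_map[OF computes_ask_prop])
    qed
    then show ?thesis by (rule computes_mono) simp
  qed
  have fin: "finite (set_pmf ?p)" using finV V_ne finite_prop_pair by simp
  have E: "expect ?p g = (\<Sum>u\<in>V. expect prop_pair (\<lambda>z. g (?f u, of_bool (snd z \<le> \<theta>)))) / real n" for g
    by (subst expect_bind)
       (use finV V_ne finite_prop_pair in \<open>simp_all add: expectation_pmf_of_set avg_def cardV\<close>)
  have n0: "real n > 0" using n_ge_2 by simp
  have fst: "expect ?p fst = low_mass \<theta> / real n" by (simp add: E low_mass_def)
  have P: "expect prop_pair (\<lambda>z. of_bool (snd z \<le> \<theta>)) = low_mass \<theta> / (2 * m)"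
    using expect_prop_pair[of "\<lambda>_ k. of_bool (k \<le> \<theta>)"] by (simp add: low_mass_def)
  have snd: "expect ?p snd = low_mass \<theta> / (2 * m)"
    using n0 by (simp add: E P cardV)
  have snd2: "expect ?p (\<lambda>z. (snd z)\<^sup>2) = low_mass \<theta> / (2 * m)"
  proof -
    have "(of_bool b)\<^sup>2 = (of_bool b :: real)" for b by simp
    then show ?thesis using n0 P by (simp add: E cardV)
  qed
  have "(\<Sum>u\<in>V. (?f u)\<^sup>2) \<le> (\<Sum>u\<in>V. real \<theta> * ?f u)"
    by (intro sum_mono) (auto simp: power2_eq_square intro!: mult_right_mono)
  then have fst2: "expect ?p (\<lambda>z. (fst z)\<^sup>2) \<le> real \<theta> * expect ?p fst"
    unfolding fst unfolding E low_mass_def using n0 by (simp add: sum_distrib_left[symmetric] divide_right_mono)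
  have lm: "low_mass \<theta> \<ge> 0" by (simp add: low_mass_def sum_nonneg)
  show ?thesis
  proof (rule estimates_ratio[OF c fin, where a = "real \<theta>" and b = 0 and a' = 1 and b' = 0 and K = "16 * s"])
    show "expect ?p fst = d * expect ?p snd" unfolding fst snd using m_pos n0 by (simp add: d_eq)
    show "0 \<le> expect ?p snd" unfolding snd using lm m_pos by simp
    show "expect ?p (\<lambda>z. (fst z)\<^sup>2) \<le> real \<theta> * expect ?p fst + 0 * (expect ?p fst)\<^sup>2" using fst2 by simp
    show "expect ?p (\<lambda>z. (snd z)\<^sup>2) \<le> 1 * expect ?p snd + 0 * (expect ?p snd)\<^sup>2" unfolding snd snd2 by simp
    show "real \<theta> / s \<le> expect ?p fst \<and> 1 / 4 \<le> expect ?p snd"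
      if "real \<theta> / s \<le> low_mass \<theta> / real n \<and> 1 / 4 \<le> low_mass \<theta> / (2 * m)"
      using that unfolding fst snd .
  qed (use assms in auto)
qed

lemma weight_at_sum:
  assumes "fst ` set zs \<subseteq> V"
  shows "(\<Sum>x\<in>V. real (weight_at f zs x) * g x) = (\<Sum>z\<leftarrow>zs. real (f (snd z)) * g (fst z))"
  using assms
proof (induction zs)
  case (Cons z zs)
  have "real (weight_at f (z # zs) x) * g x
      = (if fst z = x then real (f (snd z)) * g (fst z) else 0) + real (weight_at f zs x) * g x" for x
    by (simp add: weight_at_def algebra_simps)
  then show ?case using Cons finV by (simp add: sum.distrib)
qed (simp add: weight_at_def)

lemma bil_weight_at:
  assumes "fst ` set xs \<subseteq> V" "fst ` set ys \<subseteq> V"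
  shows "bil (\<lambda>x. real (weight_at f xs x)) (\<lambda>x. real (weight_at f ys x))
    = (\<Sum>y\<leftarrow>ys. \<Sum>x\<leftarrow>xs. real (f (snd x)) * real (f (snd y)) * adj (fst x) (fst y))"
proof -
  have "bil (\<lambda>x. real (weight_at f xs x)) (\<lambda>x. real (weight_at f ys x))
    = (\<Sum>x\<in>V. real (weight_at f xs x) * (\<Sum>y\<in>V. real (weight_at f ys y) * adj x y))"
    unfolding bil_def by (simp add: sum_distrib_left mult.assoc)
  also have "\<dots> = (\<Sum>x\<leftarrow>xs. real (f (snd x)) * (\<Sum>y\<in>V. real (weight_at f ys y) * adj (fst x) y))"
    by (rule weight_at_sum[OF assms(1)])
  also have "\<dots> = (\<Sum>x\<leftarrow>xs. real (f (snd x)) * (\<Sum>y\<leftarrow>ys. real (f (snd y)) * adj (fst x) (fst y)))"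
    by (simp add: weight_at_sum[OF assms(2)])
  also have "\<dots> = (\<Sum>x\<leftarrow>xs. \<Sum>y\<leftarrow>ys. real (f (snd x)) * real (f (snd y)) * adj (fst x) (fst y))"
    by (simp add: sum_list_const_mult mult.assoc)
  also have "\<dots> = (\<Sum>y\<leftarrow>ys. \<Sum>x\<leftarrow>xs. real (f (snd x)) * real (f (snd y)) * adj (fst x) (fst y))"
  proof (induction xs)
    case (Cons x xs)
    then show ?case by (simp add: sum_list_addf)
  qed simp
  finally show ?thesis .
qed

section \<open>The heavy trial: weighted adjacency of sampled pairs\<close>

definition \<omega> :: "nat \<Rightarrow> nat \<Rightarrow> real" where "\<omega> \<theta> x = real (heavy_weight n \<theta> (deg E x))"
text \<open>Degree-proportional sampling multiplies the weight by the degree. The product lies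
  between \<open>n / 2\<close> and \<open>n\<close> on vertices of degree above
  \<open>\<theta> / 2\<close> and vanishes elsewhere.\<close>

definition \<phi> :: "nat \<Rightarrow> nat \<Rightarrow> real" where "\<phi> \<theta> x = real (deg E x) * \<omega> \<theta> x"

definition heavy_mean :: "nat \<Rightarrow> real" where "heavy_mean \<theta> = avg E (\<lambda>e. \<Prod>x\<in>e. \<phi> \<theta> x)"

lemma \<phi>_bounds: "0 \<le> \<phi> \<theta> x" "\<phi> \<theta> x \<le> real n"
  using heavy_weight_le[of "deg E x" n \<theta>] unfolding \<phi>_def \<omega>_def
  by (simp_all flip: of_nat_mult)

lemma bil_\<phi>: "bil (\<phi> \<theta>) (\<phi> \<theta>) = 2 * m * heavy_mean \<theta>"
  using m_pos by (simp add: bil_edges heavy_mean_def avg_def m_def)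

lemma heavy_mean_nonneg: "0 \<le> heavy_mean \<theta>"
  unfolding heavy_mean_def by (intro avg_nonneg prod_nonneg ballI \<phi>_bounds)

lemma edge_prod_le: "e \<in> E \<Longrightarrow> (\<Prod>x\<in>e. \<phi> \<theta> x) \<le> (real n)\<^sup>2"
proof -
  assume e: "e \<in> E"
  have "(\<Prod>x\<in>e. \<phi> \<theta> x) \<le> (\<Prod>x\<in>e. real n)" by (intro prod_mono) (simp add: \<phi>_bounds)
  then show ?thesis using edge(2)[OF e] by simp
qed

definition pair_weight :: "nat \<Rightarrow> nat \<times> nat \<Rightarrow> nat \<times> nat \<Rightarrow> real" where
  "pair_weight \<theta> z z' = real (heavy_weight n \<theta> (snd z)) * real (heavy_weight n \<theta> (snd z')) * adj (fst z) (fst z')"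

lemma expect_pairs:
  "expect prop_pair (\<lambda>z. expect prop_pair (\<lambda>z'. g z z'))
   = (\<Sum>x\<in>V. \<Sum>y\<in>V. real (deg E x) * real (deg E y) * g (x, deg E x) (y, deg E y)) / (4 * m\<^sup>2)"
proof -
  have "expect prop_pair (\<lambda>z'. g z z') = (\<Sum>y\<in>V. real (deg E y) * g z (y, deg E y)) / (2 * m)" for z
    using expect_prop_pair[of "\<lambda>a b. g z (a, b)"] by simp
  then have "expect prop_pair (\<lambda>z. expect prop_pair (\<lambda>z'. g z z'))
     = (\<Sum>x\<in>V. real (deg E x) * ((\<Sum>y\<in>V. real (deg E y) * g (x, deg E x) (y, deg E y)) / (2 * m))) / (2 * m)"
    using expect_prop_pair[of "\<lambda>a b. (\<Sum>y\<in>V. real (deg E y) * g (a, b) (y, deg E y)) / (2 * m)"] by simp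
  then show ?thesis by (simp add: sum_divide_distrib[symmetric] sum_distrib_left mult.assoc power2_eq_square)
qed

lemma pair_weight_mean:
  "expect prop_pair (\<lambda>z. expect prop_pair (pair_weight \<theta> z)) = heavy_mean \<theta> / (2 * m)"
proof -
  have "expect prop_pair (\<lambda>z. expect prop_pair (pair_weight \<theta> z)) = bil (\<phi> \<theta>) (\<phi> \<theta>) / (4 * m\<^sup>2)"
    unfolding expect_pairs by (simp add: bil_def \<phi>_def \<omega>_def pair_weight_def mult_ac)
  then show ?thesis using m_pos by (simp add: bil_\<phi> power2_eq_square)
qed

text \<open>The weights are at most \<open>2 * n / \<theta>\<close> each, so one factor of the
  square can be replaced by a constant.\<close>

lemma pair_weight_sq:
  assumes "0 < \<theta>"
  shows "expect prop_pair (\<lambda>z. expect prop_pair (\<lambda>z'. (pair_weight \<theta> z z')\<^sup>2))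
    \<le> (2 * real n / real \<theta>)\<^sup>2 * (heavy_mean \<theta> / (2 * m))"
proof -
  let ?c = "(2 * real n / real \<theta>)\<^sup>2"
  have b: "(pair_weight \<theta> z z')\<^sup>2 \<le> ?c * pair_weight \<theta> z z'" for z z'
  proof -
    have "pair_weight \<theta> z z' \<le> (2 * real n / real \<theta>) * (2 * real n / real \<theta>) * 1"
      unfolding pair_weight_def using heavy_weight_le_div[OF assms]
      by (intro mult_mono) (auto simp: adj_def)
    moreover have "0 \<le> pair_weight \<theta> z z'" by (simp add: pair_weight_def adj_def)
    ultimately have "pair_weight \<theta> z z' * pair_weight \<theta> z z'
      \<le> (2 * real n / real \<theta>) * (2 * real n / real \<theta>) * 1 * pair_weight \<theta> z z'"
      by (rule mult_right_mono)
    then show ?thesis by (simp add: power2_eq_square)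
  qed
  have "expect prop_pair (\<lambda>z. expect prop_pair (\<lambda>z'. (pair_weight \<theta> z z')\<^sup>2))
     \<le> expect prop_pair (\<lambda>z. expect prop_pair (\<lambda>z'. ?c * pair_weight \<theta> z z'))"
    by (intro expect_mono finite_prop_pair b)
  also have "\<dots> = ?c * (heavy_mean \<theta> / (2 * m))"
    by (simp add: pair_weight_mean)
  finally show ?thesis .
qed

text \<open>Averaging out one sample leaves \<open>\<omega> \<theta> x * g x / (2 * m)\<close>. As
  \<open>g x\<close> is at most \<open>n\<close> times the degree, it cancels the reciprocal degree
  in the weight, and the marginal is at most \<open>n\<^sup>2 / (2 * m)\<close> whatever the
  threshold. One factor of the square is bounded in this way, the other keeps the mean.\<close>

lemma pair_weight_marginal:
  "expect prop_pair (\<lambda>z. (expect prop_pair (pair_weight \<theta> z))\<^sup>2)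
    \<le> (real n)\<^sup>2 * (heavy_mean \<theta> / (2 * m)) / (2 * m)"
proof -
  define g where "g x = (\<Sum>y\<in>V. \<phi> \<theta> y * adj x y)" for x
  have marg: "expect prop_pair (pair_weight \<theta> z) = real (heavy_weight n \<theta> (snd z)) * g (fst z) / (2 * m)" for z
  proof -
    have "expect prop_pair (pair_weight \<theta> z)
      = (\<Sum>x\<in>V. real (deg E x) * pair_weight \<theta> z (x, deg E x)) / (2 * m)"
      using expect_prop_pair[of "\<lambda>a b. pair_weight \<theta> z (a, b)"] by simp
    then show ?thesis
      by (simp add: pair_weight_def g_def \<phi>_def \<omega>_def sum_distrib_left mult_ac)
  qed
  have g: "0 \<le> g x" "g x \<le> real n * real (deg E x)" for x
  proof -
    show "0 \<le> g x" unfolding g_def by (intro sum_nonneg mult_nonneg_nonneg \<phi>_bounds) (simp add: adj_def)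
    have "g x = (\<Sum>y\<in>nbrs E x. \<phi> \<theta> y)"
      unfolding g_def using nbrs_sub[of x] finV
      by (intro sum.mono_neutral_cong_right) (auto simp: adj_def nbrs_def)
    also have "\<dots> \<le> (\<Sum>y\<in>nbrs E x. real n)" by (intro sum_mono \<phi>_bounds)
    finally show "g x \<le> real n * real (deg E x)" by (simp add: deg_def mult.commute)
  qed
  have "expect prop_pair (\<lambda>z. (expect prop_pair (pair_weight \<theta> z))\<^sup>2)
    = (\<Sum>x\<in>V. real (deg E x) * (\<omega> \<theta> x * g x / (2 * m))\<^sup>2) / (2 * m)"
    unfolding marg using expect_prop_pair[of "\<lambda>a b. (real (heavy_weight n \<theta> b) * g a / (2 * m))\<^sup>2"]
    by (simp add: \<omega>_def)
  also have "\<dots> \<le> (\<Sum>x\<in>V. (real n)\<^sup>2 * (\<phi> \<theta> x * g x) / (4 * m\<^sup>2)) / (2 * m)"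
  proof (intro divide_right_mono sum_mono)
    fix x
    have "\<omega> \<theta> x * g x \<le> \<omega> \<theta> x * (real n * real (deg E x))"
      using g by (intro mult_left_mono) (auto simp: \<omega>_def)
    also have "\<dots> = real n * \<phi> \<theta> x" by (simp add: \<phi>_def)
    also have "\<dots> \<le> real n * real n" by (intro mult_left_mono \<phi>_bounds) auto
    finally have "(\<omega> \<theta> x * g x) * (\<phi> \<theta> x * g x) \<le> (real n * real n) * (\<phi> \<theta> x * g x)"
      using g \<phi>_bounds by (intro mult_right_mono) auto
    then have "(\<omega> \<theta> x * g x) * (\<phi> \<theta> x * g x) / (4 * m\<^sup>2) \<le> (real n)\<^sup>2 * (\<phi> \<theta> x * g x) / (4 * m\<^sup>2)"
      by (intro divide_right_mono) (simp_all add: power2_eq_square)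
    moreover have "real (deg E x) * (\<omega> \<theta> x * g x / (2 * m))\<^sup>2 = (\<omega> \<theta> x * g x) * (\<phi> \<theta> x * g x) / (4 * m\<^sup>2)"
      by (simp add: \<phi>_def power2_eq_square)
    ultimately show "real (deg E x) * (\<omega> \<theta> x * g x / (2 * m))\<^sup>2 \<le> (real n)\<^sup>2 * (\<phi> \<theta> x * g x) / (4 * m\<^sup>2)"
      by (simp only:)
  qed (use m_pos in auto)
  also have "(\<Sum>x\<in>V. (real n)\<^sup>2 * (\<phi> \<theta> x * g x) / (4 * m\<^sup>2)) = (real n)\<^sup>2 * bil (\<phi> \<theta>) (\<phi> \<theta>) / (4 * m\<^sup>2)"
    by (simp add: bil_def g_def sum_distrib_left sum_divide_distrib mult_ac)
  also have "\<dots> = (real n)\<^sup>2 * (heavy_mean \<theta> / (2 * m))"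
    using m_pos by (simp add: bil_\<phi> power2_eq_square)
  finally show ?thesis .
qed

lemma pair_weight_sym: "pair_weight \<theta> z z' = pair_weight \<theta> z' z"
  by (simp add: pair_weight_def adj_sym)

lemma two_set_Min_Max:
  fixes e :: "nat set"
  assumes "card e = 2"
  shows "e = {Min e, Max e}" "Min e \<noteq> Max e"
proof -
  obtain a b where e: "e = {a, b}" "a \<noteq> b" using assms by (auto simp: card_2_iff)
  then show "e = {Min e, Max e}" "Min e \<noteq> Max e" by (auto simp: min_def max_def)
qed

text \<open>The assumption makes the accumulated weights fit into \<open>B\<close> digits. The cost
  is that of an edge and two degrees, two lists of \<open>s\<close> samples at cost 2 each, and
  \<open>5 * B * B\<close> \<open>Additive\<close> queries on at most \<open>2 * s\<close>
  vertices.\<close>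

lemma computes_heavy_trial:
  assumes "s * n < 2 ^ B"
  shows "computes V E (heavy_trial n B \<theta> s)
    (bind_pmf (pmf_of_set E) (\<lambda>e. bind_pmf (replicate_pmf s prop_pair) (\<lambda>xs.
       map_pmf (\<lambda>ys. ((\<Prod>x\<in>e. \<phi> \<theta> x) / real n, (\<Sum>y\<leftarrow>ys. \<Sum>x\<leftarrow>xs. pair_weight \<theta> x y) / (real s)\<^sup>2))
         (replicate_pmf s prop_pair))))
    (1 + (1 + (1 + (s * 2 + (s * 2 + 5 * B * B * (2 * s))))))"
  unfolding heavy_trial_def
proof (rule computes_bind[OF computes_basic(2)])
  fix e assume "e \<in> set_pmf (pmf_of_set E)"
  then have e: "e \<in> E" using finE E_ne by simp
  note M = two_set_Min_Max[OF edge(2)[OF e]]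
  have MV: "Min e \<in> V" "Max e \<in> V" using edge(1)[OF e] M(1) by blast+
  let ?k = "deg E (Min e)" and ?l = "deg E (Max e)" and ?w = "heavy_weight n \<theta>"
  have prod: "real (?k * ?w ?k) * real (?l * ?w ?l) = (\<Prod>x\<in>e. \<phi> \<theta> x)"
    by (subst (3) M(1)) (use M(2) in \<open>simp add: \<phi>_def \<omega>_def\<close>)
  let ?P = "\<lambda>k l \<kappa>. repeat_sub s ask_prop (\<lambda>xs. repeat_sub s ask_prop (\<lambda>ys.
       ask_additive (digit_terms B (fst ` set xs) (fst ` set ys) (weight_at ?w xs) (weight_at ?w ys))
         (\<lambda>r. \<kappa> (real (k * ?w k) * real (l * ?w l) / real n, r / (real s)\<^sup>2))))"
  let ?Q = "\<lambda>xs ys. (\<Sum>y\<leftarrow>ys. \<Sum>x\<leftarrow>xs. pair_weight \<theta> x y)"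
  have main: "computes V E (?P ?k ?l)
    (bind_pmf (replicate_pmf s prop_pair) (\<lambda>xs. bind_pmf (replicate_pmf s prop_pair)
       (\<lambda>ys. return_pmf ((\<Prod>x\<in>e. \<phi> \<theta> x) / real n, ?Q xs ys / (real s)\<^sup>2))))
    (s * 2 + (s * 2 + 5 * B * B * (2 * s)))"
  proof (rule computes_bind[OF computes_repeat[OF computes_ask_prop] computes_bind[OF computes_repeat[OF computes_ask_prop]]])
    fix xs ys assume "xs \<in> set_pmf (replicate_pmf s prop_pair)" "ys \<in> set_pmf (replicate_pmf s prop_pair)"
    then have len: "length xs = s" "length ys = s" and sub: "fst ` set xs \<subseteq> V" "fst ` set ys \<subseteq> V"
      using set_prop_vertex by (auto simp: set_replicate_pmf prop_pair_def)
    let ?T = "digit_terms B (fst ` set xs) (fst ` set ys) (weight_at ?w xs) (weight_at ?w ys)"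
    have "?w k \<le> n" for k by (simp add: heavy_weight_def)
    then have "weight_at ?w zs x \<le> length zs * n" for zs x by (rule weight_at_le)
    then have lt: "weight_at ?w xs x < 2 ^ B" "weight_at ?w ys x < 2 ^ B" for x
      using assms len by (metis le_less_trans)+
    have "(\<Sum>(c, U)\<leftarrow>?T. c * esub U) = bil (\<lambda>x. real (weight_at ?w xs x)) (\<lambda>x. real (weight_at ?w ys x))"
      using lt by (rule digit_terms) (use weight_at_support in blast)+
    also have "\<dots> = ?Q xs ys" unfolding bil_weight_at[OF sub] by (simp add: pair_weight_def)
    finally have val: "(\<Sum>(c, U)\<leftarrow>?T. c * esub U) = ?Q xs ys" .
    have "computes V E (ask_additive ?T) (return_pmf (\<Sum>(c, U)\<leftarrow>?T. c * esub U)) (length ?T * (2 * s))"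
    proof (rule computes_ask_additive)
      fix c U assume "(c, U) \<in> set ?T"
      then have U: "U \<subseteq> fst ` set xs \<union> fst ` set ys" by (rule digit_terms_sub)
      have "card U \<le> card (fst ` set xs \<union> fst ` set ys)" using U by (intro card_mono) auto
      also have "\<dots> \<le> card (fst ` set xs) + card (fst ` set ys)" by (rule card_Un_le)
      also have "card (fst ` set xs) \<le> s" using len card_image_le[of "set xs" fst] card_length[of xs] by simp
      also have "card (fst ` set ys) \<le> s" using len card_image_le[of "set ys" fst] card_length[of ys] by simp
      finally have "card U \<le> 2 * s" by simp
      moreover have "U \<subseteq> V" using U sub by (meson Un_least order_trans)
      ultimately show "U \<subseteq> V \<and> card U \<le> 2 * s" by blast
    qed
    from computes_map[OF this[unfolded val length_digit_terms], of "\<lambda>r. ((\<Prod>x\<in>e. \<phi> \<theta> x) / real n, r / (real s)\<^sup>2)"]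
    show "computes V E (\<lambda>\<kappa>. ask_additive ?T (\<lambda>r. \<kappa> (real (?k * ?w ?k) * real (?l * ?w ?l) / real n, r / (real s)\<^sup>2)))
       (return_pmf ((\<Prod>x\<in>e. \<phi> \<theta> x) / real n, ?Q xs ys / (real s)\<^sup>2)) (5 * B * B * (2 * s))"
      unfolding prod by simp
  qed
  have "computes V E (\<lambda>\<kappa>. ask_degree (Min e) (\<lambda>k. ask_degree (Max e) (\<lambda>l. ?P k l \<kappa>)))
    (bind_pmf (replicate_pmf s prop_pair) (\<lambda>xs. bind_pmf (replicate_pmf s prop_pair)
       (\<lambda>ys. return_pmf ((\<Prod>x\<in>e. \<phi> \<theta> x) / real n, ?Q xs ys / (real s)\<^sup>2))))
    (1 + (1 + (s * 2 + (s * 2 + 5 * B * B * (2 * s)))))"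
    by (intro computes_seq[OF computes_basic(3)[OF MV(1)]] computes_seq[OF computes_basic(3)[OF MV(2)]] main)
  then show "computes V E (\<lambda>\<kappa>. ask_degree (Min e) (\<lambda>k. ask_degree (Max e) (\<lambda>l. ?P k l \<kappa>)))
    (bind_pmf (replicate_pmf s prop_pair) (\<lambda>xs. map_pmf
       (\<lambda>ys. ((\<Prod>x\<in>e. \<phi> \<theta> x) / real n, ?Q xs ys / (real s)\<^sup>2)) (replicate_pmf s prop_pair)))
    (1 + (1 + (s * 2 + (s * 2 + 5 * B * B * (2 * s)))))"
    by (simp only: map_pmf_def)
qed

text \<open>The threshold of the denominator equals the linear coefficient of its second moment, so
  this part costs only 4 and the number of repetitions does not grow with \<open>s\<close>. The
  quadratic part 65 is 32 for each of the two marginals plus 1 for the squared mean.\<close>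

lemma heavy_estimates:
  assumes eps: "0 < \<epsilon>" "\<epsilon> < 1" "0 < \<eta>" and s: "1 \<le> s" "s * n < 2 ^ B" and \<theta>: "0 < \<theta>"
    and N: "real N \<ge> 32 * 69 / (\<eta> * \<epsilon>\<^sup>2)"
  shows "estimates (estimator (real n / 8) ((2 * real n / real \<theta>)\<^sup>2 / (real s)\<^sup>2) N (heavy_trial n B \<theta> s))
    (N * (1 + (1 + (1 + (s * 2 + (s * 2 + 5 * B * B * (2 * s))))))) \<eta> \<epsilon>
    (real n / 8 \<le> heavy_mean \<theta> / real n \<and> (2 * real n / real \<theta>)\<^sup>2 / (real s)\<^sup>2 \<le> heavy_mean \<theta> / (2 * m))"
proof -
  let ?R = "replicate_pmf s prop_pair"
  let ?f = "\<lambda>e. (\<Prod>x\<in>e. \<phi> \<theta> x) / real n"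
  let ?Q = "\<lambda>xs ys. (\<Sum>y\<leftarrow>ys. \<Sum>x\<leftarrow>xs. pair_weight \<theta> x y)"
  let ?p = "bind_pmf (pmf_of_set E) (\<lambda>e. bind_pmf ?R (\<lambda>xs. map_pmf (\<lambda>ys. (?f e, ?Q xs ys / (real s)\<^sup>2)) ?R))"
  define \<mu> where "\<mu> = heavy_mean \<theta> / (2 * m)"
  have n0: "real n > 0" using n_ge_2 by simp
  have s0: "real s > 0" using s by simp
  note fp = finite_prop_pair
  note fR = finite_set_replicate_pmf[OF fp, of s]
  note [simp] = integrable_measure_pmf_finite[OF fR]
  have fin: "finite (set_pmf ?p)" using finE E_ne fR by simp
  have E: "expect ?p g = avg E (\<lambda>e. expect ?R (\<lambda>xs. expect ?R (\<lambda>ys. g (?f e, ?Q xs ys / (real s)\<^sup>2))))" for g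
  proof -
    have "expect ?p g = expect (pmf_of_set E) (\<lambda>e. expect
        (bind_pmf ?R (\<lambda>xs. map_pmf (\<lambda>ys. (?f e, ?Q xs ys / (real s)\<^sup>2)) ?R)) g)"
      by (rule expect_bind) (use finE E_ne fR in auto)
    then show ?thesis using fR by (simp add: expect_bind expectation_pmf_of_set[OF finE E_ne])
  qed
  have fst: "expect ?p fst = heavy_mean \<theta> / real n"
    by (simp add: E heavy_mean_def avg_def sum_divide_distrib[symmetric])
  have snd: "expect ?p snd = \<mu>"
    using s0 finE E_ne
    by (simp add: E expect_two_samples[OF fp] pair_weight_mean \<mu>_def avg_const)
  have fst2: "expect ?p (\<lambda>z. (fst z)\<^sup>2) \<le> real n * expect ?p fst"
  proof -
    have "expect ?p (\<lambda>z. (fst z)\<^sup>2) = avg E (\<lambda>e. (?f e)\<^sup>2)" by (simp add: E)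
    also have "\<dots> \<le> avg E (\<lambda>e. (\<Prod>x\<in>e. \<phi> \<theta> x))"
    proof (rule avg_mono)
      fix e assume e: "e \<in> E"
      have "0 \<le> (\<Prod>x\<in>e. \<phi> \<theta> x)" by (intro prod_nonneg ballI \<phi>_bounds)
      then have "(\<Prod>x\<in>e. \<phi> \<theta> x) * (\<Prod>x\<in>e. \<phi> \<theta> x) \<le> (real n)\<^sup>2 * (\<Prod>x\<in>e. \<phi> \<theta> x)"
        by (intro mult_right_mono edge_prod_le e)
      then show "(?f e)\<^sup>2 \<le> (\<Prod>x\<in>e. \<phi> \<theta> x)" using n0 by (simp add: power_divide power2_eq_square divide_simps mult_ac)
    qed
    finally show ?thesis using n0 by (simp add: fst heavy_mean_def)
  qed
  have snd2: "expect ?p (\<lambda>z. (snd z)\<^sup>2)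
    \<le> (2 * real n / real \<theta>)\<^sup>2 / (real s)\<^sup>2 * expect ?p snd + 65 * (expect ?p snd)\<^sup>2"
    if F: "expect ?p fst \<ge> real n / 8 / 4"
  proof -
    have \<mu>0: "0 \<le> \<mu>" using heavy_mean_nonneg[of \<theta>] m_pos by (simp add: \<mu>_def)
    \<comment> \<open>A numerator of mean at least \<open>n / 32\<close> turns the
      \<open>n\<^sup>2\<close> in the marginal bound into a multiple of the mean.\<close>
    have "(real n)\<^sup>2 \<le> 32 * heavy_mean \<theta>" using F[unfolded fst] n0 by (simp add: power2_eq_square field_simps)
    then have "(real n)\<^sup>2 * (\<mu> / (2 * m)) \<le> 32 * heavy_mean \<theta> * (\<mu> / (2 * m))"
      using \<mu>0 m_pos by (intro mult_right_mono) auto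
    then have H: "(real n)\<^sup>2 * \<mu> / (2 * m) \<le> 32 * \<mu>\<^sup>2"
      by (simp add: \<mu>_def power2_eq_square)
    let ?X = "(real s)\<^sup>2 * ((2 * real n / real \<theta>)\<^sup>2 * \<mu>) + real s ^ 3 * (32 * \<mu>\<^sup>2) + real s ^ 3 * (32 * \<mu>\<^sup>2) + real s ^ 4 * \<mu>\<^sup>2"
    have marg: "expect prop_pair (\<lambda>y. (expect prop_pair (\<lambda>x. pair_weight \<theta> x y))\<^sup>2) \<le> 32 * \<mu>\<^sup>2"
      "expect prop_pair (\<lambda>x. (expect prop_pair (pair_weight \<theta> x))\<^sup>2) \<le> 32 * \<mu>\<^sup>2"
      using pair_weight_marginal[of \<theta>] H by (simp_all add: pair_weight_sym[of \<theta> _ y for y] \<mu>_def)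
    have "expect ?R (\<lambda>xs. expect ?R (\<lambda>ys. (?Q xs ys)\<^sup>2)) \<le> ?X"
      by (rule order_trans[OF expect_two_samples_sq_le[OF fp]], unfold pair_weight_mean \<mu>_def[symmetric],
          intro add_mono mult_left_mono marg)
         (use pair_weight_sq[OF \<theta>] in \<open>simp_all add: \<mu>_def\<close>)
    moreover have "?X / real s ^ 4 \<le> (2 * real n / real \<theta>)\<^sup>2 / (real s)\<^sup>2 * \<mu> + 65 * \<mu>\<^sup>2"
    proof -
      have "?X / real s ^ 4 = (2 * real n / real \<theta>)\<^sup>2 / (real s)\<^sup>2 * \<mu> + (64 * \<mu>\<^sup>2) / real s + \<mu>\<^sup>2"
      proof -
        have "(t\<^sup>2 * (a * u) + t ^ 3 * (32 * v) + t ^ 3 * (32 * v) + t ^ 4 * v) / t ^ 4 = a / t\<^sup>2 * u + (64 * v) / t + v"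
          if "t > 0" for t a u v :: real
          using that by (simp add: field_simps power2_eq_square power3_eq_cube power4_eq_xxxx)
        from this[OF s0] show ?thesis .
      qed
      moreover have "(64 * \<mu>\<^sup>2) / real s \<le> (64 * \<mu>\<^sup>2) / 1" using s by (intro divide_left_mono) auto
      ultimately show ?thesis by linarith
    qed
    moreover have "expect ?p (\<lambda>z. (snd z)\<^sup>2) = expect ?R (\<lambda>xs. expect ?R (\<lambda>ys. (?Q xs ys)\<^sup>2)) / real s ^ 4"
      using finE E_ne by (simp add: E avg_const power_divide flip: power_mult)
    ultimately show ?thesis unfolding snd using s0 by (smt (verit) divide_right_mono zero_le_power)
  qed
  have ratio: "expect ?p fst = d * expect ?p snd" unfolding fst snd using m_pos n0 by (simp add: d_eq \<mu>_def)
  have \<mu>0: "0 \<le> expect ?p snd" unfolding snd \<mu>_def using heavy_mean_nonneg[of \<theta>] m_pos by simp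
  let ?t = "(2 * real n / real \<theta>)\<^sup>2 / (real s)\<^sup>2"
  have t: "0 < ?t" using n0 s0 \<theta> by simp
  show ?thesis
  proof (rule estimates_ratio[OF computes_heavy_trial[OF s(2)] fin _ t eps, where a = "real n" and b = 0
        and a' = ?t and b' = 65 and K = 69])
    show "4 * ?t / ?t + 65 \<le> 69" using t by simp
    show "expect ?p (\<lambda>z. (snd z)\<^sup>2) \<le> ?t * expect ?p snd + 65 * (expect ?p snd)\<^sup>2" if "real n / 8 / 4 \<le> expect ?p fst"
      by (rule snd2[OF that])
    show "real n / 8 \<le> expect ?p fst \<and> ?t \<le> expect ?p snd"
      if "real n / 8 \<le> heavy_mean \<theta> / real n \<and> ?t \<le> heavy_mean \<theta> / (2 * m)"
      using that unfolding fst snd \<mu>_def .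
  qed (use ratio \<mu>0 fst2 N n0 t in auto)
qed

end

subsection \<open>The degree estimation algorithm\<close>

context graph
begin

text \<open>An edge without light endpoints contributes at least \<open>n\<^sup>2 / 4\<close>.
  Counting light endpoints instead of edges with a light endpoint gives a pointwise bound that is
  linear, so it can be summed by \<open>sum_endpoints\<close>.\<close>

lemma heavy_mean_ge:
  assumes "(\<Sum>x\<in>V. real (deg E x) * of_bool (2 * deg E x \<le> \<theta>)) \<le> m / 2"
  shows "(real n)\<^sup>2 / 8 \<le> heavy_mean \<theta>"
proof -
  let ?light = "\<lambda>e. \<Sum>x\<in>e. of_bool (2 * deg E x \<le> \<theta>) :: real"
  have "(real n)\<^sup>2 / 4 * (1 - ?light e) \<le> (\<Prod>x\<in>e. \<phi> \<theta> x)" if e: "e \<in> E" for e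
  proof (cases "\<forall>x\<in>e. \<theta> < 2 * deg E x")
    case True
    have "(\<Prod>x\<in>e. real n / 2) \<le> (\<Prod>x\<in>e. \<phi> \<theta> x)"
    proof (rule prod_mono)
      fix x assume x: "x \<in> e"
      then have "deg E x \<le> n" using deg_less[of x] edge(1)[OF e] by fastforce
      then show "0 \<le> real n / 2 \<and> real n / 2 \<le> \<phi> \<theta> x"
        using heavy_weight_ge[of \<theta> "deg E x" n] True x by (simp add: \<phi>_def \<omega>_def)
    qed
    moreover have "?light e = 0" using True by (intro sum.neutral) auto
    ultimately show ?thesis using edge(2)[OF e] by (simp add: power_divide)
  next
    case False
    then obtain x where x: "x \<in> e" "2 * deg E x \<le> \<theta>" by auto
    have "(\<Sum>x\<in>{x}. of_bool (2 * deg E x \<le> \<theta>) :: real) \<le> ?light e"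
      using x edge_fin_ne[OF e] by (intro sum_mono2) auto
    then have "(real n)\<^sup>2 / 4 * (1 - ?light e) \<le> 0" using x by (intro mult_nonneg_nonpos) auto
    also have "0 \<le> (\<Prod>x\<in>e. \<phi> \<theta> x)" by (intro prod_nonneg ballI \<phi>_bounds)
    finally show ?thesis .
  qed
  then have "(\<Sum>e\<in>E. (real n)\<^sup>2 / 4 * (1 - ?light e)) \<le> (\<Sum>e\<in>E. \<Prod>x\<in>e. \<phi> \<theta> x)"
    by (intro sum_mono)
  also have "(\<Sum>e\<in>E. (real n)\<^sup>2 / 4 * (1 - ?light e)) = (real n)\<^sup>2 / 4 * (m - (\<Sum>e\<in>E. ?light e))"
    unfolding sum_distrib_left[symmetric] sum_subtractf by (simp add: m_def)
  finally have 1: "(real n)\<^sup>2 / 4 * (m - (\<Sum>e\<in>E. ?light e)) \<le> (\<Sum>e\<in>E. \<Prod>x\<in>e. \<phi> \<theta> x)" .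
  have "(\<Sum>e\<in>E. ?light e) \<le> m / 2" unfolding sum_endpoints by (rule assms)
  then have "(real n)\<^sup>2 / 4 * (m / 2) \<le> (real n)\<^sup>2 / 4 * (m - (\<Sum>e\<in>E. ?light e))"
    by (intro mult_left_mono) auto
  then have "(real n)\<^sup>2 / 8 * m \<le> (\<Sum>e\<in>E. \<Prod>x\<in>e. \<phi> \<theta> x)" using 1 by linarith
  then show ?thesis using m_pos by (simp add: heavy_mean_def avg_def m_def le_divide_eq)
qed

text \<open>Take the least power of two below which a quarter of the total degree lies. If the light
  trial rejects there, the threshold exceeds \<open>d * s / 4\<close>; by minimality at least half
  of the edges join vertices above half the threshold, and the heavy trial accepts.\<close>

lemma some_trial_accepts:
  assumes n: "n \<le> 2 ^ l" and s: "5 * min d (root 4 (real n / d)) \<le> real s"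
  shows "d \<le> real s \<or> (\<exists>t\<le>l.
    (real (2 ^ t) / real s \<le> low_mass (2 ^ t) / real n \<and> 1 / 4 \<le> low_mass (2 ^ t) / (2 * m)) \<or>
    (real n / 8 \<le> heavy_mean (2 ^ t) / real n \<and>
      (2 * real n / real (2 ^ t))\<^sup>2 / (real s)\<^sup>2 \<le> heavy_mean (2 ^ t) / (2 * m)))"
proof (cases "d \<le> real s")
  case False
  define \<rho> where "\<rho> = root 4 (real n / d)"
  have n0: "real n > 0" using n_ge_2 by simp
  have d0: "d > 0" using d_bounds by simp
  have \<rho>4: "\<rho> ^ 4 = real n / d" and \<rho>0: "\<rho> > 0" using n0 d0 by (simp_all add: \<rho>_def)
  \<comment> \<open>The minimum cannot be \<open>d\<close>, since \<open>5 * d \<le> s\<close>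
    contradicts \<open>s < d\<close>.\<close>
  have s\<rho>: "5 * \<rho> \<le> real s" using s False d0 by (auto simp: \<rho>_def min_def split: if_splits)
  have s0: "real s > 0" using s\<rho> \<rho>0 by linarith
  have "low_mass (2 ^ l) = (\<Sum>x\<in>V. real (deg E x))"
    unfolding low_mass_def using deg_less n by (intro sum.cong refl) fastforce
  then have "1 / 4 \<le> low_mass (2 ^ l) / (2 * m)" using m_pos by (simp add: handshake)
  then have ex: "\<exists>t. 1 / 4 \<le> low_mass (2 ^ t) / (2 * m)" by blast
  define t where "t = (LEAST t. 1 / 4 \<le> low_mass (2 ^ t) / (2 * m))"
  have t: "1 / 4 \<le> low_mass (2 ^ t) / (2 * m)" unfolding t_def using ex by (rule LeastI_ex)
  have tl: "t \<le> l" unfolding t_def by (rule Least_le) fact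
  have below: "low_mass (2 ^ u) < m / 2" if "u < t" for u
    using not_less_Least[OF that[unfolded t_def]] m_pos by (simp add: field_simps)
  let ?\<theta> = "real (2 ^ t)"
  show ?thesis
  proof (cases "?\<theta> / real s \<le> low_mass (2 ^ t) / real n")
    case True
    then show ?thesis using t tl by blast
  next
    case False
    have "d / 4 \<le> low_mass (2 ^ t) / real n" using t m_pos n0 by (simp add: d_eq field_simps)
    then have "d / 4 < ?\<theta> / real s" using False by linarith
    then have \<theta>: "d * real s < 4 * ?\<theta>" using s0 by (simp add: field_simps)
    have "(\<Sum>x\<in>V. real (deg E x) * of_bool (2 * deg E x \<le> 2 ^ t)) \<le> m / 2"
    proof (cases t)
      \<comment> \<open>The threshold 1 cannot be halved, but no vertex has degree at most
        1/2.\<close>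
      case 0
      have "real (deg E x) * of_bool (2 * deg E x \<le> 2 ^ t) = 0" if "x \<in> V" for x
        using deg_pos[OF that] 0 by simp
      then have "(\<Sum>x\<in>V. real (deg E x) * of_bool (2 * deg E x \<le> 2 ^ t)) = 0" by (intro sum.neutral) blast
      then show ?thesis using m_pos by linarith
    next
      case (Suc u)
      then have "(\<Sum>x\<in>V. real (deg E x) * of_bool (2 * deg E x \<le> 2 ^ t)) = low_mass (2 ^ u)"
        by (simp add: low_mass_def)
      then show ?thesis using below[of u] Suc by simp
    qed
    then have F: "(real n)\<^sup>2 / 8 \<le> heavy_mean (2 ^ t)" by (rule heavy_mean_ge)
    have "real n / 8 \<le> heavy_mean (2 ^ t) / real n"
      using F n0 by (simp add: field_simps power2_eq_square)
    moreover have "(2 * real n / ?\<theta>)\<^sup>2 / (real s)\<^sup>2 \<le> heavy_mean (2 ^ t) / (2 * m)"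
    proof -
      have m: "2 * m = d * real n" using n0 by (simp add: d_eq)
      \<comment> \<open>The denominator test needs \<theta>^2 s^2 to be at least 32 d n, and
        \<theta> > d s / 4 reduces this to s^4 being at least 512 n / d. The factor 5 is the least
        integer with fourth power at least 512.\<close>
      have "625 * (real n / d) = (5 * \<rho>) ^ 4" by (simp add: power_mult_distrib \<rho>4)
      also have "\<dots> \<le> real s ^ 4" using s\<rho> \<rho>0 by (intro power_mono) auto
      finally have "625 * real n \<le> d * real s ^ 4" using d0 by (simp add: field_simps)
      then have "d * (625 * real n) \<le> d * (d * real s ^ 4)" using d0 by (intro mult_left_mono) auto
      also have "\<dots> = (d * real s)\<^sup>2 * (real s)\<^sup>2" by (simp add: power2_eq_square power4_eq_xxxx)
      also have "\<dots> \<le> (4 * ?\<theta>)\<^sup>2 * (real s)\<^sup>2"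
        using \<theta> d0 by (intro mult_right_mono power_mono) auto
      finally have k: "625 * (d * real n) \<le> 16 * (?\<theta>\<^sup>2 * (real s)\<^sup>2)" by (simp add: power_mult_distrib)
      have "0 \<le> d * real n" using d0 n0 by simp
      then have k': "32 * (d * real n) \<le> ?\<theta>\<^sup>2 * (real s)\<^sup>2" using k by linarith
      have "(2 * real n / ?\<theta>)\<^sup>2 / (real s)\<^sup>2 = 4 * (real n)\<^sup>2 / (?\<theta>\<^sup>2 * (real s)\<^sup>2)"
        by (simp add: power_mult_distrib power_divide)
      also have "\<dots> \<le> 4 * (real n)\<^sup>2 / (32 * (d * real n))"
        using k' d0 n0 s0 by (intro divide_left_mono) (auto intro!: mult_pos_pos)
      also have "\<dots> = ((real n)\<^sup>2 / 8) / (2 * m)" by (simp add: m)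
      also have "\<dots> \<le> heavy_mean (2 ^ t) / (2 * m)" using F m_pos by (intro divide_right_mono) auto
      finally show ?thesis .
    qed
    ultimately show ?thesis using tl by blast
  qed
qed simp

end

section \<open>Numerical parameters and the cost of one scale\<close>

definition log_ceil :: "nat \<Rightarrow> nat" where "log_ceil n = nat \<lceil>log 2 (real n)\<rceil>"
text \<open>The number of scales times the number of estimators per scale, namely one plus two for
  each threshold. Four scales more than \<open>log_ceil n\<close> reach
  \<open>s \<ge> 8 * n\<close>, enough for 5 times the minimum.\<close>

definition trials :: "nat \<Rightarrow> nat" where "trials n = (log_ceil n + 4) * (2 * log_ceil n + 3)"
definition digits :: "nat \<Rightarrow> nat" where "digits n = 2 * log_ceil n + 4"

text \<open>Each estimator may fail with probability \<open>1 / (100 * trials n)\<close>, so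
  together they fail with probability at most 1/100.\<close>

definition repetitions :: "nat \<Rightarrow> real \<Rightarrow> real \<Rightarrow> nat" where
  "repetitions n \<epsilon> K = nat \<lceil>32 * K / (1 / (100 * real (trials n)) * \<epsilon>\<^sup>2)\<rceil>"

definition light_estimator :: "nat \<Rightarrow> real \<Rightarrow> nat \<Rightarrow> nat \<Rightarrow> real option subroutine" where
  "light_estimator n \<epsilon> s \<theta> =
     estimator (real \<theta> / real s) (1 / 4) (repetitions n \<epsilon> (16 * real s)) (light_trial \<theta>)"

definition heavy_estimator :: "nat \<Rightarrow> real \<Rightarrow> nat \<Rightarrow> nat \<Rightarrow> real option subroutine" where
  "heavy_estimator n \<epsilon> s \<theta> =
     estimator (real n / 8) ((2 * real n / real \<theta>)\<^sup>2 / (real s)\<^sup>2) (repetitions n \<epsilon> 69) (heavy_trial n (digits n) \<theta> s)"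

definition level :: "nat \<Rightarrow> real \<Rightarrow> nat \<Rightarrow> real option subroutine list" where
  "level n \<epsilon> s = estimator 1 (1 / real s) (repetitions n \<epsilon> (4 * real s)) inverse_degree_trial #
     map (\<lambda>t. light_estimator n \<epsilon> s (2 ^ t)) [0..<Suc (log_ceil n)] @
     map (\<lambda>t. heavy_estimator n \<epsilon> s (2 ^ t)) [0..<Suc (log_ceil n)]"

definition degree_algorithm :: "nat \<Rightarrow> real \<Rightarrow> algorithm" where
  "degree_algorithm n \<epsilon> = first_accepted (concat (map (\<lambda>j. level n \<epsilon> (2 ^ j)) [0..<log_ceil n + 4]))"

lemma only_queries_degree_algorithm: "only_queries advanced_edge_queries (degree_algorithm n \<epsilon>)"
  unfolding degree_algorithm_def
  by (rule only_queries_first_accepted)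
     (auto simp: level_def light_estimator_def heavy_estimator_def uses_allowed_estimator)

lemma length_level: "length (level n \<epsilon> s) = 2 * log_ceil n + 3"
  by (simp add: level_def)

lemma length_levels: "length (concat (map (\<lambda>j. level n \<epsilon> (2 ^ j)) [0..<k])) = k * (2 * log_ceil n + 3)"
  by (simp add: length_concat comp_def length_level sum_list_triv)

lemma trials_pos: "0 < trials n"
  by (simp add: trials_def)

lemma repetitions_ge: "32 * K / (1 / (100 * real (trials n)) * \<epsilon>\<^sup>2) \<le> real (repetitions n \<epsilon> K)"
  unfolding repetitions_def by linarith

lemma repetitions_le:
  assumes "1 \<le> K" "0 < \<epsilon>" "\<epsilon> < 1"
  shows "real (repetitions n \<epsilon> K) \<le> 3300 * real (trials n) * K / \<epsilon>\<^sup>2"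
proof -
  define x where "x = real (trials n) * K / \<epsilon>\<^sup>2"
  have "1 \<le> real (trials n)" using trials_pos[of n] by linarith
  then have "1 * 1 \<le> real (trials n) * K" using assms by (intro mult_mono) auto
  moreover have "\<epsilon>\<^sup>2 \<le> 1" "\<epsilon>\<^sup>2 > 0" using assms by (auto simp: power_le_one)
  ultimately have "1 \<le> x" by (simp add: x_def le_divide_eq)
  moreover have "32 * K / (1 / (100 * real (trials n)) * \<epsilon>\<^sup>2) = 3200 * x" by (simp add: x_def)
  ultimately have "real (repetitions n \<epsilon> K) \<le> 3200 * x + 1" unfolding repetitions_def by linarith
  also have "\<dots> \<le> 3300 * x" using \<open>1 \<le> x\<close> by simp
  finally show ?thesis by (simp add: x_def)
qed

definition level_cost :: "nat \<Rightarrow> real \<Rightarrow> nat \<Rightarrow> nat" where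
  "level_cost n \<epsilon> s = nat \<lfloor>10 ^ 7 * real (trials n) * (real (digits n))\<^sup>2 * real s / \<epsilon>\<^sup>2\<rfloor>"

lemma level_cost_mono:
  assumes "s \<le> s'"
  shows "level_cost n \<epsilon> s \<le> level_cost n \<epsilon> s'"
  unfolding level_cost_def using assms
  by (intro nat_mono floor_mono divide_right_mono mult_left_mono) auto

text \<open>\<open>K\<close> governs the number of repetitions and \<open>c\<close> bounds the cost
  of each. Inverse degree and light trials have \<open>K\<close> of order \<open>s\<close> and
  constant cost; heavy trials have constant \<open>K\<close> and cost of order \<open>s\<close>
  times the squared number of digits. All products fit one bound, with 3300 * 3000 rounded up to
  10^7.\<close>

lemma level_costI:
  assumes "1 \<le> K" "0 < \<epsilon>" "\<epsilon> < 1" "K * real c \<le> 3000 * ((real (digits n))\<^sup>2 * real s)"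
  shows "repetitions n \<epsilon> K * c \<le> level_cost n \<epsilon> s"
proof -
  have "real (repetitions n \<epsilon> K * c) \<le> 3300 * real (trials n) * K / \<epsilon>\<^sup>2 * real c"
    unfolding of_nat_mult using repetitions_le[OF assms(1-3)] by (intro mult_right_mono) auto
  also have "\<dots> = 3300 * real (trials n) / \<epsilon>\<^sup>2 * (K * real c)" by simp
  also have "\<dots> \<le> 3300 * real (trials n) / \<epsilon>\<^sup>2 * (3000 * ((real (digits n))\<^sup>2 * real s))"
    by (intro mult_left_mono assms) auto
  also have "\<dots> = 9900000 * (real (trials n) * (real (digits n))\<^sup>2 * real s / \<epsilon>\<^sup>2)" by simp
  also have "\<dots> \<le> 10 ^ 7 * (real (trials n) * (real (digits n))\<^sup>2 * real s / \<epsilon>\<^sup>2)"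
    by (intro mult_right_mono) auto
  finally show ?thesis unfolding level_cost_def by (intro le_nat_floor) (simp add: mult.assoc)
qed

lemma digits_sq: "16 \<le> (real (digits n))\<^sup>2"
  using power_mono[of 4 "real (digits n)" 2] by (simp add: digits_def)

context graph
begin

lemma estimates_mono: "estimates P C \<eta> \<epsilon> acc \<Longrightarrow> C \<le> C' \<Longrightarrow> estimates P C' \<eta> \<epsilon> acc"
  unfolding estimates_def using computes_mono by blast

context
  fixes \<epsilon> :: real
  assumes \<epsilon>: "0 < \<epsilon>" "\<epsilon> < 1"
begin

abbreviation "\<eta> \<equiv> 1 / (100 * real (trials n))"

lemma \<eta>_pos: "0 < \<eta>"
  using trials_pos[of n] by simp

lemma inverse_degree_level:
  assumes "1 \<le> s"
  shows "estimates (estimator 1 (1 / real s) (repetitions n \<epsilon> (4 * real s)) inverse_degree_trial)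
    (level_cost n \<epsilon> s) \<eta> \<epsilon> (d \<le> real s)"
proof (rule estimates_mono[OF inverse_degree_estimates[OF \<epsilon> \<eta>_pos _ repetitions_ge]])
  have "4 * real s * real 2 \<le> 3000 * ((real (digits n))\<^sup>2 * real s)"
    using mult_right_mono[OF digits_sq of_nat_0_le_iff, of s n] unfolding of_nat_numeral by linarith
  then show "repetitions n \<epsilon> (4 * real s) * 2 \<le> level_cost n \<epsilon> s"
    by (intro level_costI \<epsilon>) (use assms in auto)
qed (use assms in simp)

lemma light_level:
  assumes "1 \<le> s"
  shows "estimates (light_estimator n \<epsilon> s (2 ^ t)) (level_cost n \<epsilon> s) \<eta> \<epsilon>
    (real (2 ^ t) / real s \<le> low_mass (2 ^ t) / real n \<and> 1 / 4 \<le> low_mass (2 ^ t) / (2 * m))"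
  unfolding light_estimator_def
proof (rule estimates_mono[OF light_estimates[OF \<epsilon> \<eta>_pos _ _ repetitions_ge]])
  have "16 * real s * real 4 \<le> 3000 * ((real (digits n))\<^sup>2 * real s)"
    using mult_right_mono[OF digits_sq of_nat_0_le_iff, of s n] unfolding of_nat_numeral by linarith
  then show "repetitions n \<epsilon> (16 * real s) * 4 \<le> level_cost n \<epsilon> s"
    by (intro level_costI \<epsilon>) (use assms in auto)
qed (use assms in auto)

lemma heavy_level:
  assumes "1 \<le> s" "s * n < 2 ^ digits n"
  shows "estimates (heavy_estimator n \<epsilon> s (2 ^ t)) (level_cost n \<epsilon> s) \<eta> \<epsilon>
    (real n / 8 \<le> heavy_mean (2 ^ t) / real n \<and>
      (2 * real n / real (2 ^ t))\<^sup>2 / (real s)\<^sup>2 \<le> heavy_mean (2 ^ t) / (2 * m))"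
  unfolding heavy_estimator_def
proof (rule estimates_mono[OF heavy_estimates[OF \<epsilon> \<eta>_pos assms _ repetitions_ge]])
  let ?B = "digits n"
  let ?c = "1 + (1 + (1 + (s * 2 + (s * 2 + 5 * ?B * ?B * (2 * s)))))"
  define y where "y = (real ?B)\<^sup>2 * real s"
  have "16 * 1 \<le> (real ?B)\<^sup>2 * real s" using digits_sq assms by (intro mult_mono) auto
  then have y16: "16 \<le> y" by (simp add: y_def)
  have ys: "16 * real s \<le> y" unfolding y_def using digits_sq by (intro mult_right_mono) auto
  have c: "real ?c = 3 + 4 * real s + 10 * y" by (simp add: y_def power2_eq_square)
  have "69 * (3 + 4 * a + 10 * b) \<le> 3000 * b" if "16 \<le> b" "16 * a \<le> b" for a b :: real
  proof -
    have "a \<le> b" "207 \<le> 207 * b" using that by simp_all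
    then show ?thesis by simp
  qed
  from this[OF y16 ys] have "69 * real ?c \<le> 3000 * y" unfolding c .
  then show "repetitions n \<epsilon> 69 * ?c \<le> level_cost n \<epsilon> s"
    by (intro level_costI \<epsilon>) (auto simp: y_def)
qed simp

lemma n_le_log_ceil: "n \<le> 2 ^ log_ceil n"
proof -
  have n0: "real n > 0" using n_ge_2 by simp
  have "log 2 (real n) \<le> real (log_ceil n)" unfolding log_ceil_def by linarith
  then have "real n \<le> 2 powr real (log_ceil n)" using n0 by (simp add: log_le_iff)
  then have "real n \<le> real (2 ^ log_ceil n)" by (simp add: powr_realpow)
  then show ?thesis by (simp only: of_nat_le_iff)
qed

lemma level_digits:
  assumes "j < log_ceil n + 4"
  shows "2 ^ j * n < 2 ^ digits n"
proof -
  have "2 ^ j * n \<le> 2 ^ (log_ceil n + 3) * 2 ^ log_ceil n"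
    using assms n_le_log_ceil by (intro mult_mono power_increasing) auto
  also have "\<dots> = 2 ^ (2 * log_ceil n + 3)"
    unfolding power_add[symmetric] by (rule arg_cong[where f = "power 2"]) simp
  also have "\<dots> < 2 ^ digits n" unfolding digits_def by (intro power_strict_increasing) auto
  finally show ?thesis .
qed

lemma level_estimates:
  assumes "P \<in> set (level n \<epsilon> (2 ^ j))" "j < log_ceil n + 4"
  shows "estimates P (level_cost n \<epsilon> (2 ^ j)) \<eta> \<epsilon> False"
proof -
  have weaken: "estimates P C h e acc \<Longrightarrow> estimates P C h e False" for P C h e acc
    by (auto simp: estimates_def)
  note B = level_digits[OF assms(2)]
  have 1: "1 \<le> (2 :: nat) ^ j" by simp
  show ?thesis
    using assms(1) inverse_degree_level[OF 1] light_level[OF 1] heavy_level[OF 1 B]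
    by (auto simp: level_def intro: weaken simp del: of_nat_power)
qed

lemma level_accepts:
  assumes "j < log_ceil n + 4" "5 * min d (root 4 (real n / d)) \<le> real (2 ^ j)"
  shows "\<exists>P\<in>set (level n \<epsilon> (2 ^ j)). estimates P (level_cost n \<epsilon> (2 ^ j)) \<eta> \<epsilon> True"
proof -
  note B = level_digits[OF assms(1)]
  have 1: "1 \<le> (2 :: nat) ^ j" by simp
  from some_trial_accepts[OF n_le_log_ceil assms(2)] show ?thesis
  proof (elim disjE exE conjE)
    assume "d \<le> real (2 ^ j)"
    then have "estimates (estimator 1 (1 / real (2 ^ j)) (repetitions n \<epsilon> (4 * real (2 ^ j))) inverse_degree_trial)
      (level_cost n \<epsilon> (2 ^ j)) \<eta> \<epsilon> True" using inverse_degree_level[OF 1] by (simp only:)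
    then show ?thesis unfolding level_def by (meson list.set_intros(1))
  next
    fix t assume t: "t \<le> log_ceil n"
      and a: "real (2 ^ t) / real (2 ^ j) \<le> low_mass (2 ^ t) / real n" "1 / 4 \<le> low_mass (2 ^ t) / (2 * m)"
    have "estimates (light_estimator n \<epsilon> (2 ^ j) (2 ^ t)) (level_cost n \<epsilon> (2 ^ j)) \<eta> \<epsilon> True"
      using light_level[OF 1, of t] a by (simp only: simp_thms)
    moreover have "t \<in> set [0..<Suc (log_ceil n)]" using t by (simp del: upt_Suc)
    then have "light_estimator n \<epsilon> (2 ^ j) (2 ^ t) \<in> set (level n \<epsilon> (2 ^ j))"
      unfolding level_def list.set(2) set_append set_map by blast
    ultimately show ?thesis by blast
  next
    fix t assume t: "t \<le> log_ceil n"
      and a: "real n / 8 \<le> heavy_mean (2 ^ t) / real n"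
        "(2 * real n / real (2 ^ t))\<^sup>2 / (real (2 ^ j))\<^sup>2 \<le> heavy_mean (2 ^ t) / (2 * m)"
    have "estimates (heavy_estimator n \<epsilon> (2 ^ j) (2 ^ t)) (level_cost n \<epsilon> (2 ^ j)) \<eta> \<epsilon> True"
      using heavy_level[OF 1 B, of t] a by (simp only: simp_thms)
    moreover have "t \<in> set [0..<Suc (log_ceil n)]" using t by (simp del: upt_Suc)
    then have "heavy_estimator n \<epsilon> (2 ^ j) (2 ^ t) \<in> set (level n \<epsilon> (2 ^ j))"
      unfolding level_def list.set(2) set_append set_map by blast
    ultimately show ?thesis by blast
  qed
qed

text \<open>All estimators listed before the accepting one belong to scales up to
  \<open>2 ^ j\<close>, so each of them costs at most as much as the scale \<open>2 ^ j\<close>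
  allows.\<close>

lemma degree_algorithm_hit:
  assumes "j < log_ceil n + 4" "5 * min d (root 4 (real n / d)) \<le> real (2 ^ j)"
  shows "99 / 100 \<le> hit V E (degree_algorithm n \<epsilon>) (eps_approx \<epsilon> d) (trials n * level_cost n \<epsilon> (2 ^ j))"
proof -
  let ?C = "level_cost n \<epsilon> (2 ^ j)" and ?L = "\<lambda>k. concat (map (\<lambda>j. level n \<epsilon> (2 ^ j)) [0..<k])"
  obtain P where P: "P \<in> set (level n \<epsilon> (2 ^ j))" "estimates P ?C \<eta> \<epsilon> True"
    using level_accepts[OF assms] by blast
  obtain as bs where ab: "level n \<epsilon> (2 ^ j) = as @ P # bs" using split_list[OF P(1)] by blast
  define Ps where "Ps = ?L j @ as"
  have "[0..<log_ceil n + 4] = [0..<j] @ j # [Suc j..<log_ceil n + 4]"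
    using assms(1) upt_add_eq_append[of 0 j "log_ceil n + 4 - j"] by (simp add: upt_conv_Cons)
  then obtain Ps' where L: "?L (log_ceil n + 4) = Ps @ P # Ps'"
    by (simp add: Ps_def ab)
  have len: "Suc (length Ps) \<le> trials n"
    using arg_cong[OF L, of length] unfolding length_levels trials_def by simp
  have "1 - real (Suc (length Ps)) * \<eta>
      \<le> hit V E (first_accepted (Ps @ P # Ps')) (eps_approx \<epsilon> d) (Suc (length Ps) * ?C)"
  proof (rule hit_first_accepted)
    fix R assume "R \<in> set Ps"
    have "\<exists>i\<le>j. R \<in> set (level n \<epsilon> (2 ^ i))"
    proof (cases "R \<in> set as")
      case True
      then have "R \<in> set (level n \<epsilon> (2 ^ j))" by (simp add: ab)
      then show ?thesis by blast
    next
      case False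
      then have "\<exists>i<j. R \<in> set (level n \<epsilon> (2 ^ i))" using \<open>R \<in> set Ps\<close> by (auto simp: Ps_def)
      then show ?thesis using less_imp_le by blast
    qed
    then obtain i where i: "i \<le> j" "R \<in> set (level n \<epsilon> (2 ^ i))" by blast
    have "estimates R ?C \<eta> \<epsilon> False"
      by (rule estimates_mono[OF level_estimates[OF i(2)] level_cost_mono]) (use i(1) assms(1) in auto)
    then show "\<exists>p. computes V E R p ?C \<and>
        1 - \<eta> \<le> measure_pmf.prob p {r. \<forall>x. r = Some x \<longrightarrow> x \<in> eps_approx \<epsilon> d}"
      by (auto simp: estimates_def)
  next
    show "\<exists>p. computes V E P p ?C \<and> 1 - \<eta> \<le> measure_pmf.prob p (Some ` eps_approx \<epsilon> d)"
      using P(2) by (auto simp: estimates_def)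
    show "real (Suc (length Ps)) * \<eta> \<le> 1"
      using len trials_pos[of n] by (simp add: divide_le_eq)
  qed (use \<eta>_pos in simp)
  moreover have "real (Suc (length Ps)) * \<eta> \<le> 1 / 100"
    using len trials_pos[of n] by (simp add: divide_le_eq)
  moreover have "hit V E (first_accepted (Ps @ P # Ps')) (eps_approx \<epsilon> d) (Suc (length Ps) * ?C)
      \<le> hit V E (degree_algorithm n \<epsilon>) (eps_approx \<epsilon> d) (trials n * ?C)"
    unfolding degree_algorithm_def L hit_def using mult_right_mono[OF len, of ?C]
    by (intro measure_pmf.finite_measure_mono) (auto simp: success_def)
  ultimately show ?thesis by linarith
qed

text \<open>For the last bound: if \<open>d\<close> exceeds n^(1/5), then n / d is below n^(4/5),
  whose fourth root is again n^(1/5).\<close>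

lemma min_bounds: "1 \<le> min d (root 4 (real n / d))" "min d (root 4 (real n / d)) \<le> real n"
  "min d (root 4 (real n / d)) \<le> real n powr (1 / 5)"
proof -
  have n0: "real n > 0" using n_ge_2 by simp
  have d0: "d > 0" using d_bounds by simp
  have "1 \<le> root 4 (real n / d)" using d_bounds d0 by simp
  then show "1 \<le> min d (root 4 (real n / d))" using d_bounds by simp
  show "min d (root 4 (real n / d)) \<le> real n" using d_bounds by simp
  show "min d (root 4 (real n / d)) \<le> real n powr (1 / 5)"
  proof (cases "d \<le> real n powr (1 / 5)")
    case False
    then have "real n / d \<le> real n / real n powr (1 / 5)" using n0 d0 by (intro divide_left_mono) auto
    also have "\<dots> = real n powr (1 - 1 / 5)" using n0 by (subst powr_diff) simp
    also have "\<dots> = (real n powr (1 / 5)) ^ 4" using n0 by (simp add: powr_power)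
    finally have "root 4 (real n / d) \<le> root 4 ((real n powr (1 / 5)) ^ 4)" by simp
    also have "\<dots> = real n powr (1 / 5)" by (intro real_root_power_cancel) auto
    finally show ?thesis by simp
  qed simp
qed

lemma log_ceil_bounds: "1 \<le> log_ceil n" "real (log_ceil n) \<le> 3 * ln (real n)"
proof -
  have n2: "real n \<ge> 2" using n_ge_2 by simp
  have "log 2 (real n) \<ge> log 2 2" using n2 by (subst log_le_cancel_iff) auto
  then have l1: "log 2 (real n) \<ge> 1" by simp
  then show "1 \<le> log_ceil n" unfolding log_ceil_def by linarith
  have "real (log_ceil n) \<le> log 2 (real n) + 1" unfolding log_ceil_def using l1 by linarith
  also have "\<dots> \<le> 2 * log 2 (real n)" using l1 by simp
  also have "\<dots> = 2 * ln (real n) / ln 2" by (simp add: log_def)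
  also have "\<dots> \<le> 2 * ln (real n) / (2 / 3)"
    using n2 ln2_ge_two_thirds by (intro divide_left_mono) auto
  finally show "real (log_ceil n) \<le> 3 * ln (real n)" by simp
qed

text \<open>Four of the six logarithms come from \<open>trials n\<close>, which enters once as the
  number of estimators and once through their failure probability; the other two come from the
  squared number of digits.\<close>

lemma cost_bound:
  assumes "real s \<le> 10 * \<mu>"
  shows "real (trials n * level_cost n \<epsilon> s) \<le> 2 * 10 ^ 15 * ln (real n) ^ 6 * (1 / \<epsilon>\<^sup>2) * \<mu>"
proof -
  let ?l = "real (log_ceil n)"
  have l1: "?l \<ge> 1" using log_ceil_bounds(1) by simp
  have T: "real (trials n) \<le> 25 * ?l\<^sup>2"
  proof -
    have "real (trials n) = (?l + 4) * (2 * ?l + 3)" by (simp add: trials_def)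
    also have "\<dots> \<le> (5 * ?l) * (5 * ?l)" using l1 by (intro mult_mono) auto
    finally show ?thesis by (simp add: power2_eq_square)
  qed
  have B: "(real (digits n))\<^sup>2 \<le> 36 * ?l\<^sup>2"
  proof -
    have "(real (digits n))\<^sup>2 \<le> (6 * ?l)\<^sup>2" using l1 by (intro power_mono) (auto simp: digits_def)
    then show ?thesis by (simp add: power_mult_distrib)
  qed
  have \<mu>0: "0 \<le> \<mu>" using assms by (smt (verit) of_nat_0_le_iff)
  have "real (level_cost n \<epsilon> s) \<le> 10 ^ 7 * real (trials n) * (real (digits n))\<^sup>2 * real s / \<epsilon>\<^sup>2"
    unfolding level_cost_def by (rule of_nat_floor) simp
  then have "real (trials n * level_cost n \<epsilon> s)
     \<le> real (trials n) * (10 ^ 7 * real (trials n) * (real (digits n))\<^sup>2 * real s / \<epsilon>\<^sup>2)"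
    unfolding of_nat_mult by (intro mult_left_mono) auto
  also have "\<dots> = 10 ^ 7 * (real (trials n) * real (trials n) * (real (digits n))\<^sup>2) * (real s / \<epsilon>\<^sup>2)" by simp
  also have "\<dots> \<le> 10 ^ 7 * ((25 * ?l\<^sup>2) * (25 * ?l\<^sup>2) * (36 * ?l\<^sup>2)) * (10 * \<mu> / \<epsilon>\<^sup>2)"
    using assms T B \<mu>0 by (intro mult_mono divide_right_mono mult_nonneg_nonneg) auto
  also have "\<dots> = 2250000000000 * ?l ^ 6 * (\<mu> / \<epsilon>\<^sup>2)" by (simp add: power2_eq_square power_numeral_reduce)
  also have "\<dots> \<le> 2250000000000 * (3 * ln (real n)) ^ 6 * (\<mu> / \<epsilon>\<^sup>2)"
    using log_ceil_bounds(2) \<mu>0 by (intro mult_right_mono mult_left_mono power_mono) auto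
  also have "\<dots> = 1640250000000000 * (ln (real n) ^ 6 * (\<mu> / \<epsilon>\<^sup>2))" by (simp add: power_mult_distrib)
  also have "\<dots> \<le> 2 * 10 ^ 15 * (ln (real n) ^ 6 * (\<mu> / \<epsilon>\<^sup>2))"
    using \<mu>0 n_ge_2 by (intro mult_right_mono mult_nonneg_nonneg) auto
  finally show ?thesis by simp
qed

lemma succeeds_mono: "succeeds V E A I b \<Longrightarrow> b \<le> b' \<Longrightarrow> succeeds V E A I b'"
  unfolding succeeds_def
  by (erule order_trans, intro measure_pmf.finite_measure_mono) auto

lemma degree_algorithm_succeeds:
  "succeeds V E (degree_algorithm n \<epsilon>) (eps_approx \<epsilon> d)
     (2 * 10 ^ 15 * ln (real n) ^ 6 * (1 / \<epsilon>\<^sup>2) * min d (root 4 (real n / d)))"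
proof -
  define \<mu> where "\<mu> = min d (root 4 (real n / d))"
  have "5 * \<mu> \<le> 8 * real n" using min_bounds unfolding \<mu>_def by linarith
  also have "real n \<le> real (2 ^ log_ceil n)" using n_le_log_ceil by (simp only: of_nat_le_iff)
  then have "8 * real n \<le> real (2 ^ (log_ceil n + 3))" by (simp add: power_add)
  finally have top: "5 * \<mu> \<le> real (2 ^ (log_ceil n + 3))" .
  \<comment> \<open>The least sufficient scale: minimality gives
    \<open>2 ^ j \<le> 10 * \<mu>\<close>, once \<open>j = 0\<close> is excluded by
    \<open>\<mu> \<ge> 1\<close>.\<close>
  define j where "j = (LEAST j. 5 * \<mu> \<le> real (2 ^ j))"
  have j: "5 * \<mu> \<le> real (2 ^ j)" unfolding j_def using top by (rule LeastI)
  have jl: "j \<le> log_ceil n + 3" unfolding j_def using top by (rule Least_le)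
  have "j \<noteq> 0"
  proof
    assume "j = 0"
    then show False using j min_bounds(1) by (simp add: \<mu>_def)
  qed
  then obtain i where i: "j = Suc i" using not0_implies_Suc by blast
  then have "\<not> 5 * \<mu> \<le> real (2 ^ i)" 
    using not_less_Least[of i "\<lambda>j. 5 * \<mu> \<le> real (2 ^ j)"] unfolding j_def[symmetric] by simp
  then have s: "real (2 ^ j) \<le> 10 * \<mu>" by (simp add: i)
  have "99 / 100 \<le> hit V E (degree_algorithm n \<epsilon>) (eps_approx \<epsilon> d) (trials n * level_cost n \<epsilon> (2 ^ j))"
    by (rule degree_algorithm_hit) (use j jl in \<open>auto simp: \<mu>_def\<close>)
  then have "succeeds V E (degree_algorithm n \<epsilon>) (eps_approx \<epsilon> d) (real (trials n * level_cost n \<epsilon> (2 ^ j)))"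
    unfolding succeeds_def hit_def
    by (elim order_trans) (intro measure_pmf.finite_measure_mono, auto simp: success_def simp flip: of_nat_mult)
  then show ?thesis using cost_bound[OF s] unfolding \<mu>_def by (rule succeeds_mono)
qed

lemma degree_algorithm_succeeds_powr:
  "succeeds V E (degree_algorithm n \<epsilon>) (eps_approx \<epsilon> d)
     (2 * 10 ^ 15 * ln (real n) ^ 6 * (1 / \<epsilon>\<^sup>2) * real n powr (1 / 5))"
  by (rule succeeds_mono[OF degree_algorithm_succeeds])
     (use min_bounds(3) n_ge_2 in \<open>intro mult_left_mono mult_nonneg_nonneg, auto\<close>)

end

end

theorem theorem1p2:
  "(\<exists>(A :: nat \<Rightarrow> real \<Rightarrow> algorithm) (C :: real) (k :: nat).
      \<forall>(n :: nat) (\<epsilon> :: real). 0 < \<epsilon> \<and> \<epsilon> < 1 \<longrightarrow>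
        only_queries advanced_edge_queries (A n \<epsilon>) \<and>
        (\<forall>V E. graph_on n V E \<longrightarrow>
          (let d = avg_degree V E in
            succeeds V E (A n \<epsilon>) (eps_approx \<epsilon> d)
              (C * ln (real n) ^ k * (1 / \<epsilon>\<^sup>2) * min d (root 4 (real n / d))) \<and>
            succeeds V E (A n \<epsilon>) (eps_approx \<epsilon> d)
              (C * ln (real n) ^ k * (1 / \<epsilon>\<^sup>2) * real n powr (1 / 5)))))
   \<and>
   (\<forall>Q \<in> {advanced_edge_queries, full_nbrhood_edge_queries}.
      \<forall>c :: real. c \<ge> 1 \<longrightarrow>
        (\<exists>\<delta> :: real. \<delta> > 0 \<and>
          (\<forall>\<^sub>F n :: nat in sequentially. \<forall>(A :: algorithm) (q :: real).
             only_queries Q A \<and>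
             (\<forall>V E. graph_on n V E \<longrightarrow>
                succeeds V E A (factor_approx c (avg_degree V E)) q)
             \<longrightarrow> q \<ge> \<delta> * real n powr (1 / 5))))"
proof (intro conjI ballI allI impI)
  show "\<exists>(A :: nat \<Rightarrow> real \<Rightarrow> algorithm) (C :: real) (k :: nat).
      \<forall>(n :: nat) (\<epsilon> :: real). 0 < \<epsilon> \<and> \<epsilon> < 1 \<longrightarrow>
        only_queries advanced_edge_queries (A n \<epsilon>) \<and>
        (\<forall>V E. graph_on n V E \<longrightarrow>
          (let d = avg_degree V E in
            succeeds V E (A n \<epsilon>) (eps_approx \<epsilon> d)
              (C * ln (real n) ^ k * (1 / \<epsilon>\<^sup>2) * min d (root 4 (real n / d))) \<and>
            succeeds V E (A n \<epsilon>) (eps_approx \<epsilon> d)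
              (C * ln (real n) ^ k * (1 / \<epsilon>\<^sup>2) * real n powr (1 / 5))))"
    unfolding Let_def
  proof (rule exI[of _ degree_algorithm], rule exI[of _ "2 * 10 ^ 15"], rule exI[of _ 6],
      intro allI impI conjI)
    fix n V E and \<epsilon> :: real
    assume "0 < \<epsilon> \<and> \<epsilon> < 1" and "graph_on n V E"
    then interpret graph n V E by unfold_locales
    show "succeeds V E (degree_algorithm n \<epsilon>) (eps_approx \<epsilon> d)
       (2 * 10 ^ 15 * ln (real n) ^ 6 * (1 / \<epsilon>\<^sup>2) * min d (root 4 (real n / d)))"
      "succeeds V E (degree_algorithm n \<epsilon>) (eps_approx \<epsilon> d)
       (2 * 10 ^ 15 * ln (real n) ^ 6 * (1 / \<epsilon>\<^sup>2) * real n powr (1 / 5))"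
      using \<open>0 < \<epsilon> \<and> \<epsilon> < 1\<close> degree_algorithm_succeeds degree_algorithm_succeeds_powr by blast+
  qed (rule only_queries_degree_algorithm)
next
  fix Q and c :: real
  assume "c \<ge> 1"
  from lower_bound[OF this] obtain \<delta> :: real where "\<delta> > 0"
    and ev: "\<forall>\<^sub>F n :: nat in sequentially. \<forall>(A :: algorithm) (q :: real).
      (\<forall>V E. graph_on n V E \<longrightarrow> succeeds V E A (factor_approx c (avg_degree V E)) q)
       \<longrightarrow> q \<ge> \<delta> * real n powr (1 / 5)" by blast
  \<comment> \<open>The bound already holds for algorithms that use all kinds of queries together,
    so it applies to both query sets.\<close>
  from ev have "\<forall>\<^sub>F n :: nat in sequentially. \<forall>(A :: algorithm) (q :: real).
      only_queries Q A \<and> (\<forall>V E. graph_on n V E \<longrightarrow> succeeds V E A (factor_approx c (avg_degree V E)) q)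
       \<longrightarrow> q \<ge> \<delta> * real n powr (1 / 5)"
    by eventually_elim blast
  with \<open>\<delta> > 0\<close> show "\<exists>\<delta> :: real. \<delta> > 0 \<and>
          (\<forall>\<^sub>F n :: nat in sequentially. \<forall>(A :: algorithm) (q :: real).
             only_queries Q A \<and>
             (\<forall>V E. graph_on n V E \<longrightarrow>
                succeeds V E A (factor_approx c (avg_degree V E)) q)
             \<longrightarrow> q \<ge> \<delta> * real n powr (1 / 5))" by blast
qed

end
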